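(* Let $p$ be a prime, $q$ a power of $p$, $\xi\in\mathbb{F}_q((T^{-1}))$ and $n$ a positive integer. Then $w_n(\xi)=w_n(\xi^p)$ and $w_n^*(\xi)=w_n^*(\xi^p)$.
   Context: $\mathbb{F}_q$ is the field with $q$ elements. For a nonzero $\xi=\sum_{k\ge N} a_k T^{-k}\in\mathbb{F}_q((T^{-1}))$ with $a_N\neq 0$, set $|\xi|=q^{-N}$, and $|0|=0$. The height $H(P)$ of $P\in\mathbb{F}_q[T][X]$ is the maximum of the absolute values of its coefficients. An element $\alpha$ of $\mathbb{F}_q((T^{-1}))$ is algebraic if it is a root of a nonzero polynomial in $\mathbb{F}_q[T][X]$; its degree and height $H(\alpha)$ are those of its minimal defining polynomial over $\mathbb{F}_q[T]$. $w_n(\xi)$ is the supremum of the real $w$ such that $0<|P(\xi)|<H(P)^{-w}$ has infinitely many solutions $P\in\mathbb{F}_q[T][X]$ of degree at most $n$. $w_n^*(\xi)$ is the supremum of the real $w^*$ such that $0<|\xi-\alpha|<H(\alpha)^{-w^*-1}$ has infinitely many solutions in algebraic $\alpha\in\mathbb{F}_q((T^{-1}))$ of degree at most $n$. *)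

theory Defs
  imports Complex_Main "HOL-Computational_Algebra.Computational_Algebra"
    "HOL-Library.Extended_Real" "HOL-Library.Cardinality"
begin

text \<open>
  The field \<open>F_q((T^{-1}))\<close> is rendered as \<^typ>\<open>'a fls\<close>, where \<^typ>\<open>'a\<close> is a finite field with
  \<open>q\<close> elements and the formal variable \<^term>\<open>fls_X\<close> stands for \<open>T^{-1}\<close>; thus \<open>T\<close> is
  \<^term>\<open>fls_X_inv\<close>, and the leading exponent \<open>N\<close> of a nonzero series is its
  \<^const>\<open>fls_subdegree\<close>.  The ring \<open>F_q[T][X]\<close> is \<^typ>\<open>'a poly poly\<close>, the inner polynomials
  being those in \<open>T\<close>.
\<close>

definition fls_abs :: "'a::{field,finite} fls \<Rightarrow> real" where
  "fls_abs \<xi> = (if \<xi> = 0 then 0 else real CARD('a) powi (- fls_subdegree \<xi>))"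

definition poly_to_fls :: "'a::field poly \<Rightarrow> 'a fls" where
  "poly_to_fls a = poly (map_poly fls_const a) fls_X_inv"

definition eval_fls :: "'a::field poly poly \<Rightarrow> 'a fls \<Rightarrow> 'a fls" where
  "eval_fls P \<xi> = poly (map_poly poly_to_fls P) \<xi>"

definition height_poly :: "'a::{field,finite} poly poly \<Rightarrow> real" where
  "height_poly P = Max ((\<lambda>i. fls_abs (poly_to_fls (coeff P i))) ` {..degree P})"

definition algebraic_fls :: "'a::field fls \<Rightarrow> bool" where
  "algebraic_fls \<alpha> \<longleftrightarrow> (\<exists>P. P \<noteq> 0 \<and> eval_fls P \<alpha> = 0)"

text \<open>
  The minimal defining polynomial over \<open>F_q[T]\<close>.  Irreducibility is meant in \<open>F_q[T][X]\<close>, so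
  that a polynomial of positive degree in \<open>X\<close> satisfying it is in particular primitive; the
  leading coefficient is required to be monic in \<open>T\<close>, which fixes the remaining unit of \<open>F_q\<close>.
  The description is meaningful only for algebraic \<open>\<alpha>\<close>.
\<close>

definition min_def_poly :: "'a::field fls \<Rightarrow> 'a poly poly" where
  "min_def_poly \<alpha> = (THE P. irreducible P \<and> 0 < degree P \<and>
     lead_coeff (lead_coeff P) = 1 \<and> eval_fls P \<alpha> = 0)"

definition degree_fls :: "'a::field fls \<Rightarrow> nat" where
  "degree_fls \<alpha> = degree (min_def_poly \<alpha>)"

definition height_fls :: "'a::{field,finite} fls \<Rightarrow> real" where
  "height_fls \<alpha> = height_poly (min_def_poly \<alpha>)"

text \<open>
  Both exponents may be infinite, so the suprema are taken in \<^typ>\<open>ereal\<close>.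
\<close>

definition w_exp :: "nat \<Rightarrow> 'a::{field,finite} fls \<Rightarrow> ereal" where
  "w_exp n \<xi> = Sup (ereal ` {w. infinite {P. degree P \<le> n \<and>
     0 < fls_abs (eval_fls P \<xi>) \<and> fls_abs (eval_fls P \<xi>) < height_poly P powr (- w)}})"

definition w_star_exp :: "nat \<Rightarrow> 'a::{field,finite} fls \<Rightarrow> ereal" where
  "w_star_exp n \<xi> = Sup (ereal ` {w. infinite {\<alpha>. algebraic_fls \<alpha> \<and> degree_fls \<alpha> \<le> n \<and>
     0 < fls_abs (\<xi> - \<alpha>) \<and> fls_abs (\<xi> - \<alpha>) < height_fls \<alpha> powr (- w - 1)}})"

end

theory Submission imports Defs "Jordan_Normal_Form.Char_Poly"
begin

text \<open>
  Write \<open>frob P\<close> for \<open>P\<close> with all coefficients raised to the power \<open>p\<close>, so that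
  \<open>(frob P)(\<xi>^p) = P(\<xi>)^p\<close>.  As \<open>F_q\<close> is perfect, every \<open>Q\<close> is \<open>\<Sum>\<^sub>j T^j frob P\<^sub>j\<close> with \<open>j < p\<close>, and the
  terms of \<open>Q(\<xi>^p) = \<Sum>\<^sub>j T^j P\<^sub>j(\<xi>)^p\<close> have distinct absolute values; hence a small value of
  \<open>Q\<close> at \<open>\<xi>^p\<close> yields a small value of some section \<open>P\<^sub>j\<close> at \<open>\<xi>\<close>.  This settles \<open>w\<^sub>n\<close>.

  For \<open>w\<^sub>n\<^sup>*\<close>, raising to the power \<open>p\<close> sends good approximations of \<open>\<xi>\<close> to good approximations of
  \<open>\<xi>^p\<close>.  Conversely let \<open>Q\<close> be the minimal polynomial of a \<open>\<beta>\<close> close to \<open>\<xi>^p\<close>.  If the sections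
  \<open>P\<^sub>j\<close> have a common factor, then \<open>\<beta>\<close> is a \<open>p\<close>-th power.  If \<open>\<beta>\<close> is metrically the only root of \<open>Q\<close>
  that close to \<open>\<xi>^p\<close>, then Hensel's lemma applies to a section.  Otherwise all sections have,
  metrically, a double root near \<open>\<xi>\<close>, and a resultant (or, if \<open>\<xi>\<close> is algebraic of degree at most
  \<open>n\<close>, Liouville's inequality) shows that \<open>\<beta>\<close> is no better an approximation than what a Wirsing-type
  argument provides for \<open>\<xi>\<close> anyway.
\<close>

subsection \<open>The absolute value\<close>

text \<open>Two obstacles keep \<open>Q\<close> from yielding an approximation of \<xi> directly.
  The p-th root of \<beta> generally lies in an inseparable extension and not in
  \<open>'a fls\<close>, so \<alpha> has to be produced as a root of a section; and the section that
  dominates the linear Taylor coefficient of \<open>Q\<close> at \<xi>^p need not dominate the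
  constant one, so vanishing at \<xi> has to be excluded. The double root case yields no \<alpha> at
  all. It is harmless because of a comparison of constants: with \<open>M = w + 1\<close>, such
  double roots occur for arbitrarily large heights only if \<open>4 * M \<le> 2 * n + 1\<close>,
  whereas the Wirsing-type argument supplies every \<open>M < (n + 1) / 2\<close>. For \<xi>
  algebraic of degree \<open>D \<le> n\<close> both thresholds are \<open>D / 2\<close>. Taking p-th
  roots of height and distance leaves the exponent unchanged, and a factor \<open>q\<close> lost in
  the height disappears in the limit.\<close>

lemma CARD_field_gt_1: "1 < CARD('a::{field,finite})"
proof -
  have "card {0, 1 :: 'a} \<le> CARD('a)" by (rule card_mono) auto
  thus ?thesis by simp
qed

lemma real_CARD_field_gt_1: "1 < real CARD('a::{field,finite})"
  using CARD_field_gt_1[where 'a = 'a] by simp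

lemma fls_abs_0 [simp]: "fls_abs 0 = 0"
  by (simp add: fls_abs_def)

lemma fls_abs_1 [simp]: "fls_abs 1 = 1"
  by (simp add: fls_abs_def)

lemma fls_abs_nonneg [simp]: "0 \<le> fls_abs x"
  by (simp add: fls_abs_def)

lemma fls_abs_eq_0_iff [simp]: "fls_abs x = 0 \<longleftrightarrow> x = 0"
  by (simp add: fls_abs_def)

lemma fls_abs_pos_iff [simp]: "0 < fls_abs x \<longleftrightarrow> x \<noteq> 0"
  using fls_abs_nonneg[of x] fls_abs_eq_0_iff[of x] by linarith

lemma fls_abs_le_0_iff [simp]: "fls_abs x \<le> 0 \<longleftrightarrow> x = 0"
  using fls_abs_pos_iff[of x] by linarith

lemma fls_abs_mult: "fls_abs (x * y) = fls_abs x * fls_abs (y :: 'a::{field,finite} fls)"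
proof -
  have "real CARD('a) \<noteq> 0" by simp
  thus ?thesis
    by (auto simp: fls_abs_def power_int_add[symmetric] algebra_simps)
qed

lemma fls_abs_power: "fls_abs (x ^ n) = fls_abs x ^ n"
  by (induction n) (auto simp: fls_abs_mult)

lemma fls_abs_prod: "fls_abs (\<Prod>i\<in>I. f i) = (\<Prod>i\<in>I. fls_abs (f i))"
  by (induction I rule: infinite_finite_induct) (auto simp: fls_abs_mult)

lemma fls_abs_uminus [simp]: "fls_abs (- x) = fls_abs x"
  by (simp add: fls_abs_def)

lemma fls_abs_minus_commute: "fls_abs (x - y) = fls_abs (y - x)"
  by (metis fls_abs_uminus minus_diff_eq)

lemma fls_abs_divide: "fls_abs (x / y) = fls_abs x / fls_abs (y :: 'a::{field,finite} fls)"
proof (cases "y = 0")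
  case False
  hence "fls_abs (x / y) * fls_abs y = fls_abs x"
    by (simp flip: fls_abs_mult)
  with False show ?thesis by (simp add: field_simps)
qed auto

lemma fls_abs_X_inv [simp]: "fls_abs (fls_X_inv :: 'a::{field,finite} fls) = real CARD('a)"
  by (simp add: fls_abs_def)

text \<open>Closed balls are defined by the vanishing of initial coefficients, so they are additive
  subgroups. This gives the ultrametric inequality and lets limits and pigeonhole arguments work
  coefficientwise.\<close>

lemma fls_abs_le_powi_iff:
  "fls_abs (x :: 'a::{field,finite} fls) \<le> real CARD('a) powi (- k) \<longleftrightarrow> (\<forall>i<k. fls_nth x i = 0)"
proof (cases "x = 0")
  case False
  have q: "1 < real CARD('a)" by (rule real_CARD_field_gt_1)
  have "fls_abs x \<le> real CARD('a) powi (- k) \<longleftrightarrow> k \<le> fls_subdegree x"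
  proof
    assume "fls_abs x \<le> real CARD('a) powi (- k)"
    thus "k \<le> fls_subdegree x"
      using False q power_int_strict_increasing[of "- k" "- fls_subdegree x" "real CARD('a)"]
      by (cases "fls_subdegree x < k") (auto simp: fls_abs_def)
  next
    assume "k \<le> fls_subdegree x"
    thus "fls_abs x \<le> real CARD('a) powi (- k)"
      using False q power_int_increasing[of "- fls_subdegree x" "- k" "real CARD('a)"]
      by (simp add: fls_abs_def)
  qed
  also have "\<dots> \<longleftrightarrow> (\<forall>i<k. fls_nth x i = 0)"
    using False fls_subdegree_geI[of x k] nth_fls_subdegree_nonzero[OF False]
    by (meson fls_eq0_below_subdegree not_le order_less_le_trans)
  finally show ?thesis .
qed auto

lemma fls_abs_add_le_max: "fls_abs (x + y) \<le> max (fls_abs x) (fls_abs (y :: 'a::{field,finite} fls))"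
proof -
  have *: "fls_abs (x + y) \<le> fls_abs x" if "fls_abs y \<le> fls_abs x" for x y :: "'a fls"
  proof (cases "x = 0")
    case True
    thus ?thesis using that by simp
  next
    case False
    define k where "k = fls_subdegree x"
    have k: "fls_abs x = real CARD('a) powi (- k)"
      using False by (simp add: fls_abs_def k_def)
    have "\<forall>i<k. fls_nth x i = 0" "\<forall>i<k. fls_nth y i = 0"
      using that k fls_abs_le_powi_iff[of x k] fls_abs_le_powi_iff[of y k] by auto
    thus ?thesis
      unfolding k fls_abs_le_powi_iff by simp
  qed
  show ?thesis
    using *[of y x] *[of x y] by (cases "fls_abs y \<le> fls_abs x") (auto simp: add.commute)
qed

lemma fls_abs_add_le:
  "fls_abs x \<le> B \<Longrightarrow> fls_abs y \<le> B \<Longrightarrow> fls_abs (x + y) \<le> B"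
  using fls_abs_add_le_max[of x y] by linarith

lemma fls_abs_diff_le:
  "fls_abs x \<le> B \<Longrightarrow> fls_abs y \<le> B \<Longrightarrow> fls_abs (x - y) \<le> B"
  using fls_abs_add_le[of x B "- y"] by simp

lemma fls_abs_sum_le:
  assumes "\<And>i. i \<in> I \<Longrightarrow> fls_abs (f i) \<le> B" "0 \<le> B"
  shows "fls_abs (\<Sum>i\<in>I. f i) \<le> B"
  using assms by (induction I rule: infinite_finite_induct) (auto intro: fls_abs_add_le)

lemma fls_abs_add_eq:
  assumes "fls_abs y < fls_abs x"
  shows "fls_abs (x + y) = fls_abs x"
proof (rule antisym)
  show "fls_abs (x + y) \<le> fls_abs x" using fls_abs_add_le_max[of x y] assms by simp
  show "fls_abs x \<le> fls_abs (x + y)"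
    using fls_abs_add_le_max[of "x + y" "- y"] assms by (simp add: max_def split: if_splits)
qed

text \<open>A largest nonzero term strictly exceeds all others and cannot be cancelled. Zero terms
  are exempt from distinctness because several sections may contribute zero at once.\<close>

lemma fls_abs_sum_distinct:
  assumes "finite J"
    and "\<And>i j. i \<in> J \<Longrightarrow> j \<in> J \<Longrightarrow> i \<noteq> j \<Longrightarrow> y i \<noteq> 0 \<Longrightarrow> y j \<noteq> 0 \<Longrightarrow> fls_abs (y i) \<noteq> fls_abs (y j)"
    and "J \<noteq> {}"
  shows "\<exists>i\<in>J. fls_abs (\<Sum>j\<in>J. y j) = fls_abs (y i) \<and> (\<forall>j\<in>J. fls_abs (y j) \<le> fls_abs (y i))"
  using assms(1,3,2)
proof (induction J rule: finite_ne_induct)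
  case (singleton x)
  thus ?case by simp
next
  case (insert a J)
  from insert.IH insert.prems obtain i where
    i: "i \<in> J" "fls_abs (\<Sum>j\<in>J. y j) = fls_abs (y i)" "\<forall>j\<in>J. fls_abs (y j) \<le> fls_abs (y i)"
    by (metis insertCI)
  have ai: "a \<noteq> i" using insert i by auto
  consider "y i = 0" | "y i \<noteq> 0" "fls_abs (y a) < fls_abs (y i)" | "fls_abs (y i) < fls_abs (y a)"
    using insert.prems[of a i] ai i by (metis fls_abs_pos_iff insertCI linorder_neqE_linordered_idom)
  thus ?case
  proof cases
    case 1
    hence "(\<Sum>j\<in>J. y j) = 0" "\<forall>j\<in>J. y j = 0" using i by auto
    thus ?thesis using insert by auto
  next
    case 2
    hence "fls_abs (\<Sum>j\<in>insert a J. y j) = fls_abs (y i)"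
      using insert i fls_abs_add_eq[of "y a" "\<Sum>j\<in>J. y j"] by (simp add: add.commute)
    thus ?thesis using i 2 by (intro bexI[of _ i]) auto
  next
    case 3
    hence "fls_abs (\<Sum>j\<in>insert a J. y j) = fls_abs (y a)"
      using insert i fls_abs_add_eq[of "\<Sum>j\<in>J. y j" "y a"] by simp
    thus ?thesis using i 3 by (intro bexI[of _ a]) force+
  qed
qed

subsection \<open>Polynomials over the polynomial ring\<close>

interpretation fls_const_hom: inj_idom_hom "fls_const :: 'a::field \<Rightarrow> 'a fls"
  by unfold_locales (auto simp: fls_plus_const fls_const_mult_const fls_eq_iff split: if_splits)

lemma poly_to_fls_pCons: "poly_to_fls (pCons c a) = fls_const c + fls_X_inv * poly_to_fls a"
  by (simp add: poly_to_fls_def fls_const_hom.map_poly_pCons_hom)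

lemma poly_to_fls_0 [simp]: "poly_to_fls 0 = 0"
  by (simp add: poly_to_fls_def)

lemma poly_to_fls_nth: "fls_nth (poly_to_fls a) k = (if k \<le> 0 then coeff a (nat (- k)) else 0)"
proof (induction a arbitrary: k)
  case (pCons c a)
  show ?case
  proof (cases "k < 0")
    case True
    hence "nat (- k) = Suc (nat (- (k + 1)))" by simp
    with True pCons.IH[of "k + 1"] show ?thesis
      by (simp add: poly_to_fls_pCons fls_X_inv_times_conv_shift)
  qed (use pCons.IH[of "k + 1"] in \<open>auto simp: poly_to_fls_pCons fls_X_inv_times_conv_shift\<close>)
qed auto

interpretation poly_to_fls_hom: inj_idom_hom "poly_to_fls :: 'a::field poly \<Rightarrow> 'a fls"
proof unfold_locales
  interpret map_poly_comm_ring_hom "fls_const :: 'a \<Rightarrow> 'a fls" ..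
  fix a b :: "'a poly"
  show "poly_to_fls (a + b) = poly_to_fls a + poly_to_fls b"
    by (simp add: poly_to_fls_def hom_add)
  show "poly_to_fls (a * b) = poly_to_fls a * poly_to_fls b"
    by (simp add: poly_to_fls_def hom_mult)
  show "poly_to_fls (1 :: 'a poly) = 1"
    by (simp add: poly_to_fls_def)
  show "a = 0" if "poly_to_fls a = 0"
  proof (rule poly_eqI)
    fix n
    show "coeff a n = coeff 0 n"
      using that poly_to_fls_nth[of a "- int n"] by simp
  qed
qed simp

interpretation poly_to_fls_poly_hom: map_poly_inj_idom_hom "poly_to_fls :: 'a::field poly \<Rightarrow> 'a fls" ..

lemma poly_to_fls_monom: "poly_to_fls (monom 1 j) = fls_X_inv ^ j"
  by (induction j) (auto simp: monom_Suc poly_to_fls_pCons)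

lemma fls_abs_poly_to_fls:
  "a \<noteq> 0 \<Longrightarrow> fls_abs (poly_to_fls (a :: 'a::{field,finite} poly)) = real CARD('a) ^ degree a"
proof -
  assume a: "a \<noteq> 0"
  have "fls_subdegree (poly_to_fls a) = - int (degree a)"
    using a by (intro fls_subdegree_eqI) (auto simp: poly_to_fls_nth coeff_eq_0)
  thus ?thesis using a by (simp add: fls_abs_def)
qed

lemma fls_abs_poly_to_fls_ge_1:
  fixes a :: "'a::{field,finite} poly"
  shows "a \<noteq> 0 \<Longrightarrow> 1 \<le> fls_abs (poly_to_fls a)"
  using CARD_field_gt_1[where 'a = 'a] by (simp add: fls_abs_poly_to_fls)

text \<open>The coefficients are the Hasse derivatives of \<open>P\<close> at \<xi>. Recentring
  provides them without division by factorials, which may vanish in characteristic p.\<close>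

definition taylor :: "'a::field poly poly \<Rightarrow> 'a fls \<Rightarrow> 'a fls poly" where
  "taylor P \<xi> = map_poly poly_to_fls P \<circ>\<^sub>p [:\<xi>, 1:]"

lemma taylor_mult: "taylor (P * Q) \<xi> = taylor P \<xi> * taylor Q \<xi>"
  by (simp add: taylor_def hom_distribs pcompose_mult)

lemma taylor_add: "taylor (P + Q) \<xi> = taylor P \<xi> + taylor Q \<xi>"
  by (simp add: taylor_def hom_distribs pcompose_add)

lemma taylor_const: "taylor [:c:] \<xi> = [:poly_to_fls c:]"
  by (simp add: taylor_def poly_to_fls_hom.map_poly_pCons_hom)

lemma degree_taylor [simp]: "degree (taylor P \<xi>) = degree P"
  by (simp add: taylor_def)

lemma taylor_eq_0_iff [simp]: "taylor P \<xi> = 0 \<longleftrightarrow> P = 0"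
  by (simp add: taylor_def pcompose_eq_0_iff)

lemma taylor_sum: "taylor (\<Sum>j\<in>J. F j) \<xi> = (\<Sum>j\<in>J. taylor (F j) \<xi>)"
  by (induction J rule: infinite_finite_induct) (auto simp: taylor_add)

lemma lead_coeff_taylor: "coeff (taylor P \<xi>) (degree P) = poly_to_fls (lead_coeff P)"
proof -
  have "lead_coeff (map_poly poly_to_fls P \<circ>\<^sub>p [:\<xi>, 1:]) = poly_to_fls (lead_coeff P)"
    by (subst lead_coeff_comp) auto
  thus ?thesis by (simp add: taylor_def)
qed

lemma coeff_0_taylor: "coeff (taylor P \<xi>) 0 = eval_fls P \<xi>"
  by (simp add: taylor_def eval_fls_def poly_pcompose flip: poly_0_coeff_0)

lemma poly_taylor: "poly (taylor P \<xi>) x = eval_fls P (\<xi> + x)"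
  by (simp add: taylor_def eval_fls_def poly_pcompose)

lemma eval_fls_mult [simp]: "eval_fls (P * Q) \<xi> = eval_fls P \<xi> * eval_fls Q \<xi>"
  by (simp add: eval_fls_def hom_distribs)

lemma eval_fls_add [simp]: "eval_fls (P + Q) \<xi> = eval_fls P \<xi> + eval_fls Q \<xi>"
  by (simp add: eval_fls_def hom_distribs)

lemma eval_fls_const [simp]: "eval_fls [:c:] \<xi> = poly_to_fls c"
  by (simp add: eval_fls_def poly_to_fls_hom.map_poly_pCons_hom)

lemma eval_fls_0 [simp]: "eval_fls 0 \<xi> = 0"
  by (simp add: eval_fls_def)

section \<open>Heights of polynomials and finiteness below a given height\<close>

lemma height_poly_le_iff:
  "height_poly P \<le> B \<longleftrightarrow> (\<forall>i. fls_abs (poly_to_fls (coeff P i)) \<le> B)" if "0 \<le> B"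
proof -
  have "height_poly P \<le> B \<longleftrightarrow> (\<forall>i\<le>degree P. fls_abs (poly_to_fls (coeff P i)) \<le> B)"
    by (auto simp: height_poly_def)
  also have "\<dots> \<longleftrightarrow> (\<forall>i. fls_abs (poly_to_fls (coeff P i)) \<le> B)"
  proof safe
    fix i assume "\<forall>i\<le>degree P. fls_abs (poly_to_fls (coeff P i)) \<le> B"
    thus "fls_abs (poly_to_fls (coeff P i)) \<le> B"
      using that by (cases "i \<le> degree P") (auto simp: coeff_eq_0)
  qed auto
  finally show ?thesis .
qed

lemma coeff_le_height_poly: "fls_abs (poly_to_fls (coeff P i)) \<le> height_poly P"
proof -
  have "fls_abs (poly_to_fls (coeff P 0)) \<le> height_poly P"
    by (simp add: height_poly_def)
  hence "0 \<le> height_poly P" using fls_abs_nonneg order_trans by blast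
  thus ?thesis using height_poly_le_iff by blast
qed

lemma height_poly_nonneg [simp]: "0 \<le> height_poly P"
  using coeff_le_height_poly[of P 0] fls_abs_nonneg order_trans by blast

lemma height_poly_attained: "\<exists>i. height_poly P = fls_abs (poly_to_fls (coeff P i))"
proof -
  have "height_poly P \<in> (\<lambda>i. fls_abs (poly_to_fls (coeff P i))) ` {..degree P}"
    unfolding height_poly_def by (rule Max_in) auto
  thus ?thesis by auto
qed

lemma height_poly_ge_1: "P \<noteq> 0 \<Longrightarrow> 1 \<le> height_poly P"
  using coeff_le_height_poly[of P "degree P"] fls_abs_poly_to_fls_ge_1[of "lead_coeff P"]
  by auto

text \<open>The height bounds the T-degree of every coefficient, and the field of constants is
  finite, so only finitely many coefficients are possible.\<close>

lemma finite_height_poly_le: "finite {P :: 'a::{field,finite} poly poly. degree P \<le> n \<and> height_poly P \<le> X}"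
proof -
  have fin: "finite {a :: 'a poly. degree a \<le> m}" for m
  proof (induction m)
    case 0
    have "{a :: 'a poly. degree a \<le> 0} \<subseteq> (\<lambda>c. [:c:]) ` UNIV"
      by (auto elim!: degree_eq_zeroE)
    thus ?case by (rule finite_subset) simp
  next
    case (Suc m)
    have "{a :: 'a poly. degree a \<le> Suc m} \<subseteq> (\<lambda>(c, a). pCons c a) ` (UNIV \<times> {a. degree a \<le> m})"
    proof
      fix a :: "'a poly" assume a: "a \<in> {a. degree a \<le> Suc m}"
      obtain c b where "a = pCons c b" by (cases a) auto
      thus "a \<in> (\<lambda>(c, a). pCons c a) ` (UNIV \<times> {a. degree a \<le> m})"
        using a by (cases "b = 0") auto
    qed
    thus ?case by (rule finite_subset) (use Suc in simp)
  qed
  have fin2: "finite {P :: 'a poly poly. degree P \<le> m \<and> (\<forall>i. coeff P i \<in> A)}" if "finite A" for A m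
  proof (induction m)
    case 0
    have "{P :: 'a poly poly. degree P \<le> 0 \<and> (\<forall>i. coeff P i \<in> A)} \<subseteq> (\<lambda>c. [:c:]) ` A"
    proof
      fix P assume "P \<in> {P :: 'a poly poly. degree P \<le> 0 \<and> (\<forall>i. coeff P i \<in> A)}"
      hence "P = [:coeff P 0:]" "coeff P 0 \<in> A" by (auto simp: degree_0_id)
      thus "P \<in> (\<lambda>c. [:c:]) ` A" by blast
    qed
    thus ?case by (rule finite_subset) (use that in simp)
  next
    case (Suc m)
    have "{P :: 'a poly poly. degree P \<le> Suc m \<and> (\<forall>i. coeff P i \<in> A)}
      \<subseteq> (\<lambda>(c, a). pCons c a) ` (A \<times> {P. degree P \<le> m \<and> (\<forall>i. coeff P i \<in> A)})"
    proof
      fix P assume P: "P \<in> {P :: 'a poly poly. degree P \<le> Suc m \<and> (\<forall>i. coeff P i \<in> A)}"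
      obtain c b where cb: "P = pCons c b" by (cases P) auto
      have "c \<in> A" using P cb by (metis (mono_tags, lifting) coeff_pCons_0 mem_Collect_eq)
      moreover have "coeff b i \<in> A" for i
        using P cb by (metis (mono_tags, lifting) coeff_pCons_Suc mem_Collect_eq)
      moreover have "degree b \<le> m" using P cb by (cases "b = 0") auto
      ultimately show "P \<in> (\<lambda>(c, a). pCons c a) ` (A \<times> {P. degree P \<le> m \<and> (\<forall>i. coeff P i \<in> A)})"
        using cb by auto
    qed
    thus ?case by (rule finite_subset) (use Suc that in simp)
  qed
  have q: "1 < real CARD('a)" by (rule real_CARD_field_gt_1)
  then obtain m where m: "X < real CARD('a) ^ m" using real_arch_pow by blast
  have "{P :: 'a poly poly. degree P \<le> n \<and> height_poly P \<le> X} \<subseteq>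
    {P. degree P \<le> n \<and> (\<forall>i. coeff P i \<in> {a. degree a \<le> m})}"
  proof safe
    fix P :: "'a poly poly" and i assume P: "height_poly P \<le> X"
    show "degree (coeff P i) \<le> m"
    proof (cases "coeff P i = 0")
      case False
      have "real CARD('a) ^ degree (coeff P i) \<le> X"
        using coeff_le_height_poly[of P i] P False by (simp add: fls_abs_poly_to_fls)
      thus ?thesis using m q by (meson less_imp_le order_le_less_trans power_less_imp_less_exp)
    qed auto
  qed
  thus ?thesis by (rule finite_subset) (rule fin2[OF fin])
qed

subsection \<open>Divisibility in the bivariate polynomial ring\<close>

lemma poly_irreducible_factor_exists:
  assumes "0 < degree (c :: 'a::field poly)"
  shows "\<exists>\<pi>. irreducible \<pi> \<and> \<pi> dvd c \<and> 0 < degree \<pi>"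
proof -
  obtain \<pi> where \<pi>: "\<pi> dvd c" "0 < degree \<pi>"
    and min: "\<And>\<rho>. \<rho> dvd c \<Longrightarrow> 0 < degree \<rho> \<Longrightarrow> degree \<pi> \<le> degree \<rho>"
    using ex_has_least_nat[of "\<lambda>\<pi>. \<pi> dvd c \<and> 0 < degree \<pi>" c degree] assms by auto
  have "irreducible \<pi>"
  proof (rule irreducibleI)
    show "\<pi> \<noteq> 0" using \<pi> by auto
    show "\<not> \<pi> dvd 1" using \<pi> by (auto simp: is_unit_poly_iff)
    fix a b assume ab: "\<pi> = a * b"
    with \<pi> have nz: "a \<noteq> 0" "b \<noteq> 0" by auto
    have "degree a = 0 \<or> degree b = 0"
      using min[of a] min[of b] \<pi> ab nz by (auto simp: degree_mult_eq intro: dvd_trans)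
    thus "a dvd 1 \<or> b dvd 1"
      using nz by (metis is_unit_iff_degree)
  qed
  with \<pi> show ?thesis by blast
qed

text \<open>The rings of constants lack gcds in the class hierarchy, so Gauss's lemma is proved by
  distributing the prime factors of the constant over the two factors.\<close>
lemma const_mult_split:
  fixes D B P :: "'a::field poly poly"
  assumes "c \<noteq> 0" "D * B = [:c:] * P"
  shows "\<exists>c1 c2 D' B'. D = [:c1:] * D' \<and> B = [:c2:] * B' \<and> D' * B' = P"
  using assms
proof (induction "degree c" arbitrary: c D B rule: less_induct)
  case less
  show ?case
  proof (cases "degree c = 0")
    case True
    then obtain u where u: "c = [:u:]" "u \<noteq> 0" using less by (auto elim!: degree_eq_zeroE)
    have "[:[:1 / u:]:] * [:c:] = 1" using u by (simp add: one_pCons)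
    hence uc: "[:[:1 / u:]:] * ([:c:] * F) = F" for F :: "'a poly poly"
      by (simp only: mult.assoc[symmetric] mult_1)
    have "D * ([:[:1 / u:]:] * B) = P"
      using uc[of P] by (simp only: mult.left_commute[of D] less.prems(2))
    moreover have "B = [:c:] * ([:[:1 / u:]:] * B)"
      using uc[of B] by (simp only: mult.left_commute)
    moreover have "D = [:1:] * D" by simp
    ultimately show ?thesis by blast
  next
    case False
    then obtain \<pi> where \<pi>: "irreducible \<pi>" "\<pi> dvd c" "0 < degree \<pi>"
      using poly_irreducible_factor_exists by blast
    then obtain e where e: "c = \<pi> * e" by blast
    \<comment> \<open>A prime of the ring of constants stays prime in the polynomial ring, so it
      divides one of the two factors.\<close>
    have prime: "prime_elem [:\<pi>:]"
      using \<pi> by (intro lift_prime_elem_poly field_poly_irreducible_imp_prime)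
    have ce: "[:c:] = [:\<pi>:] * [:e:]" using e by simp
    have nz: "[:\<pi>:] \<noteq> 0" "e \<noteq> 0" using e less.prems by auto
    have deg: "degree e < degree c" using e less.prems \<pi> nz by (simp add: degree_mult_eq)
    have "[:\<pi>:] dvd D * B" unfolding less.prems ce by (simp only: mult.assoc dvd_triv_left)
    then consider "[:\<pi>:] dvd D" | "[:\<pi>:] dvd B" using prime prime_elem_dvd_multD by blast
    thus ?thesis
    proof cases
      case 1
      then obtain D1 where D1: "D = [:\<pi>:] * D1" by blast
      have "[:\<pi>:] * (D1 * B) = [:\<pi>:] * ([:e:] * P)"
        using less.prems(2) unfolding D1 ce by (simp only: mult.assoc)
      hence "D1 * B = [:e:] * P" using nz mult_left_cancel by blast
      from less.hyps[OF deg nz(2) this] obtain c1 c2 D' B' where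
        "D1 = [:c1:] * D'" "B = [:c2:] * B'" "D' * B' = P" by blast
      moreover from this have "D = [:\<pi> * c1:] * D'" unfolding D1 by (simp add: mult.commute)
      ultimately show ?thesis by blast
    next
      case 2
      then obtain B1 where B1: "B = [:\<pi>:] * B1" by blast
      have "[:\<pi>:] * (D * B1) = [:\<pi>:] * ([:e:] * P)"
        using less.prems(2) unfolding B1 ce by (simp only: mult.assoc mult.left_commute)
      hence "D * B1 = [:e:] * P" using nz mult_left_cancel by blast
      from less.hyps[OF deg nz(2) this] obtain c1 c2 D' B' where
        "D = [:c1:] * D'" "B1 = [:c2:] * B'" "D' * B' = P" by blast
      moreover from this have "B = [:\<pi> * c2:] * B'" unfolding B1 by (simp add: mult.commute)
      ultimately show ?thesis by blast
    qed
  qed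
qed

text \<open>An irreducible polynomial of positive degree is primitive: when the primes of
  \<open>c\<close> are distributed, the part that falls to \<open>P\<close> is a unit.\<close>

lemma irreducible_dvd_const_multD:
  fixes P S :: "'a::field poly poly"
  assumes P: "irreducible P" "0 < degree P" and "c \<noteq> 0" "P dvd [:c:] * S"
  shows "P dvd S"
proof -
  from assms(4) obtain E where "P * E = [:c:] * S" by (metis dvd_def)
  with \<open>c \<noteq> 0\<close> obtain c1 P' E' where *: "P = [:c1:] * P'" "P' * E' = S"
    using const_mult_split by metis
  have "\<not> P' dvd 1" using * P by (auto simp: is_unit_poly_iff)
  hence "[:c1:] dvd 1" using P * irreducibleD by blast
  hence "P dvd P'" unfolding *(1) by (metis dvd_refl mult_dvd_mono mult_1)
  thus ?thesis using dvd_mult2[of P P' E'] *(2) by simp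
qed

text \<open>The measure, X-degree plus T-degree of the leading coefficient, is additive on products
  and, among nonzero polynomials, vanishes only at units. Hence the factors of a proper
  factorization are smaller.\<close>

lemma bivariate_poly_induct [consumes 1, case_names unit irreducible mult]:
  fixes P :: "'a::field poly poly"
  assumes "P \<noteq> 0"
    and unit: "\<And>P. P dvd 1 \<Longrightarrow> Q P"
    and irr: "\<And>P. irreducible P \<Longrightarrow> Q P"
    and mult: "\<And>A B. A \<noteq> 0 \<Longrightarrow> B \<noteq> 0 \<Longrightarrow> Q A \<Longrightarrow> Q B \<Longrightarrow> Q (A * B)"
  shows "Q P"
  using assms(1)
proof (induction "degree P + degree (lead_coeff P)" arbitrary: P rule: less_induct)
  case less
  consider "P dvd 1" | "irreducible P" | "\<not> P dvd 1" "\<not> irreducible P" by blast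
  thus ?case
  proof cases
    case 3
    then obtain A B where AB: "P = A * B" "\<not> A dvd 1" "\<not> B dvd 1"
      using less.prems irreducibleI by metis
    have nz: "A \<noteq> 0" "B \<noteq> 0" using AB less.prems by auto
    have pos: "0 < degree A + degree (lead_coeff A)" if "A \<noteq> 0" "\<not> A dvd 1" for A :: "'a poly poly"
    proof (rule ccontr)
      assume "\<not> 0 < degree A + degree (lead_coeff A)"
      then obtain u where u: "A = [:[:u:]:]" using that
        by (metis degree_eq_zeroE add_is_0 lead_coeff_pCons(2) neq0_conv degree_pCons_0 coeff_pCons_0)
      with that show False by (auto simp: is_unit_poly_iff)
    qed
    have "degree P + degree (lead_coeff P) =
      (degree A + degree (lead_coeff A)) + (degree B + degree (lead_coeff B))"
      using nz unfolding AB lead_coeff_mult by (simp add: degree_mult_eq)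
    thus ?thesis
      using less.hyps[of A] less.hyps[of B] nz pos[of A] pos[of B] AB mult[of A B] by simp
  qed (use unit irr in auto)
qed

lemma irreducible_factor_of_pos_degree:
  fixes D :: "'a::field poly poly"
  assumes "0 < degree D"
  shows "\<exists>G. irreducible G \<and> 0 < degree G \<and> G dvd D"
proof -
  have "D \<noteq> 0" using assms by auto
  hence "0 < degree D \<longrightarrow> (\<exists>G. irreducible G \<and> 0 < degree G \<and> G dvd D)"
  proof (induction D rule: bivariate_poly_induct)
    case (unit P)
    then obtain c where "P = [:c:]" unfolding is_unit_poly_iff by blast
    hence "degree P = 0" by simp
    thus ?case by (simp only: less_irrefl simp_thms)
  next
    case (irreducible P)
    show ?case by (intro impI exI[of _ P] conjI dvd_refl irreducible)
  next
    case (mult A B)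
    show ?case
    proof
      assume "0 < degree (A * B)"
      hence "0 < degree A \<or> 0 < degree B" using mult.hyps by (auto simp: degree_mult_eq)
      thus "\<exists>G. irreducible G \<and> 0 < degree G \<and> G dvd A * B"
      proof
        assume "0 < degree A"
        with mult.IH(1) obtain G where "irreducible G" "0 < degree G" "G dvd A" by (elim impE exE conjE)
        thus ?thesis by (intro exI[of _ G] conjI dvd_mult2)
      next
        assume "0 < degree B"
        with mult.IH(2) obtain G where "irreducible G" "0 < degree G" "G dvd B" by (elim impE exE conjE)
        thus ?thesis by (intro exI[of _ G] conjI dvd_mult)
      qed
    qed
  qed
  thus ?thesis using assms by (rule mp)
qed

text \<open>This is Bezout over the field of fractions with denominators cleared. A nonzero element
  \<open>D\<close> of least degree in the ideal of \<open>P\<close> and \<open>S\<close> divides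
  both up to constants, by pseudo-division. If \<open>D\<close> has positive degree, its irreducible
  factors of positive degree divide both, since constants can be removed from the
  divisibility.\<close>

lemma Bezout_or_common_factor:
  fixes P S :: "'a::field poly poly"
  assumes P: "P \<noteq> 0"
  shows "(\<exists>U V c. c \<noteq> 0 \<and> U * P + V * S = [:c:]) \<or>
    (\<exists>G. irreducible G \<and> 0 < degree G \<and> G dvd P \<and> G dvd S)"
proof -
  define I where "I = {D. D \<noteq> 0 \<and> (\<exists>U V. D = U * P + V * S)}"
  have PI: "P \<in> I"
  proof -
    have "P = 1 * P + 0 * S" by simp
    thus ?thesis unfolding I_def using P by blast
  qed
  obtain D where D: "D \<in> I" and min: "\<And>E. E \<in> I \<Longrightarrow> degree D \<le> degree E"
    using ex_has_least_nat[of "\<lambda>D. D \<in> I" P degree] PI by auto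
  from D obtain U V where UV: "D = U * P + V * S" "D \<noteq> 0" unfolding I_def by blast
  show ?thesis
  proof (cases "degree D = 0")
    case True
    thus ?thesis using UV by (metis degree_eq_zeroE pCons_0_0)
  next
    case False
    have dvd: "\<exists>l q. l \<noteq> 0 \<and> D * q = [:l:] * F" if "F = U' * P + V' * S" for F U' V'
    proof -
      obtain q r where qr: "pseudo_divmod F D = (q, r)" by fastforce
      define l where "l = lead_coeff D ^ (Suc (degree F) - degree D)"
      have 1: "Polynomial.smult l F = D * q + r" "r = 0 \<or> degree r < degree D"
        using pseudo_divmod[OF UV(2) qr] by (auto simp: l_def)
      have "r = ([:l:] * U' - U * q) * P + ([:l:] * V' - V * q) * S"
        using 1(1) unfolding that UV(1) by (simp add: algebra_simps smult_add_right)
      hence "r \<noteq> 0 \<Longrightarrow> r \<in> I" unfolding I_def by blast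
      hence "r = 0" using min[of r] 1 by fastforce
      moreover have "l \<noteq> 0" using UV(2) by (simp add: l_def)
      ultimately show ?thesis using 1 by auto
    qed
    obtain G where G: "irreducible G" "0 < degree G" "G dvd D"
      using irreducible_factor_of_pos_degree False by blast
    have dvd_comb: "G dvd F" if F: "F = U' * P + V' * S" for F U' V'
    proof -
      obtain l q where lq: "l \<noteq> 0" "D * q = [:l:] * F" using dvd[OF F] by blast
      have "G dvd [:l:] * F" unfolding lq(2)[symmetric] using G(3) by (rule dvd_mult2)
      thus ?thesis using irreducible_dvd_const_multD[OF G(1,2) lq(1)] by blast
    qed
    have "P = 1 * P + 0 * S" "S = 0 * P + 1 * S" by simp_all
    hence "G dvd P" "G dvd S" using dvd_comb by metis+
    thus ?thesis using G(1,2) by (intro disjI2 exI[of _ G] conjI)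
  qed
qed

lemma irreducible_Bezout:
  fixes P S :: "'a::field poly poly"
  assumes P: "irreducible P" "0 < degree P" and ndvd: "\<not> P dvd S"
  shows "\<exists>U V c. c \<noteq> 0 \<and> U * P + V * S = [:c:]"
proof -
  have common: False if G: "irreducible G" "0 < degree G" "G dvd P" "G dvd S" for G
  proof -
    obtain E where E: "P = G * E" using G(3) by blast
    have "\<not> G dvd 1" using G(1) by (auto simp: irreducible_def)
    hence "E dvd 1" using irreducibleD[OF P(1) E] by blast
    then obtain E' where "1 = E * E'" by blast
    hence "G = P * E'" unfolding E mult.assoc by simp
    hence "P dvd G" by (rule dvdI)
    with G(4) ndvd show False using dvd_trans by blast
  qed
  have "P \<noteq> 0" using P by auto
  from Bezout_or_common_factor[OF this, of S] show ?thesis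
  proof
    assume "\<exists>G. irreducible G \<and> 0 < degree G \<and> G dvd P \<and> G dvd S"
    then obtain G where "irreducible G" "0 < degree G" "G dvd P" "G dvd S" by (elim exE conjE)
    hence False by (rule common)
    thus ?thesis ..
  qed assumption
qed

lemma irreducible_dvd_multD:
  fixes P A B :: "'a::field poly poly"
  assumes P: "irreducible P" "0 < degree P" "P dvd A * B"
  shows "P dvd A \<or> P dvd B"
proof (rule ccontr)
  assume neg: "\<not> (P dvd A \<or> P dvd B)"
  hence "\<not> P dvd A" by simp
  from irreducible_Bezout[OF P(1,2) this] obtain U V c where c: "c \<noteq> 0" "U * P + V * A = [:c:]"
    by (elim exE conjE)
  have "[:c:] * B = P * (U * B) + V * (A * B)"
    unfolding c(2)[symmetric] by (simp add: algebra_simps)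
  hence "P dvd [:c:] * B" using P(3) by (metis dvd_add dvd_mult dvd_triv_left)
  thus False using irreducible_dvd_const_multD[OF P(1,2) c(1)] neg by blast
qed

subsection \<open>Minimal defining polynomials\<close>

lemma irreducible_unit_mult:
  fixes P :: "'a::field poly poly"
  assumes "irreducible P" "u \<noteq> 0"
  shows "irreducible ([:[:u:]:] * P)"
proof -
  have "is_unit [:[:u:]:]" using assms by (simp add: is_unit_poly_iff)
  thus ?thesis using assms irreducible_mult_unit_left by blast
qed

text \<open>A Bezout relation between \<open>P\<close> and \<open>S\<close>, evaluated at \<alpha>,
  would make its nonzero constant vanish.\<close>

lemma irreducible_root_unique:
  fixes P :: "'a::field poly poly"
  assumes "irreducible P" "0 < degree P" "eval_fls P \<alpha> = 0" "eval_fls S \<alpha> = 0"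
  shows "P dvd S"
proof (rule ccontr)
  assume "\<not> P dvd S"
  then obtain U V c where c: "c \<noteq> 0" "U * P + V * S = [:c:]"
    using irreducible_Bezout assms by blast
  have "poly_to_fls c = eval_fls (U * P + V * S) \<alpha>" by (simp add: c)
  also have "\<dots> = 0" using assms by (simp del: eval_fls_const)
  finally show False using c by simp
qed

lemma min_def_poly_eqI:
  assumes "irreducible P" "0 < degree P" "lead_coeff (lead_coeff P) = 1" "eval_fls P \<alpha> = 0"
  shows "min_def_poly \<alpha> = P"
  unfolding min_def_poly_def
proof (rule the_equality)
  fix P' assume P': "irreducible P' \<and> 0 < degree P' \<and> lead_coeff (lead_coeff P') = 1 \<and> eval_fls P' \<alpha> = 0"
  have "P dvd P'" "P' dvd P"
    using irreducible_root_unique[of P \<alpha> P'] irreducible_root_unique[of P' \<alpha> P] assms P' by auto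
  then obtain u v where uv: "P' = P * u" "P = P' * v" by (metis dvd_def)
  have "P * (u * v) = P * 1" using uv by (metis mult.assoc mult.right_neutral)
  hence "u * v = 1" using assms by (metis degree_0 less_irrefl mult_left_cancel)
  hence "u dvd 1" by (metis dvd_triv_left)
  then obtain k0 where k0: "u = [:k0:]" "k0 dvd 1" unfolding is_unit_poly_iff by blast
  then obtain k where "k0 = [:k:]" unfolding is_unit_poly_iff by blast
  hence k: "u = [:[:k:]:]" using k0 by simp
  have "lead_coeff (lead_coeff P') = lead_coeff (lead_coeff P) * k"
    unfolding uv(1) k lead_coeff_mult by simp
  hence "k = 1" using P' assms(3) by simp
  thus "P' = P" using uv(1) k by (simp flip: one_pCons)
qed (use assms in auto)

lemma algebraic_irreducible_factor:
  assumes "S \<noteq> 0" "eval_fls S \<alpha> = 0"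
  shows "\<exists>P. irreducible P \<and> 0 < degree P \<and> eval_fls P \<alpha> = 0"
  using assms
proof (induction S rule: bivariate_poly_induct)
  case (unit P)
  then obtain c where "P = [:c:]" "c \<noteq> 0" by (auto simp: is_unit_poly_iff)
  with unit show ?case by simp
next
  case (irreducible P)
  have "degree P \<noteq> 0"
  proof
    assume "degree P = 0"
    then obtain c where "P = [:c:]" by (auto elim!: degree_eq_zeroE)
    with irreducible show False by auto
  qed
  with irreducible show ?case by blast
qed auto

lemma min_def_poly:
  assumes "algebraic_fls \<alpha>"
  shows "irreducible (min_def_poly \<alpha>)" "0 < degree (min_def_poly \<alpha>)"
    "lead_coeff (lead_coeff (min_def_poly \<alpha>)) = 1" "eval_fls (min_def_poly \<alpha>) \<alpha> = 0"
proof -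
  from assms obtain P where P: "irreducible P" "0 < degree P" "eval_fls P \<alpha> = 0"
    unfolding algebraic_fls_def using algebraic_irreducible_factor by metis
  define u where "u = 1 / lead_coeff (lead_coeff P)"
  have P0: "P \<noteq> 0" using P by auto
  hence u: "u \<noteq> 0" by (simp add: u_def)
  have "lead_coeff (lead_coeff ([:[:u:]:] * P)) = u * lead_coeff (lead_coeff P)"
    by (simp only: lead_coeff_mult lead_coeff_pCons)
  also have "\<dots> = 1" using P0 by (simp add: u_def)
  finally have lc: "lead_coeff (lead_coeff ([:[:u:]:] * P)) = 1" .
  have "degree ([:[:u:]:] * P) = degree P"
    using u P0 by (subst degree_mult_eq) auto
  hence deg: "0 < degree ([:[:u:]:] * P)" using P by metis
  have ev: "eval_fls ([:[:u:]:] * P) \<alpha> = 0" by (simp only: eval_fls_mult P mult_zero_right)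
  note * = irreducible_unit_mult[OF P(1) u] deg lc ev
  show "irreducible (min_def_poly \<alpha>)" "0 < degree (min_def_poly \<alpha>)"
    "lead_coeff (lead_coeff (min_def_poly \<alpha>)) = 1" "eval_fls (min_def_poly \<alpha>) \<alpha> = 0"
    unfolding min_def_poly_eqI[OF *] by (rule *)+
qed

lemma min_def_poly_dvd:
  assumes "eval_fls P \<alpha> = 0" "P \<noteq> 0"
  shows "min_def_poly \<alpha> dvd P"
proof -
  have "algebraic_fls \<alpha>" using assms unfolding algebraic_fls_def by blast
  from min_def_poly[OF this] show ?thesis using assms irreducible_root_unique by blast
qed

subsection \<open>Heights\<close>

lemma fls_abs_sum_less:
  assumes "\<And>i. i \<in> I \<Longrightarrow> fls_abs (f i) < B" "0 < B"
  shows "fls_abs (\<Sum>i\<in>I. f i) < B"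
  using assms
proof (induction I rule: infinite_finite_induct)
  case (insert x F)
  hence "fls_abs (f x) < B" "fls_abs (sum f F) < B" by auto
  thus ?case using fls_abs_add_le_max[of "f x" "sum f F"] insert.hyps by simp
qed auto

text \<open>Gauss's lemma for the non-archimedean norm: let \<open>i\<close> and \<open>j\<close> be
  the least indices at which the two maxima occur. In the coefficient of index \<open>i + j\<close>
  their product strictly dominates, since every other summand contains a coefficient of index below
  \<open>i\<close> or below \<open>j\<close>.\<close>

lemma height_poly_mult:
  "height_poly (P * Q) = height_poly P * height_poly (Q :: 'a::{field,finite} poly poly)"
proof (cases "P = 0 \<or> Q = 0")
  case True
  thus ?thesis by (auto simp: height_poly_def)
next
  case False
  define a where "a i = poly_to_fls (coeff P i)" for i
  define b where "b i = poly_to_fls (coeff Q i)" for i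
  have co: "poly_to_fls (coeff (P * Q) n) = (\<Sum>k\<le>n. a k * b (n - k))" for n
    by (simp add: coeff_mult hom_distribs a_def b_def)
  have HP: "fls_abs (a i) \<le> height_poly P" for i by (simp add: a_def coeff_le_height_poly)
  have HQ: "fls_abs (b i) \<le> height_poly Q" for i by (simp add: b_def coeff_le_height_poly)
  have pos: "0 < height_poly P" "0 < height_poly Q"
    using height_poly_ge_1[of P] height_poly_ge_1[of Q] False by auto
  show ?thesis
  proof (rule antisym)
    show "height_poly (P * Q) \<le> height_poly P * height_poly Q"
      using pos HP HQ
      by (subst height_poly_le_iff) (auto simp: co fls_abs_mult intro!: fls_abs_sum_le mult_mono)
    define i where "i = (LEAST i. fls_abs (a i) = height_poly P)"
    define j where "j = (LEAST j. fls_abs (b j) = height_poly Q)"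
    have "\<exists>k. fls_abs (a k) = height_poly P" using height_poly_attained[of P] by (metis a_def)
    hence i: "fls_abs (a i) = height_poly P" unfolding i_def by (rule LeastI_ex)
    have "\<exists>k. fls_abs (b k) = height_poly Q" using height_poly_attained[of Q] by (metis b_def)
    hence j: "fls_abs (b j) = height_poly Q" unfolding j_def by (rule LeastI_ex)
    have i': "fls_abs (a k) < height_poly P" if "k < i" for k
      using not_less_Least[OF that[unfolded i_def]] HP[of k] by auto
    have j': "fls_abs (b k) < height_poly Q" if "k < j" for k
      using not_less_Least[OF that[unfolded j_def]] HQ[of k] by auto
    have "(\<Sum>k\<le>i + j. a k * b (i + j - k)) = a i * b j + (\<Sum>k\<in>{..i + j} - {i}. a k * b (i + j - k))"
      by (subst sum.remove[of _ i]) auto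
    moreover have "fls_abs (\<Sum>k\<in>{..i + j} - {i}. a k * b (i + j - k)) < fls_abs (a i * b j)"
      unfolding fls_abs_mult i j
    proof (rule fls_abs_sum_less)
      fix k assume "k \<in> {..i + j} - {i}"
      then consider "k < i" | "i + j - k < j" by fastforce
      thus "fls_abs (a k * b (i + j - k)) < height_poly P * height_poly Q"
      proof cases
        case 1
        have "fls_abs (a k) * fls_abs (b (i + j - k)) \<le> fls_abs (a k) * height_poly Q"
          by (intro mult_left_mono HQ) auto
        also have "\<dots> < height_poly P * height_poly Q"
          using i'[OF 1] pos by (intro mult_strict_right_mono)
        finally show ?thesis by (simp add: fls_abs_mult)
      next
        case 2
        have "fls_abs (a k) * fls_abs (b (i + j - k)) \<le> height_poly P * fls_abs (b (i + j - k))"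
          by (intro mult_right_mono HP) auto
        also have "\<dots> < height_poly P * height_poly Q"
          using j'[OF 2] pos by (intro mult_strict_left_mono)
        finally show ?thesis by (simp add: fls_abs_mult)
      qed
    qed (use pos in auto)
    ultimately have "fls_abs (poly_to_fls (coeff (P * Q) (i + j))) = height_poly P * height_poly Q"
      unfolding co by (simp add: fls_abs_add_eq fls_abs_mult i j)
    thus "height_poly P * height_poly Q \<le> height_poly (P * Q)"
      using coeff_le_height_poly by metis
  qed
qed

lemma height_poly_dvd_le:
  assumes "P dvd Q" "Q \<noteq> 0"
  shows "height_poly P \<le> height_poly Q"
proof -
  obtain R where R: "Q = P * R" using assms by blast
  have "1 \<le> height_poly R" using R assms by (intro height_poly_ge_1) auto
  thus ?thesis unfolding R height_poly_mult using mult_left_mono[of 1 "height_poly R" "height_poly P"] by simp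
qed

text \<open>The minimal polynomial divides \<open>P\<close>, and the cofactor has height at least 1.
  Later constructions therefore need only some annihilating polynomial, not an irreducible
  one.\<close>

lemma root_degree_height_le:
  assumes "P \<noteq> 0" "eval_fls P \<alpha> = 0"
  shows "algebraic_fls \<alpha>" "degree_fls \<alpha> \<le> degree P" "height_fls \<alpha> \<le> height_poly P"
proof -
  note dvd = min_def_poly_dvd[OF assms(2,1)]
  show "algebraic_fls \<alpha>" unfolding algebraic_fls_def using assms by blast
  show "degree_fls \<alpha> \<le> degree P"
    unfolding degree_fls_def by (rule dvd_imp_degree_le[OF dvd assms(1)])
  show "height_fls \<alpha> \<le> height_poly P"
    unfolding height_fls_def by (rule height_poly_dvd_le[OF dvd assms(1)])
qed

text \<open>Horner's scheme: each step multiplies by \<open>X + \<xi>\<close>, which costs a factor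
  \<open>max 1 (fls_abs \<xi>)\<close> and, by the ultrametric inequality, no binomial
  constants.\<close>

lemma coeff_taylor_le:
  "fls_abs (coeff (taylor P \<xi>) i) \<le> height_poly P * max 1 (fls_abs \<xi>) ^ degree P"
proof -
  define L where "L = max 1 (fls_abs \<xi>)"
  have L: "1 \<le> L" "fls_abs \<xi> \<le> L" by (auto simp: L_def)
  have "fls_abs (coeff (F \<circ>\<^sub>p [:\<xi>, 1:]) i) \<le> B * L ^ degree F"
    if "\<forall>i. fls_abs (coeff F i) \<le> B" "0 \<le> B" for F B
    using that(1)
  proof (induction F arbitrary: i)
    case (pCons c F)
    have F: "\<forall>i. fls_abs (coeff F i) \<le> B" using pCons.prems by (metis coeff_pCons_Suc)
    have c: "fls_abs c \<le> B" using pCons.prems by (metis coeff_pCons_0)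
    show ?case
    proof (cases "F = 0")
      case True
      thus ?thesis using c \<open>0 \<le> B\<close> by (cases i) (auto simp: pcompose_pCons)
    next
      case False
      define G where "G = F \<circ>\<^sub>p [:\<xi>, 1:]"
      have G: "fls_abs (coeff G i) \<le> B * L ^ degree F" for i
        using pCons.IH[OF F] by (simp add: G_def)
      have le: "B * L ^ degree F \<le> B * L ^ degree (pCons c F)"
        "B * 1 \<le> B * L ^ degree (pCons c F)" "L * (B * L ^ degree F) = B * L ^ degree (pCons c F)"
      proof -
        have 1: "1 \<le> L ^ degree (pCons c F)" "L ^ degree F \<le> L ^ degree (pCons c F)"
          using L by (auto intro: one_le_power power_increasing)
        show "B * L ^ degree F \<le> B * L ^ degree (pCons c F)" "B * 1 \<le> B * L ^ degree (pCons c F)"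
          by (rule mult_left_mono[OF 1(2) \<open>0 \<le> B\<close>], rule mult_left_mono[OF 1(1) \<open>0 \<le> B\<close>])
        show "L * (B * L ^ degree F) = B * L ^ degree (pCons c F)"
          using False by simp
      qed
      have "coeff (pCons c F \<circ>\<^sub>p [:\<xi>, 1:]) i = coeff [:c:] i + (\<xi> * coeff G i + coeff (pCons 0 G) i)"
        by (simp add: pcompose_pCons G_def)
      moreover have "fls_abs (coeff [:c:] i) \<le> B * L ^ degree (pCons c F)"
        using order_trans[OF c] order_trans[OF \<open>0 \<le> B\<close>, of "B * L ^ degree (pCons c F)"] le(2)
        by (cases i) (simp_all del: degree_pCons_eq_if)
      moreover have "fls_abs (\<xi> * coeff G i) \<le> B * L ^ degree (pCons c F)"
        unfolding fls_abs_mult le(3)[symmetric] using L G by (intro mult_mono) auto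
      moreover have "fls_abs (coeff (pCons 0 G) i) \<le> B * L ^ degree (pCons c F)"
        using order_trans[OF G le(1)] order_trans[OF \<open>0 \<le> B\<close>, of "B * L ^ degree (pCons c F)"] le(2)
        by (cases i) (simp_all del: degree_pCons_eq_if)
      ultimately show ?thesis by (simp only: fls_abs_add_le)
    qed
  qed (use \<open>0 \<le> B\<close> in simp)
  from this[of "map_poly poly_to_fls P" "height_poly P"] show ?thesis
    by (simp add: taylor_def coeff_le_height_poly L_def)
qed

subsection \<open>Sylvester determinants in a translated basis\<close>

text \<open>In the Leibniz expansion each permutation meets every row weight and every column weight
  exactly once, and the ultrametric inequality bounds the sum by its largest term.\<close>

lemma fls_abs_det_le:
  fixes A :: "'a::{field,finite} fls mat"
  assumes A: "A \<in> carrier_mat N N"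
    and le: "\<And>i j. i < N \<Longrightarrow> j < N \<Longrightarrow> fls_abs (A $$ (i, j)) \<le> r i * c j"
    and nonneg: "\<And>i. 0 \<le> r i" "\<And>j. 0 \<le> c j"
  shows "fls_abs (det A) \<le> (\<Prod>i<N. r i) * (\<Prod>j<N. c j)"
  unfolding det_def'[OF A]
proof (rule fls_abs_sum_le)
  fix p assume "p \<in> {p. p permutes {0..<N}}"
  hence p: "p permutes {0..<N}" by simp
  have "fls_abs (signof p * (\<Prod>i = 0..<N. A $$ (i, p i))) = (\<Prod>i = 0..<N. fls_abs (A $$ (i, p i)))"
    by (simp add: fls_abs_mult fls_abs_prod sign_def)
  also have "\<dots> \<le> (\<Prod>i = 0..<N. r i * c (p i))"
    using le permutes_in_image[OF p] by (intro prod_mono) auto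
  also have "\<dots> = (\<Prod>i = 0..<N. r i) * (\<Prod>j = 0..<N. c j)"
    unfolding prod.distrib using prod.permute[OF p, of c] by (simp add: o_def)
  finally show "fls_abs (signof p * (\<Prod>i = 0..<N. A $$ (i, p i))) \<le> (\<Prod>i<N. r i) * (\<Prod>j<N. c j)"
    by (simp add: atLeast0LessThan)
qed (intro mult_nonneg_nonneg prod_nonneg, use nonneg in auto)

definition coeff_mat :: "nat \<Rightarrow> (nat \<Rightarrow> 'a::zero poly) \<Rightarrow> 'a mat" where
  "coeff_mat N F = mat N N (\<lambda>(i, j). coeff (F i) j)"

text \<open>With \<open>G = X\<close> and \<open>k\<close> the degree of \<open>S\<close> these are
  the rows of the Sylvester matrix of \<open>R\<close> and \<open>S\<close>. Other \<open>G\<close>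
  are allowed because recentring at \<xi> turns multiplication by \<open>X\<close> into
  multiplication by \<open>X + \<xi>\<close>.\<close>

definition sylvester_rows :: "nat \<Rightarrow> 'a::comm_semiring_1 poly \<Rightarrow> 'a poly \<Rightarrow> 'a poly \<Rightarrow> nat \<Rightarrow> 'a poly" where
  "sylvester_rows k G R S i = (if i < k then G ^ i * R else G ^ (i - k) * S)"

lemma coeff_mat_carrier [simp]: "coeff_mat N F \<in> carrier_mat N N"
  by (simp add: coeff_mat_def)

lemma coeff_mat_index [simp]: "i < N \<Longrightarrow> j < N \<Longrightarrow> coeff_mat N F $$ (i, j) = coeff (F i) j"
  by (simp add: coeff_mat_def)

lemma coeff_linear_power:
  "coeff ([:\<xi>, 1:] ^ k) k = (1 :: 'a::idom)" "k < j \<Longrightarrow> coeff ([:\<xi>, 1:] ^ k) j = (0 :: 'a::idom)"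
proof -
  have deg: "degree ([:\<xi>, 1:] ^ k :: 'a poly) = k" by (rule degree_linear_power)
  have "lead_coeff ([:\<xi>, 1:] ^ k :: 'a poly) = 1" by (simp add: lead_coeff_power)
  thus "coeff ([:\<xi>, 1:] ^ k) k = (1 :: 'a)" by (simp add: deg)
  show "k < j \<Longrightarrow> coeff ([:\<xi>, 1:] ^ k) j = (0 :: 'a)"
    by (rule coeff_eq_0) (simp add: deg)
qed

lemma det_unit_lower_triangular:
  assumes "A \<in> carrier_mat N N"
    and "\<And>i j. i < j \<Longrightarrow> j < N \<Longrightarrow> A $$ (i, j) = 0" "\<And>i. i < N \<Longrightarrow> A $$ (i, i) = (1 :: 'a::idom)"
  shows "det A = 1"
proof -
  have "det A = prod_list (diag_mat A)"
    using assms by (intro det_lower_triangular) auto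
  also have "\<dots> = 1"
    using assms by (simp add: prod_list_diag_prod)
  finally show ?thesis .
qed

lemma coeff_pcompose:
  fixes F G :: "'a::comm_ring_1 poly"
  assumes "degree F < N"
  shows "coeff (F \<circ>\<^sub>p G) j = (\<Sum>k<N. coeff F k * coeff (G ^ k) j)"
proof -
  have "F \<circ>\<^sub>p G = (\<Sum>k<N. Polynomial.smult (coeff F k) (G ^ k))"
  proof -
    have "F \<circ>\<^sub>p G = (\<Sum>k\<le>degree F. Polynomial.smult (coeff F k) (G ^ k))"
      by (simp add: pcompose_altdef poly_altdef coeff_map_poly degree_map_poly)
    also have "\<dots> = (\<Sum>k<N. Polynomial.smult (coeff F k) (G ^ k))"
      using assms by (intro sum.mono_neutral_left) (auto simp: coeff_eq_0)
    finally show ?thesis .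
  qed
  thus ?thesis by (simp add: coeff_sum)
qed

text \<open>Recentring multiplies the coefficient matrix on the right by the matrix of the powers of
  \<open>X + \<xi>\<close>, which is unitriangular.\<close>

lemma det_coeff_mat_translate:
  fixes F :: "nat \<Rightarrow> 'a::idom poly"
  assumes "\<And>i. i < N \<Longrightarrow> degree (F i) < N"
  shows "det (coeff_mat N (\<lambda>i. F i \<circ>\<^sub>p [:\<xi>, 1:])) = det (coeff_mat N F)"
proof -
  have "coeff_mat N (\<lambda>i. F i \<circ>\<^sub>p [:\<xi>, 1:]) = coeff_mat N F * coeff_mat N (\<lambda>k. [:\<xi>, 1:] ^ k)"
  proof (rule eq_matI)
    fix i j
    assume "i < dim_row (coeff_mat N F * coeff_mat N (\<lambda>k. [:\<xi>, 1:] ^ k))"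
      "j < dim_col (coeff_mat N F * coeff_mat N (\<lambda>k. [:\<xi>, 1:] ^ k))"
    hence ij: "i < N" "j < N" by (auto simp: coeff_mat_def)
    have "(coeff_mat N F * coeff_mat N (\<lambda>k. [:\<xi>, 1:] ^ k)) $$ (i, j) =
      (\<Sum>k = 0..<N. coeff (F i) k * coeff ([:\<xi>, 1:] ^ k) j)"
      using ij by (simp add: coeff_mat_def scalar_prod_def)
    thus "coeff_mat N (\<lambda>i. F i \<circ>\<^sub>p [:\<xi>, 1:]) $$ (i, j) =
      (coeff_mat N F * coeff_mat N (\<lambda>k. [:\<xi>, 1:] ^ k)) $$ (i, j)"
      using ij coeff_pcompose[OF assms[OF ij(1)]] by (simp add: atLeast0LessThan)
  qed (auto simp: coeff_mat_def)
  moreover have "det (coeff_mat N (\<lambda>k. [:\<xi>, 1:] ^ k)) = 1"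
    by (rule det_unit_lower_triangular[of _ N]) (auto simp: coeff_linear_power)
  ultimately show ?thesis
    using det_mult[of "coeff_mat N F" N "coeff_mat N (\<lambda>k. [:\<xi>, 1:] ^ k)"] by simp
qed

lemma coeff_linear_power_mult:
  fixes R :: "'a::idom poly"
  assumes "i < b"
  shows "coeff ([:\<xi>, 1:] ^ i * R) k = (\<Sum>j<b. coeff ([:\<xi>, 1:] ^ i) j * coeff ([:0, 1:] ^ j * R) k)"
proof -
  have "[:\<xi>, 1:] ^ i * R = ([:\<xi>, 1:] ^ i \<circ>\<^sub>p [:0, 1:]) * R"
    by (simp add: pcompose_idR)
  also have "[:\<xi>, 1:] ^ i \<circ>\<^sub>p [:0, 1:] =
    (\<Sum>j<b. Polynomial.smult (coeff ([:\<xi>, 1:] ^ i) j) ([:0, 1:] ^ j))"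
  proof -
    have "degree ([:\<xi>, 1:] ^ i) < b" using assms by (simp add: degree_linear_power)
    from coeff_pcompose[OF this, of "[:0, 1:]"] show ?thesis by (intro poly_eqI) (simp only: coeff_sum coeff_smult)
  qed
  finally show ?thesis by (simp add: sum_distrib_right coeff_sum)
qed

lemma det_sylvester_rows_translate:
  fixes R S :: "'a::idom poly"
  assumes "k \<le> N"
  shows "det (coeff_mat N (sylvester_rows k [:\<xi>, 1:] R S)) = det (coeff_mat N (sylvester_rows k [:0, 1:] R S))"
    (is "det ?A = det ?B")
proof -
  \<comment> \<open>\<open>U\<close> has two diagonal blocks, one for the rows of \<open>R\<close>
    and one for those of \<open>S\<close>; each expands powers of \<open>X + \<xi>\<close> in powers
    of \<open>X\<close> and is lower unitriangular.\<close>
  define U where "U = mat N N (\<lambda>(i, j). if i < k then (if j < k then coeff ([:\<xi>, 1:] ^ i) j else 0)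
    else if j < k then 0 else coeff ([:\<xi>, 1:] ^ (i - k)) (j - k))"
  have U: "U \<in> carrier_mat N N" by (simp add: U_def)
  have "?A = U * ?B"
  proof (rule eq_matI)
    fix i j assume "i < dim_row (U * ?B)" "j < dim_col (U * ?B)"
    hence ij: "i < N" "j < N" by (auto simp: coeff_mat_def U_def)
    have "(U * ?B) $$ (i, j) = (\<Sum>l\<in>{..<k} \<union> {k..<N}. U $$ (i, l) * coeff (sylvester_rows k [:0, 1:] R S l) j)"
      using ij assms U by (simp add: coeff_mat_def scalar_prod_def atLeast0LessThan ivl_disj_un)
    also have "\<dots> = (\<Sum>l<k. U $$ (i, l) * coeff (sylvester_rows k [:0, 1:] R S l) j) +
      (\<Sum>l\<in>{k..<N}. U $$ (i, l) * coeff (sylvester_rows k [:0, 1:] R S l) j)"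
      by (rule sum.union_disjoint) auto
    also have "\<dots> = coeff (sylvester_rows k [:\<xi>, 1:] R S i) j"
    proof (cases "i < k")
      case True
      have "(\<Sum>l<k. U $$ (i, l) * coeff (sylvester_rows k [:0, 1:] R S l) j) =
        (\<Sum>l<k. coeff ([:\<xi>, 1:] ^ i) l * coeff ([:0, 1:] ^ l * R) j)"
        using True ij assms by (intro sum.cong) (auto simp: U_def sylvester_rows_def)
      moreover have "(\<Sum>l\<in>{k..<N}. U $$ (i, l) * coeff (sylvester_rows k [:0, 1:] R S l) j) = 0"
        using True ij by (intro sum.neutral) (auto simp: U_def)
      ultimately show ?thesis
        using True coeff_linear_power_mult[OF True, of \<xi> R j] by (simp add: sylvester_rows_def)
    next
      case False
      have ik: "i - k < N - k" using False ij by simp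
      have "(\<Sum>l<k. U $$ (i, l) * coeff (sylvester_rows k [:0, 1:] R S l) j) = 0"
        using False ij assms by (intro sum.neutral) (auto simp: U_def)
      moreover have "(\<Sum>l\<in>{k..<N}. U $$ (i, l) * coeff (sylvester_rows k [:0, 1:] R S l) j) =
        (\<Sum>l<N - k. coeff ([:\<xi>, 1:] ^ (i - k)) l * coeff ([:0, 1:] ^ l * S) j)"
        using False ij
        by (intro sum.reindex_bij_witness[of _ "\<lambda>l. l + k" "\<lambda>l. l - k"]) (auto simp: U_def sylvester_rows_def)
      ultimately show ?thesis
        using False coeff_linear_power_mult[OF ik, of \<xi> S j] by (simp add: sylvester_rows_def)
    qed
    finally show "?A $$ (i, j) = (U * ?B) $$ (i, j)" using ij by simp
  qed (auto simp: coeff_mat_def U_def)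
  moreover have "det U = 1"
    by (rule det_unit_lower_triangular[OF U]) (auto simp: U_def coeff_linear_power)
  ultimately show ?thesis
    using det_mult[OF U, of ?B] by simp
qed

text \<open>A linear relation among the rows gives \<open>A * R + B * S = 0\<close> with
  \<open>deg A < deg S\<close> and \<open>deg B < deg R\<close>. Bezout makes \<open>S\<close>
  divide \<open>c * A\<close>, so \<open>A = 0\<close> by degree, and then
  \<open>B = 0\<close>.\<close>

lemma det_sylvester_rows_nonzero:
  fixes R S :: "'a::idom poly"
  assumes Bezout: "c \<noteq> 0" "U * R + V * S = [:c:]"
    and N: "N = degree R + degree S" and nz: "R \<noteq> 0" "S \<noteq> 0"
  shows "det (coeff_mat N (sylvester_rows (degree S) [:0, 1:] R S)) \<noteq> 0"
proof
  define k where "k = degree S"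
  define F where "F = sylvester_rows k [:0, 1:] R S"
  assume "det (coeff_mat N (sylvester_rows (degree S) [:0, 1:] R S)) = 0"
  hence "det (transpose_mat (coeff_mat N F)) = 0"
    using det_transpose[of "coeff_mat N F" N] by (simp add: F_def k_def)
  then obtain v where v: "v \<in> carrier_vec N" "v \<noteq> 0\<^sub>v N" "transpose_mat (coeff_mat N F) *\<^sub>v v = 0\<^sub>v N"
    using det_0_iff_vec_prod_zero[of "transpose_mat (coeff_mat N F)" N] by auto
  define A where "A = (\<Sum>i<k. monom (vec_index v i) i)"
  define B where "B = (\<Sum>i<degree R. monom (vec_index v (i + k)) i)"
  have A: "coeff A i = (if i < k then vec_index v i else 0)" for i
    by (auto simp: A_def coeff_sum)
  have B: "coeff B i = (if i < degree R then vec_index v (i + k) else 0)" for i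
    by (auto simp: B_def coeff_sum)
  have F: "(\<Sum>i<N. Polynomial.smult (vec_index v i) (F i)) = A * R + B * S"
  proof -
    have "(\<Sum>i<N. Polynomial.smult (vec_index v i) (F i)) =
      (\<Sum>i\<in>{..<k} \<union> {k..<N}. Polynomial.smult (vec_index v i) (F i))"
      using N by (intro sum.cong) (auto simp: k_def)
    also have "\<dots> = (\<Sum>i<k. Polynomial.smult (vec_index v i) (F i)) + (\<Sum>i\<in>{k..<N}. Polynomial.smult (vec_index v i) (F i))"
      by (rule sum.union_disjoint) auto
    also have "(\<Sum>i<k. Polynomial.smult (vec_index v i) (F i)) = A * R"
      by (simp add: A_def sum_distrib_right F_def sylvester_rows_def monom_altdef)
    also have "(\<Sum>i\<in>{k..<N}. Polynomial.smult (vec_index v i) (F i)) = B * S"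
      unfolding B_def sum_distrib_right using N
      by (intro sum.reindex_bij_witness[of _ "\<lambda>l. l + k" "\<lambda>l. l - k"])
        (auto simp: F_def sylvester_rows_def monom_altdef k_def)
    finally show ?thesis .
  qed
  have coeff_F: "coeff (A * R + B * S) j = (\<Sum>i<N. vec_index v i * coeff (F i) j)" for j
    unfolding F[symmetric] by (simp only: coeff_sum coeff_smult)
  have zero: "A * R + B * S = 0"
  proof (rule poly_eqI)
    fix j
    show "coeff (A * R + B * S) j = coeff 0 j"
    proof (cases "j < N")
      case True
      have "vec_index (transpose_mat (coeff_mat N F) *\<^sub>v v) j = 0" using v True by simp
      moreover have "vec_index (transpose_mat (coeff_mat N F) *\<^sub>v v) j = (\<Sum>i<N. coeff (F i) j * vec_index v i)"
        using True v(1) by (simp add: coeff_mat_def scalar_prod_def atLeast0LessThan)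
      ultimately show ?thesis unfolding coeff_F by (simp add: mult.commute)
    next
      case False
      have deg: "degree (F i) < N" if "i < N" for i
        using that N nz unfolding F_def sylvester_rows_def k_def
        by (auto simp: degree_mult_eq degree_power_eq)
      have "vec_index v i * coeff (F i) j = 0" if "i < N" for i
        using deg[OF that] False by (simp add: coeff_eq_0)
      hence "(\<Sum>i<N. vec_index v i * coeff (F i) j) = 0" by (intro sum.neutral) blast
      thus ?thesis unfolding coeff_F by simp
    qed
  qed
  have "A * R = - (B * S)" using zero by (simp add: eq_neg_iff_add_eq_0)
  have "[:c:] * A = S * (A * V - U * B)"
  proof -
    have "[:c:] * A = U * (A * R) + A * V * S" unfolding Bezout(2)[symmetric] by (simp add: algebra_simps)
    thus ?thesis unfolding \<open>A * R = - (B * S)\<close> by (simp add: algebra_simps)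
  qed
  hence SA: "S dvd [:c:] * A" by simp
  have A0: "A = 0"
  proof (rule ccontr)
    assume "A \<noteq> 0"
    hence "coeff A (degree A) \<noteq> 0" by simp
    hence "degree A < degree S" unfolding A k_def by (auto split: if_splits)
    moreover have "degree S \<le> degree ([:c:] * A)"
      using SA Bezout \<open>A \<noteq> 0\<close> by (intro dvd_imp_degree_le) auto
    ultimately show False using Bezout by simp
  qed
  have B0: "B = 0" using zero A0 nz by simp
  have "vec_index v i = 0" if "i < N" for i
  proof (cases "i < k")
    case True
    thus ?thesis using A[of i] A0 by simp
  next
    case False
    hence "i - k < degree R" "i - k + k = i" using that N by (auto simp: k_def)
    thus ?thesis using B[of "i - k"] B0 by simp
  qed
  hence "v = 0\<^sub>v N" using v by (intro eq_vecI) auto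
  thus False using v by blast
qed

text \<open>The resultant is a nonzero polynomial in T, so its absolute value is at least 1.
  Computed from Taylor coefficients at \<xi>, it is bounded above by the row weights
  \<open>r\<close>, \<open>s\<close> and the column weights \<open>t\<close>; this is how smallness
  near \<xi> is converted into a lower bound.\<close>

lemma sylvester_bound:
  fixes R S :: "'a::{field,finite} poly poly"
  assumes Bezout: "c \<noteq> 0" "U * R + V * S = [:c:]" and nz: "R \<noteq> 0" "S \<noteq> 0"
    and le: "\<And>b j. b < degree S \<Longrightarrow> b \<le> j \<Longrightarrow> fls_abs (coeff (taylor R \<xi>) (j - b)) \<le> r b * t j"
      "\<And>b j. b < degree R \<Longrightarrow> b \<le> j \<Longrightarrow> fls_abs (coeff (taylor S \<xi>) (j - b)) \<le> s b * t j"
    and nonneg: "\<And>b. 0 \<le> r b" "\<And>b. 0 \<le> s b" "\<And>j. 0 \<le> t j"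
  shows "1 \<le> (\<Prod>b<degree S. r b) * (\<Prod>b<degree R. s b) * (\<Prod>j<degree R + degree S. t j)"
proof -
  define k where "k = degree S"
  define N where "N = degree R + degree S"
  define M where "M = coeff_mat N (sylvester_rows k [:0, 1:] R S)"
  have deg: "degree (sylvester_rows k [:0, 1:] R S i) < N" if "i < N" for i
    using that nz by (auto simp: sylvester_rows_def k_def N_def degree_mult_eq degree_power_eq)
  have "det M \<noteq> 0"
    unfolding M_def k_def by (rule det_sylvester_rows_nonzero[OF Bezout N_def nz])
  hence "1 \<le> fls_abs (poly_to_fls (det M))" by (rule fls_abs_poly_to_fls_ge_1)
  also have "poly_to_fls (det M) = det (coeff_mat N (\<lambda>i. map_poly poly_to_fls (sylvester_rows k [:0, 1:] R S i)))"
  proof -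
    have "map_mat poly_to_fls M = coeff_mat N (\<lambda>i. map_poly poly_to_fls (sylvester_rows k [:0, 1:] R S i))"
      by (rule eq_matI) (auto simp: M_def coeff_mat_def)
    thus ?thesis by (metis poly_to_fls_hom.hom_det)
  qed
  also have "\<dots> = det (coeff_mat N (\<lambda>i. taylor (sylvester_rows k [:0, 1:] R S i) \<xi>))"
    unfolding taylor_def using deg by (intro det_coeff_mat_translate[symmetric]) simp
  also have "(\<lambda>i. taylor (sylvester_rows k [:0, 1:] R S i) \<xi>) =
    sylvester_rows k [:\<xi>, 1:] (taylor R \<xi>) (taylor S \<xi>)"
  proof -
    have X: "taylor [:0, 1:] \<xi> = [:\<xi>, 1:]"
      by (simp add: taylor_def poly_to_fls_hom.map_poly_pCons_hom pcompose_pCons)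
    have "taylor ([:0, 1:] ^ i * F) \<xi> = [:\<xi>, 1:] ^ i * taylor F \<xi>" for i F
    proof (induction i)
      case (Suc i)
      have "taylor ([:0, 1:] ^ Suc i * F) \<xi> = taylor [:0, 1:] \<xi> * taylor ([:0, 1:] ^ i * F) \<xi>"
        by (simp only: power_Suc mult.assoc taylor_mult)
      thus ?case by (simp only: X Suc power_Suc mult.assoc)
    qed simp
    thus ?thesis by (auto simp: sylvester_rows_def fun_eq_iff)
  qed
  also have "det (coeff_mat N \<dots>) = det (coeff_mat N (sylvester_rows k [:0, 1:] (taylor R \<xi>) (taylor S \<xi>)))"
    by (rule det_sylvester_rows_translate) (simp add: k_def N_def)
  also have "fls_abs \<dots> \<le> (\<Prod>i<N. if i < k then r i else s (i - k)) * (\<Prod>j<N. t j)"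
  proof (rule fls_abs_det_le[OF coeff_mat_carrier])
    fix i j assume ij: "i < N" "j < N"
    have co: "coeff ([:0, 1:] ^ b * F) j = (if b \<le> j then coeff F (j - b) else 0)" for b and F :: "'a fls poly"
      using coeff_monom_mult[of 1 b F j] by (simp add: monom_altdef)
    show "fls_abs (coeff_mat N (sylvester_rows k [:0, 1:] (taylor R \<xi>) (taylor S \<xi>)) $$ (i, j))
      \<le> (if i < k then r i else s (i - k)) * t j"
      using ij le(1)[of i j] le(2)[of "i - k" j] nonneg
      by (auto simp: sylvester_rows_def co k_def N_def)
  qed (use nonneg in auto)
  also have "(\<Prod>i<N. if i < k then r i else s (i - k)) = (\<Prod>b<k. r b) * (\<Prod>b<degree R. s b)"
  proof -
    have "(\<Prod>i<N. if i < k then r i else s (i - k)) = (\<Prod>i\<in>{..<k} \<union> {k..<N}. if i < k then r i else s (i - k))"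
      by (intro prod.cong) (auto simp: N_def k_def)
    also have "\<dots> = (\<Prod>i<k. if i < k then r i else s (i - k)) * (\<Prod>i\<in>{k..<N}. if i < k then r i else s (i - k))"
      by (rule prod.union_disjoint) auto
    also have "(\<Prod>i\<in>{k..<N}. if i < k then r i else s (i - k)) = (\<Prod>b<degree R. s b)"
      by (intro prod.reindex_bij_witness[of _ "\<lambda>l. l + k" "\<lambda>l. l - k"]) (auto simp: N_def k_def)
    finally show ?thesis by simp
  qed
  finally show ?thesis by (simp add: k_def N_def)
qed

subsection \<open>Lower bounds from coprimality\<close>

lemma power_bound_aux:
  fixes h \<delta> :: real
  assumes "1 \<le> h" "0 \<le> \<delta>" "1 \<le> h ^ m * \<delta> ^ 4" "m \<le> k"
  shows "1 \<le> h ^ k * \<delta> ^ 4"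
proof -
  have "h ^ m * \<delta> ^ 4 \<le> h ^ k * \<delta> ^ 4"
    using assms by (intro mult_right_mono power_increasing) auto
  with assms show ?thesis by linarith
qed

lemma lead_coeff_taylor_ge_1:
  fixes F :: "'a::{field,finite} poly poly"
  assumes "F \<noteq> 0"
  shows "1 \<le> fls_abs (coeff (taylor F \<xi>) (degree F))"
proof -
  have "lead_coeff F \<noteq> 0" using assms by simp
  thus ?thesis unfolding lead_coeff_taylor by (rule fls_abs_poly_to_fls_ge_1)
qed

text \<open>Two coprime polynomials that both have, metrically, a double root within \<open>\<delta>\<close> of \<open>\<xi>\<close> have a
  resultant of size at most \<open>\<delta>\<close> to the power \<open>2 \<cdot> 2\<close>; the weights below on rows and columns of the
  Sylvester matrix realise this exponent.  The case of two linear polynomials only gives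
  \<open>\<delta>\<close> to the power \<open>3\<close> and is compensated by the odd exponent of \<open>h\<close>.\<close>
lemma coprime_double_root_bound:
  fixes R S :: "'a::{field,finite} poly poly"
  assumes Bezout: "c \<noteq> 0" "U * R + V * S = [:c:]" and nz: "R \<noteq> 0" "S \<noteq> 0"
    and deg: "degree R \<le> n" "degree S \<le> n" "1 \<le> n"
    and \<delta>: "0 < \<delta>" "\<delta> \<le> 1" and h: "1 \<le> h"
    and R: "\<And>i. fls_abs (coeff (taylor R \<xi>) i) \<le> h" "fls_abs (coeff (taylor R \<xi>) 0) \<le> h * \<delta>\<^sup>2"
      "fls_abs (coeff (taylor R \<xi>) 1) \<le> h * \<delta>"
    and S: "\<And>i. fls_abs (coeff (taylor S \<xi>) i) \<le> h" "fls_abs (coeff (taylor S \<xi>) 0) \<le> h * \<delta>\<^sup>2"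
      "fls_abs (coeff (taylor S \<xi>) 1) \<le> h * \<delta>"
  shows "1 \<le> h ^ (2 * n + 1) * \<delta> ^ 4"
proof -
  have const: "1 \<le> h ^ (2 * n + 1) * \<delta> ^ 4"
    if "F \<noteq> 0" "degree F = 0" "fls_abs (coeff (taylor F \<xi>) 0) \<le> h * \<delta>\<^sup>2" for F :: "'a poly poly"
  proof -
    have "1 \<le> fls_abs (coeff (taylor F \<xi>) 0)"
      using lead_coeff_taylor_ge_1[of F \<xi>] that by simp
    hence "1 \<le> h * \<delta>\<^sup>2" using that by linarith
    hence "1 \<le> (h * \<delta>\<^sup>2) ^ 2" by (rule one_le_power)
    also have "(h * \<delta>\<^sup>2) ^ 2 = h ^ 2 * \<delta> ^ (2 * 2)"
      by (simp only: power_mult_distrib power_mult)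
    finally have *: "1 \<le> h ^ 2 * \<delta> ^ 4" by simp
    show ?thesis by (rule power_bound_aux[OF h less_imp_le[OF \<delta>(1)] *]) (use deg in simp)
  qed
  define m where "m = degree R"
  define k where "k = degree S"
  consider "m = 0" | "k = 0" | "m = 1" "k = 1" | "1 \<le> m" "1 \<le> k" "3 \<le> m + k" by linarith
  thus ?thesis
  proof cases
    case 1
    thus ?thesis using const[of R] nz R by (simp add: m_def)
  next
    case 2
    thus ?thesis using const[of S] nz S by (simp add: k_def)
  next
    case 3
    \<comment> \<open>For a linear polynomial the first Taylor coefficient is the leading
      coefficient, a nonzero polynomial in T; so \<open>h * \<delta>\<close> is at least 1 and
      supplies the missing factor.\<close>
    have "1 \<le> fls_abs (coeff (taylor R \<xi>) 1)"
      using lead_coeff_taylor_ge_1[of R \<xi>] 3 nz by (simp add: m_def)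
    hence h\<delta>: "1 \<le> h * \<delta>" using R by linarith
    have "1 \<le> (\<Prod>b<degree S. h) * (\<Prod>b<degree R. h) *
      (\<Prod>j<degree R + degree S. if j = 0 then \<delta>\<^sup>2 else if j = 1 then \<delta> else 1)"
    proof (rule sylvester_bound[OF Bezout nz])
      fix b j :: nat
      show "fls_abs (coeff (taylor R \<xi>) (j - b)) \<le> h * (if j = 0 then \<delta>\<^sup>2 else if j = 1 then \<delta> else 1)"
        if "b < degree S" "b \<le> j" using that R 3 by (auto simp: k_def)
      show "fls_abs (coeff (taylor S \<xi>) (j - b)) \<le> h * (if j = 0 then \<delta>\<^sup>2 else if j = 1 then \<delta> else 1)"
        if "b < degree R" "b \<le> j" using that S 3 by (auto simp: m_def)
    qed (use h \<delta> in auto)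
    hence "1 \<le> h * h * (\<delta>\<^sup>2 * \<delta>)"
      using 3 by (simp add: m_def k_def numeral_2_eq_2)
    hence "1 * 1 \<le> (h * h * (\<delta>\<^sup>2 * \<delta>)) * (h * \<delta>)" using h\<delta> by (intro mult_mono) auto
    also have "\<dots> = h ^ 3 * \<delta> ^ 4"
      by (simp only: power2_eq_square power3_eq_cube power4_eq_xxxx mult_ac)
    finally have *: "1 \<le> h ^ 3 * \<delta> ^ 4" by simp
    show ?thesis by (rule power_bound_aux[OF h less_imp_le[OF \<delta>(1)] *]) (use deg in simp)
  next
    case 4
    \<comment> \<open>Unshifted rows get weight \<open>h\<close>, shifted ones
      \<open>h * \<delta>\<close>, and the columns \<open>\<delta>^2\<close>,
      \<open>\<delta>\<close>, 1 and then \<open>1 / \<delta>\<close>. With \<open>l + 3\<close>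
      columns there are \<open>l + 1\<close> shifted rows, so the powers of \<delta> add up to
      \<open>(l + 1) + 3 - l = 4\<close>.\<close>
    define r where "r b = (if b = 0 then h else h * \<delta>)" for b :: nat
    define t where "t j = (if j = 0 then \<delta>\<^sup>2 else if j = 1 then \<delta> else if j = 2 then 1 else 1 / \<delta>)" for j :: nat
    have \<delta>2: "\<delta>\<^sup>2 \<le> \<delta>" "\<delta> * \<delta> = \<delta>\<^sup>2" using \<delta> by (auto simp: power2_eq_square mult_le_cancel_left2)
    have weight: "fls_abs (coeff F (j - b)) \<le> r b * t j"
      if F: "\<And>i. fls_abs (coeff F i) \<le> h" "fls_abs (coeff F 0) \<le> h * \<delta>\<^sup>2" "fls_abs (coeff F 1) \<le> h * \<delta>"
        and bj: "b \<le> j" for F :: "'a fls poly" and b j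
    proof -
      have h1: "h \<le> h / \<delta>" using h \<delta> by (simp add: le_divide_eq mult_le_cancel_left1)
      have h2: "h * \<delta>\<^sup>2 \<le> h * \<delta>" by (rule mult_left_mono[OF \<delta>2(1)]) (use h in simp)
      have "b = 0 \<or> b = 1 \<or> b = 2 \<or> 3 \<le> b" "j = 0 \<or> j = 1 \<or> j = 2 \<or> 3 \<le> j"
        by linarith+
      then consider "b = 0" "j = 0" | "b = 0" "j = 1" | "b = 0" "j = 2" | "b = 0" "3 \<le> j"
        | "b = 1" "j = 1" | "b = 1" "j = 2" | "b = 2" "j = 2" | "1 \<le> b" "3 \<le> j"
        using bj by (elim disjE) auto
      thus ?thesis
      proof cases
        case 4
        thus ?thesis using F(1)[of j] h1 by (simp add: r_def t_def)
      next
        case 5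
        thus ?thesis using F(2) unfolding r_def t_def by (simp add: mult.assoc \<delta>2(2))
      next
        case 7
        thus ?thesis using order_trans[OF F(2) h2] by (simp add: r_def t_def)
      next
        case 8
        thus ?thesis using F(1)[of "j - b"] \<delta> by (simp add: r_def t_def)
      qed (use F in \<open>auto simp: r_def t_def\<close>)
    qed
    have "1 \<le> (\<Prod>b<degree S. r b) * (\<Prod>b<degree R. r b) * (\<Prod>j<degree R + degree S. t j)"
    proof (rule sylvester_bound[OF Bezout nz])
      fix b j :: nat
      show "fls_abs (coeff (taylor R \<xi>) (j - b)) \<le> r b * t j" if "b \<le> j"
        by (rule weight[OF R that])
      show "fls_abs (coeff (taylor S \<xi>) (j - b)) \<le> r b * t j" if "b \<le> j"
        by (rule weight[OF S that])
      show "0 \<le> r b" "0 \<le> r b" "0 \<le> t j" using h \<delta> by (auto simp: r_def t_def)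
    qed
    moreover have "(\<Prod>b<Suc l. r b) = h * (h * \<delta>) ^ l" for l
      by (subst prod.lessThan_Suc_shift) (simp add: r_def)
    moreover have "(\<Prod>j<Suc (Suc (Suc l)). t j) = \<delta> ^ 3 * (1 / \<delta>) ^ l" for l
      by (simp only: prod.lessThan_Suc_shift) (simp add: t_def power2_eq_square power3_eq_cube)
    moreover obtain m' k' l where mkl: "m = Suc m'" "k = Suc k'" "m + k = Suc (Suc (Suc l))"
    proof
      show "m = Suc (m - 1)" "k = Suc (k - 1)" "m + k = Suc (Suc (Suc (m + k - 3)))" using 4 by auto
    qed
    ultimately have "1 \<le> (h * (h * \<delta>) ^ k') * (h * (h * \<delta>) ^ m') * (\<delta> ^ 3 * (1 / \<delta>) ^ l)"
      by (metis m_def k_def)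
    also have "\<dots> = h ^ (m + k) * \<delta> ^ 4"
    proof -
      have l: "k' + m' = Suc l" using mkl by simp
      have "(h * (h * \<delta>) ^ k') * (h * (h * \<delta>) ^ m') = h ^ 2 * (h * \<delta>) ^ (k' + m')"
        by (simp add: power_add power2_eq_square mult_ac)
      also have "\<dots> = h ^ (m + k) * \<delta> ^ Suc l"
        unfolding l mkl(3) by (simp add: power_mult_distrib power2_eq_square mult_ac)
      finally have "(h * (h * \<delta>) ^ k') * (h * (h * \<delta>) ^ m') * (\<delta> ^ 3 * (1 / \<delta>) ^ l) =
        h ^ (m + k) * (\<delta> ^ l * (1 / \<delta>) ^ l) * (\<delta> * \<delta> ^ 3)"
        by (simp add: mult_ac)
      also have "\<delta> ^ l * (1 / \<delta>) ^ l = 1" using \<delta> by (simp flip: power_mult_distrib)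
      finally show ?thesis by (simp flip: power_Suc)
    qed
    finally have *: "1 \<le> h ^ (m + k) * \<delta> ^ 4" .
    show ?thesis by (rule power_bound_aux[OF h less_imp_le[OF \<delta>(1)] *]) (use deg in \<open>simp add: m_def k_def\<close>)
  qed
qed

text \<open>Take the resultant of \<open>F\<close> and \<open>P\<close>. As \<open>F\<close>
  vanishes at \<xi>, the only possibly nonzero entry in the first column of the recentred Sylvester
  matrix is \<open>P(\<xi>)\<close>; it replaces one of the \<open>deg F\<close> factors of size
  \<open>H(P)\<close>.\<close>

lemma Liouville_bound:
  fixes F :: "'a::{field,finite} poly poly"
  assumes F: "irreducible F" "0 < degree F" "eval_fls F \<xi> = 0"
  shows "\<exists>C>0. \<forall>P. degree P \<le> n \<longrightarrow> eval_fls P \<xi> \<noteq> 0 \<longrightarrow>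
    1 \<le> C * height_poly P ^ (degree F - 1) * fls_abs (eval_fls P \<xi>)"
proof -
  define L where "L = max 1 (fls_abs \<xi>)"
  define d where "d = degree F"
  define CF where "CF = height_poly F * L ^ d"
  have L: "1 \<le> L" by (simp add: L_def)
  have F0: "F \<noteq> 0" using F by auto
  have "1 * 1 \<le> height_poly F * L ^ d"
    using L height_poly_ge_1[OF F0] by (intro mult_mono one_le_power) auto
  hence CF: "1 \<le> CF" by (simp add: CF_def)
  define C where "C = CF ^ n * (L ^ n) ^ (d - 1)"
  have "1 \<le> C * height_poly P ^ (degree F - 1) * fls_abs (eval_fls P \<xi>)"
    if P: "degree P \<le> n" "eval_fls P \<xi> \<noteq> 0" for P
  proof -
    have P0: "P \<noteq> 0" using P by auto
    have "\<not> F dvd P"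
      using P F by (metis dvd_def eval_fls_mult mult_zero_left)
    then obtain U V c where Bezout: "c \<noteq> 0" "U * F + V * P = [:c:]"
      using irreducible_Bezout F by blast
    define h where "h = height_poly P * L ^ n"
    have "1 * 1 \<le> height_poly P * L ^ n"
      using L height_poly_ge_1[OF P0] by (intro mult_mono one_le_power) auto
    hence h: "1 \<le> h" by (simp add: h_def)
    have coP: "fls_abs (coeff (taylor P \<xi>) i) \<le> h" for i
    proof -
      have "height_poly P * L ^ degree P \<le> h"
        unfolding h_def using L P by (intro mult_left_mono power_increasing) auto
      thus ?thesis using coeff_taylor_le[of P \<xi> i] by (simp add: L_def)
    qed
    have coF: "fls_abs (coeff (taylor F \<xi>) i) \<le> CF" for i
      using coeff_taylor_le[of F \<xi> i] by (simp add: CF_def L_def d_def)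
    define t where "t j = (if j = 0 then fls_abs (eval_fls P \<xi>) / h else 1)" for j :: nat
    have "1 \<le> (\<Prod>b<degree P. CF) * (\<Prod>b<degree F. h) * (\<Prod>j<degree F + degree P. t j)"
    proof (rule sylvester_bound[OF Bezout F0 P0])
      fix b j :: nat
      show "fls_abs (coeff (taylor F \<xi>) (j - b)) \<le> CF * t j" if "b \<le> j"
        using coF[of "j - b"] that F(3) CF h by (auto simp: t_def coeff_0_taylor)
      show "fls_abs (coeff (taylor P \<xi>) (j - b)) \<le> h * t j" if "b \<le> j"
        using coP[of "j - b"] that h by (auto simp: t_def coeff_0_taylor)
      show "0 \<le> t j" using h by (auto simp: t_def)
    qed (use CF h in auto)
    also have "(\<Prod>j<degree F + degree P. t j) = fls_abs (eval_fls P \<xi>) / h"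
    proof -
      obtain l where "degree F + degree P = Suc l" using F(2) by (metis add_is_0 not0_implies_Suc not_gr0)
      thus ?thesis by (simp only: prod.lessThan_Suc_shift) (simp add: t_def)
    qed
    also have "(\<Prod>b<degree P. CF) * (\<Prod>b<degree F. h) * (fls_abs (eval_fls P \<xi>) / h) =
      CF ^ degree P * (h ^ (d - 1) * fls_abs (eval_fls P \<xi>))"
    proof -
      have "h ^ d = h ^ (d - 1) * h"
        using F(2) by (metis d_def power_minus_mult)
      thus ?thesis using h by (simp add: d_def)
    qed
    also have "\<dots> \<le> CF ^ n * (h ^ (d - 1) * fls_abs (eval_fls P \<xi>))"
      using CF P h by (intro mult_right_mono power_increasing) auto
    also have "\<dots> = C * height_poly P ^ (degree F - 1) * fls_abs (eval_fls P \<xi>)"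
      by (simp add: C_def h_def d_def power_mult_distrib mult_ac)
    finally show ?thesis .
  qed
  moreover have "C > 0" using CF L by (auto simp: C_def)
  ultimately show ?thesis by blast
qed

subsection \<open>Hensel's lemma\<close>

text \<open>The value group is discrete, so a strict inequality gains a factor \<open>q\<close>.
  This turns the strict dominance in Hensel's lemma into a contraction with uniform ratio
  \<open>1 / q\<close>.\<close>

lemma fls_abs_less_imp_le_div:
  fixes x y :: "'a::{field,finite} fls"
  assumes "fls_abs x < fls_abs y"
  shows "fls_abs x \<le> fls_abs y / real CARD('a)"
proof (cases "x = 0")
  case False
  have q: "1 < real CARD('a)" by (rule real_CARD_field_gt_1)
  have y: "y \<noteq> 0" using assms by (metis fls_abs_nonneg fls_abs_0 not_le)
  have "\<not> fls_subdegree x \<le> fls_subdegree y"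
    using assms False y power_int_increasing[of "- fls_subdegree y" "- fls_subdegree x" "real CARD('a)"] q
    by (auto simp: fls_abs_def)
  hence "fls_abs x \<le> real CARD('a) powi (- fls_subdegree y - 1)"
    using False q power_int_increasing[of "- fls_subdegree x" "- fls_subdegree y - 1" "real CARD('a)"]
    by (auto simp: fls_abs_def)
  also have "\<dots> = fls_abs y / real CARD('a)"
    using y q by (simp add: fls_abs_def power_int_diff)
  finally show ?thesis .
qed simp

lemma fls_complete:
  fixes x :: "nat \<Rightarrow> 'a::{field,finite} fls"
  assumes \<rho>: "0 < \<rho>" and step: "\<And>n. fls_abs (x (Suc n) - x n) \<le> \<rho> / real CARD('a) ^ n"
  shows "\<exists>y. \<forall>n. fls_abs (y - x n) \<le> \<rho> / real CARD('a) ^ n"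
proof -
  define q where "q = real CARD('a)"
  have q: "1 < q" unfolding q_def by (rule real_CARD_field_gt_1)
  have dist: "fls_abs (x (n + m) - x n) \<le> \<rho> / q ^ n" for n m
  proof (induction m)
    case (Suc m)
    have "\<rho> / q ^ (n + m) \<le> \<rho> / q ^ n"
      using q \<rho> by (intro divide_left_mono power_increasing) auto
    hence "fls_abs (x (Suc (n + m)) - x (n + m)) \<le> \<rho> / q ^ n"
      using step[of "n + m"] by (simp add: q_def)
    from fls_abs_add_le[OF this Suc] show ?case by simp
  qed (use q \<rho> in simp)
  obtain e where e: "\<rho> < q ^ e" using real_arch_pow[OF q] by blast
  have small: "fls_abs z \<le> q powi (- (int n - int e))" if "fls_abs z \<le> \<rho> / q ^ n" for z :: "'a fls" and n
  proof -
    have "\<rho> / q ^ n \<le> q ^ e / q ^ n" using e q by (intro divide_right_mono) auto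
    also have "\<dots> = q powi (- (int n - int e))"
      using q by (simp add: power_int_diff)
    finally show ?thesis using that by linarith
  qed
  \<comment> \<open>From index \<open>n\<close> on, the coefficients below \<open>n - e\<close> no
    longer change; \<open>k + e + 1\<close>, truncated at 0, is therefore late enough for
    coefficient \<open>k\<close>.\<close>
  define N where "N k = nat (k + int e + 1)" for k
  \<comment> \<open>For \<open>k < s\<close> the truncation makes \<open>N k\<close> zero, and
    \<open>x 0\<close> has no coefficients below its subdegree.\<close>
  define s where "s = min (fls_subdegree (x 0)) (- int e - 1)"
  define y where "y = Abs_fls (\<lambda>k. fls_nth (x (N k)) k)"
  have y: "fls_nth y k = fls_nth (x (N k)) k" for k
    unfolding y_def
  proof (rule nth_Abs_fls_lower_bound)
    show "\<forall>k<s. fls_nth (x (N k)) k = 0"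
      by (auto simp: s_def N_def)
  qed
  have agree: "fls_nth (x m) k = fls_nth (x (N k)) k" if "N k \<le> m" for m k
  proof -
    have "fls_abs (x m - x (N k)) \<le> q powi (- (int (N k) - int e))"
      using small[OF dist[of "N k" "m - N k"]] that by simp
    hence "\<forall>i < int (N k) - int e. fls_nth (x m - x (N k)) i = 0"
      unfolding q_def fls_abs_le_powi_iff .
    moreover have "k < int (N k) - int e" by (simp add: N_def)
    ultimately show ?thesis by simp
  qed
  have lim: "fls_abs (y - x m) \<le> q powi (- (int m - int e))" for m
    unfolding q_def fls_abs_le_powi_iff
  proof safe
    fix k assume "k < int m - int e"
    hence "N k \<le> m" by (simp add: N_def)
    thus "fls_nth (y - x m) k = 0" using agree[of k m] by (simp add: y)
  qed
  have "fls_abs (y - x n) \<le> \<rho> / q ^ n" for n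
  proof -
    \<comment> \<open>\<open>lim\<close> has \<open>q^e\<close> where the claim has \<rho>;
      comparing with a sufficiently late \<open>x (n + l)\<close> removes the difference.\<close>
    obtain l where "q ^ e * q ^ n / \<rho> < q ^ l" using real_arch_pow[OF q] by blast
    hence "q ^ e / q ^ l \<le> \<rho> / q ^ n" using q \<rho> by (simp add: field_simps)
    moreover have "q ^ e / q ^ (n + l) \<le> q ^ e / q ^ l"
      using q by (intro divide_left_mono power_increasing) auto
    moreover have "q powi (- (int (n + l) - int e)) = q ^ e / q ^ (n + l)"
      using q power_int_diff[of q "int e" "int (n + l)"] by (simp flip: power_int_of_nat)
    ultimately have "fls_abs (y - x (n + l)) \<le> \<rho> / q ^ n" using lim[of "n + l"] by linarith
    from fls_abs_add_le[OF this dist[of n l]] show ?thesis by simp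
  qed
  thus ?thesis unfolding q_def by blast
qed

lemma fls_abs_power_diff_le:
  fixes x y :: "'a::{field,finite} fls"
  assumes "fls_abs x \<le> \<rho>" "fls_abs y \<le> \<rho>" "1 \<le> n"
  shows "fls_abs (x ^ n - y ^ n) \<le> fls_abs (x - y) * \<rho> ^ (n - 1)"
proof -
  have \<rho>: "0 \<le> \<rho>" using assms(1) fls_abs_nonneg order_trans by blast
  obtain m where m: "n = Suc m" using assms by (cases n) auto
  have "fls_abs (\<Sum>i<Suc m. x ^ i * y ^ (m - i)) \<le> \<rho> ^ m"
  proof (rule fls_abs_sum_le)
    fix i assume i: "i \<in> {..<Suc m}"
    have "fls_abs (x ^ i * y ^ (m - i)) \<le> \<rho> ^ i * \<rho> ^ (m - i)"
      unfolding fls_abs_mult fls_abs_power using assms \<rho> by (intro mult_mono power_mono) auto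
    thus "fls_abs (x ^ i * y ^ (m - i)) \<le> \<rho> ^ m" using i by (simp flip: power_add)
  qed (use \<rho> in simp)
  hence "fls_abs (x - y) * fls_abs (\<Sum>i<Suc m. x ^ i * y ^ (m - i)) \<le> fls_abs (x - y) * \<rho> ^ m"
    by (intro mult_left_mono) auto
  moreover have "x ^ n - y ^ n = (x - y) * (\<Sum>i<Suc m. x ^ i * y ^ (m - i))"
    unfolding m using power_diff_sumr2[of x "Suc m" y] by (simp add: lessThan_Suc_atMost mult.commute)
  ultimately show ?thesis by (simp add: fls_abs_mult m)
qed

text \<open>The map \<open>x - F(x) / c\<close>, with \<open>c\<close> the linear coefficient, is a
  Newton iteration with fixed slope. Dominance of \<open>c\<close> over the higher coefficients
  makes it contract the ball of radius \<rho>, the bound on the constant coefficient keeps it inside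
  the ball, and its fixed point is a root.\<close>

lemma Hensel_root:
  fixes F :: "'a::{field,finite} fls poly"
  assumes \<rho>: "0 < \<rho>"
    and dom: "\<And>i. 2 \<le> i \<Longrightarrow> fls_abs (coeff F i) * \<rho> ^ (i - 1) < fls_abs (coeff F 1)"
    and f0: "fls_abs (coeff F 0) \<le> fls_abs (coeff F 1) * \<rho>"
  shows "\<exists>x. fls_abs x \<le> \<rho> \<and> poly F x = 0"
proof -
  define q where "q = real CARD('a)"
  have q: "1 < q" unfolding q_def by (rule real_CARD_field_gt_1)
  define c where "c = coeff F 1"
  have "0 \<le> fls_abs (coeff F 2) * \<rho> ^ (2 - 1)" using \<rho> by (intro mult_nonneg_nonneg) auto
  hence "0 < fls_abs c" using dom[of 2] unfolding c_def by linarith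
  hence c: "c \<noteq> 0" by simp
  define g where "g x = x - poly F x / c" for x
  have diff: "poly F x - poly F y = c * (x - y) + (\<Sum>i\<in>{2..max 2 (degree F)}. coeff F i * (x ^ i - y ^ i))" for x y
  proof -
    define D where "D = max 2 (degree F)"
    have pF: "poly F z = coeff F 0 + c * z + (\<Sum>i\<in>{2..D}. coeff F i * z ^ i)" for z
    proof -
      have "poly F z = (\<Sum>i\<le>D. coeff F i * z ^ i)"
        unfolding poly_altdef by (intro sum.mono_neutral_left) (auto simp: D_def coeff_eq_0)
      also have "{..D} = {0, 1} \<union> {2..D}" by (auto simp: D_def)
      also have "(\<Sum>i\<in>{0, 1} \<union> {2..D}. coeff F i * z ^ i) = coeff F 0 + c * z + (\<Sum>i\<in>{2..D}. coeff F i * z ^ i)"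
        by (subst sum.union_disjoint) (auto simp: c_def)
      finally show ?thesis .
    qed
    show ?thesis unfolding pF D_def[symmetric]
      by (simp add: algebra_simps sum_subtractf)
  qed
  have contr: "fls_abs (g x - g y) \<le> fls_abs (x - y) / q"
    if xy: "fls_abs x \<le> \<rho>" "fls_abs y \<le> \<rho>" for x y
  proof (cases "x = y")
    case False
    define S where "S = (\<Sum>i\<in>{2..max 2 (degree F)}. coeff F i * (x ^ i - y ^ i))"
    have "fls_abs S < fls_abs c * fls_abs (x - y)"
      unfolding S_def
    proof (rule fls_abs_sum_less)
      fix i assume i: "i \<in> {2..max 2 (degree F)}"
      have "fls_abs (coeff F i * (x ^ i - y ^ i)) \<le> fls_abs (coeff F i) * (fls_abs (x - y) * \<rho> ^ (i - 1))"
        unfolding fls_abs_mult using i xy by (intro mult_left_mono fls_abs_power_diff_le) auto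
      also have "\<dots> = (fls_abs (coeff F i) * \<rho> ^ (i - 1)) * fls_abs (x - y)" by simp
      also have "\<dots> < fls_abs c * fls_abs (x - y)"
        using dom[of i] i False unfolding c_def by (intro mult_strict_right_mono) auto
      finally show "fls_abs (coeff F i * (x ^ i - y ^ i)) < fls_abs c * fls_abs (x - y)" .
    qed (use c False in simp)
    hence "fls_abs (S / c) < fls_abs (x - y)"
      using c by (simp add: fls_abs_divide field_simps)
    moreover have "g x - g y = - (S / c)"
    proof -
      have "g x - g y = (x - y) - (poly F x - poly F y) / c" by (simp add: g_def diff_divide_distrib)
      also have "(poly F x - poly F y) / c = (x - y) + S / c"
        unfolding diff S_def[symmetric] using c by (simp add: add_divide_distrib)
      finally show ?thesis by simp
    qed
    ultimately have "fls_abs (g x - g y) < fls_abs (x - y)" by simp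
    thus ?thesis unfolding q_def by (rule fls_abs_less_imp_le_div)
  qed simp
  have g0: "fls_abs (g 0) \<le> \<rho>"
  proof -
    have "fls_abs (coeff F 0) \<le> fls_abs c * \<rho>" using f0 by (simp add: c_def)
    thus ?thesis using c by (simp add: g_def fls_abs_divide poly_0_coeff_0 field_simps)
  qed
  have g\<rho>: "fls_abs (g x) \<le> \<rho>" if "fls_abs x \<le> \<rho>" for x
  proof -
    have "fls_abs (g x - g 0) \<le> fls_abs x / q" using contr[OF that, of 0] \<rho> by simp
    also have "\<dots> \<le> fls_abs x" using q by (simp add: divide_le_eq mult_le_cancel_left1 not_less)
    finally have "fls_abs (g x - g 0) \<le> \<rho>" using that by linarith
    from fls_abs_add_le[OF this g0] show ?thesis by simp
  qed
  define X where "X n = (g ^^ n) 0" for n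
  have X\<rho>: "fls_abs (X n) \<le> \<rho>" for n
    by (induction n) (use \<rho> g\<rho> in \<open>auto simp: X_def\<close>)
  have step: "fls_abs (X (Suc n) - X n) \<le> \<rho> / q ^ n" for n
  proof (induction n)
    case 0
    show ?case using g0 by (simp add: X_def)
  next
    case (Suc n)
    have "fls_abs (X (Suc (Suc n)) - X (Suc n)) \<le> fls_abs (X (Suc n) - X n) / q"
      using contr[OF X\<rho>[of "Suc n"] X\<rho>[of n]] by (simp add: X_def)
    also have "\<dots> \<le> (\<rho> / q ^ n) / q" using Suc q by (intro divide_right_mono) auto
    finally show ?case by (simp add: mult.commute)
  qed
  obtain x where x: "\<And>n. fls_abs (x - X n) \<le> \<rho> / q ^ n"
    using fls_complete[OF \<rho>, of X] step unfolding q_def by blast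
  have x\<rho>: "fls_abs x \<le> \<rho>" using x[of 0] by (simp add: X_def)
  have near_fixed: "fls_abs (g x - x) \<le> \<rho> / q ^ n" for n
  proof -
    have "fls_abs (g x - X (Suc n)) \<le> fls_abs (x - X n) / q"
      using contr[OF x\<rho> X\<rho>[of n]] by (simp add: X_def)
    also have "\<dots> \<le> fls_abs (x - X n)" using q by (simp add: divide_le_eq mult_le_cancel_left1 not_less)
    finally have 1: "fls_abs (g x - X (Suc n)) \<le> \<rho> / q ^ n" using x[of n] by linarith
    have "\<rho> / q ^ Suc n \<le> \<rho> / q ^ n" using q \<rho> by (intro divide_left_mono power_increasing) auto
    hence 2: "fls_abs (x - X (Suc n)) \<le> \<rho> / q ^ n" using x[of "Suc n"] by linarith
    from fls_abs_diff_le[OF 1 2] show ?thesis by simp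
  qed
  have "g x - x = 0"
  proof (rule ccontr)
    assume "g x - x \<noteq> 0"
    hence pos: "0 < fls_abs (g x - x)" by simp
    obtain n where "\<rho> / fls_abs (g x - x) < q ^ n" using real_arch_pow[OF q] by blast
    hence "\<rho> / q ^ n < fls_abs (g x - x)" using pos q by (simp add: field_simps)
    with near_fixed[of n] show False by linarith
  qed
  hence "poly F x = 0" using c by (simp add: g_def)
  with x\<rho> show ?thesis by blast
qed

text \<open>Hensel's lemma in the coordinate centred at \<xi>; \<open>P(\<xi>) \<noteq> 0\<close>
  ensures that the root found differs from \<xi>.\<close>

lemma algebraic_root_near:
  fixes P :: "'a::{field,finite} poly poly"
  assumes \<rho>: "0 < \<rho>"
    and dom: "\<And>i. 2 \<le> i \<Longrightarrow> fls_abs (coeff (taylor P \<xi>) i) * \<rho> ^ (i - 1) < fls_abs (coeff (taylor P \<xi>) 1)"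
    and f0: "fls_abs (eval_fls P \<xi>) \<le> fls_abs (coeff (taylor P \<xi>) 1) * \<rho>" "eval_fls P \<xi> \<noteq> 0"
  shows "\<exists>\<alpha>. algebraic_fls \<alpha> \<and> degree_fls \<alpha> \<le> degree P \<and> height_fls \<alpha> \<le> height_poly P \<and>
    0 < fls_abs (\<xi> - \<alpha>) \<and> fls_abs (\<xi> - \<alpha>) \<le> \<rho>"
proof -
  obtain x where x: "fls_abs x \<le> \<rho>" "poly (taylor P \<xi>) x = 0"
    using Hensel_root[OF \<rho> dom] f0 by (auto simp: coeff_0_taylor)
  define \<alpha> where "\<alpha> = \<xi> + x"
  have \<alpha>: "eval_fls P \<alpha> = 0" using x by (simp add: poly_taylor \<alpha>_def)
  have P: "P \<noteq> 0" using f0(2) by auto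
  have "\<xi> - \<alpha> = - x" by (simp add: \<alpha>_def)
  moreover have "x \<noteq> 0" using \<alpha> f0 by (auto simp: \<alpha>_def)
  ultimately have "0 < fls_abs (\<xi> - \<alpha>)" "fls_abs (\<xi> - \<alpha>) \<le> \<rho>" using x by simp_all
  thus ?thesis using root_degree_height_le[OF P \<alpha>] by blast
qed

subsection \<open>Frobenius\<close>

lemma prime_CHAR_finite_field: "prime CHAR('a::{field,finite})"
  by (rule prime_CHAR_semidom) (rule finite_imp_CHAR_pos, simp)

lemma CHAR_pos_finite_field: "0 < CHAR('a::{field,finite})"
  by (rule prime_gt_0_nat) (rule prime_CHAR_finite_field)

text \<open>Translation by 1 permutes the field, so adding \<open>CARD('a)\<close> times 1 does not
  change the sum of all elements; the characteristic therefore divides a power of p.\<close>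

lemma CHAR_eq_of_CARD:
  assumes "prime p" "CARD('a::{field,finite}) = p ^ m"
  shows "CHAR('a) = p"
proof -
  have "(\<Sum>x\<in>UNIV. x :: 'a) = (\<Sum>x\<in>UNIV. x + 1)"
    by (rule sum.reindex_bij_witness[of _ "\<lambda>x. x + 1" "\<lambda>x. x - 1"]) auto
  also have "\<dots> = (\<Sum>x\<in>UNIV. x) + of_nat CARD('a)" by (simp add: sum.distrib)
  finally have "of_nat CARD('a) = (0 :: 'a)" by simp
  hence "CHAR('a) dvd p ^ m" unfolding of_nat_eq_0_iff_char_dvd assms(2) .
  hence "CHAR('a) dvd p" using prime_CHAR_finite_field[where 'a = 'a] prime_dvd_power by blast
  thus ?thesis using prime_CHAR_finite_field[where 'a = 'a] assms(1) primes_dvd_imp_eq by blast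
qed

interpretation Frobenius_field_hom: inj_idom_hom "\<lambda>x :: 'a::{field,finite}. x ^ CHAR('a)"
proof unfold_locales
  have p: "prime CHAR('a)" by (rule prime_CHAR_finite_field)
  fix x y :: 'a
  show "(x + y) ^ CHAR('a) = x ^ CHAR('a) + y ^ CHAR('a)" using freshmans_dream[OF p] by simp
  show "x = 0" if "x ^ CHAR('a) = 0" using that by simp
qed (auto simp: power_mult_distrib CHAR_pos_finite_field)

interpretation Frobenius_poly_hom: inj_idom_hom "\<lambda>x :: 'a::{field,finite} poly. x ^ CHAR('a)"
proof unfold_locales
  have p: "prime CHAR('a poly)" using prime_CHAR_finite_field[where 'a = 'a] by simp
  fix x y :: "'a poly"
  show "(x + y) ^ CHAR('a) = x ^ CHAR('a) + y ^ CHAR('a)" using freshmans_dream[OF p] by simp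
  show "x = 0" if "x ^ CHAR('a) = 0" using that by simp
qed (auto simp: power_mult_distrib CHAR_pos_finite_field)

interpretation Frobenius_fls_hom: inj_idom_hom "\<lambda>x :: 'a::{field,finite} fls. x ^ CHAR('a)"
proof unfold_locales
  have p: "prime CHAR('a fls)" using prime_CHAR_finite_field[where 'a = 'a] by simp
  fix x y :: "'a fls"
  show "(x + y) ^ CHAR('a) = x ^ CHAR('a) + y ^ CHAR('a)" using freshmans_dream[OF p] by simp
  show "x = 0" if "x ^ CHAR('a) = 0" using that by simp
qed (auto simp: power_mult_distrib CHAR_pos_finite_field)

interpretation Frobenius_bipoly_hom: map_poly_inj_idom_hom "\<lambda>x :: 'a::{field,finite} poly. x ^ CHAR('a)" ..

lemma Frobenius_surj: "\<exists>y. y ^ CHAR('a) = (x :: 'a::{field,finite})"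
proof -
  have "inj (\<lambda>x :: 'a. x ^ CHAR('a))"
    by (rule injI) (rule Frobenius_field_hom.injectivity)
  hence "surj (\<lambda>x :: 'a. x ^ CHAR('a))" by (simp add: finite_UNIV_inj_surj)
  thus ?thesis by (metis surjD)
qed

section \<open>Sections with respect to p-th powers\<close>

definition proot :: "'a::{field,finite} \<Rightarrow> 'a" where
  "proot x = (SOME y. y ^ CHAR('a) = x)"

lemma proot_power [simp]: "proot (x :: 'a::{field,finite}) ^ CHAR('a) = x"
  unfolding proot_def using Frobenius_surj by (rule someI_ex)

lemma proot_0 [simp]: "proot 0 = 0"
  by (metis proot_power power_not_zero)

definition frob :: "'a::{field,finite} poly poly \<Rightarrow> 'a poly poly" where
  "frob P = map_poly (\<lambda>a. a ^ CHAR('a)) P"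

text \<open>Any \<open>a\<close> in \<open>F_q[T]\<close> is uniquely \<open>\<Sum>\<^sub>j T^j b\<^sub>j^p\<close> with \<open>j < p\<close>; the section \<open>sect j a\<close> is \<open>b\<^sub>j\<close>.\<close>
definition sect :: "nat \<Rightarrow> 'a::{field,finite} poly \<Rightarrow> 'a poly" where
  "sect j a = Poly (map (\<lambda>i. proot (coeff a (CHAR('a) * i + j))) [0..<Suc (degree a)])"

definition poly_sect :: "nat \<Rightarrow> 'a::{field,finite} poly poly \<Rightarrow> 'a poly poly" where
  "poly_sect j P = map_poly (sect j) P"

lemma coeff_sect: "coeff (sect j a) i = proot (coeff (a :: 'a::{field,finite} poly) (CHAR('a) * i + j))"
proof (cases "i < Suc (degree a)")
  case False
  have "i \<le> CHAR('a) * i" using CHAR_pos_finite_field[where 'a = 'a] by simp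
  hence "degree a < CHAR('a) * i + j" using False by linarith
  thus ?thesis using False by (simp add: sect_def nth_default_beyond coeff_eq_0 del: upt_Suc)
qed (simp add: sect_def nth_default_nth del: upt_Suc)

lemma coeff_power_CHAR:
  fixes b :: "'b::comm_ring_1 poly"
  assumes p: "prime CHAR('b)"
  shows "coeff (b ^ CHAR('b)) k = (if CHAR('b) dvd k then coeff b (k div CHAR('b)) ^ CHAR('b) else 0)"
proof -
  have p0: "0 < CHAR('b)" using p by (simp add: prime_gt_0_nat)
  have "b = (\<Sum>i\<le>degree b. monom (coeff b i) i)" by (rule poly_as_sum_of_monoms[symmetric])
  hence "b ^ CHAR('b) = (\<Sum>i\<le>degree b. monom (coeff b i) i) ^ CHAR('b poly)" by simp
  also have "\<dots> = (\<Sum>i\<le>degree b. monom (coeff b i ^ CHAR('b)) (CHAR('b) * i))"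
    using p by (subst freshmans_dream_sum) (simp_all add: monom_power mult.commute)
  also have "coeff \<dots> k = (\<Sum>i\<le>degree b. if CHAR('b) * i = k then coeff b i ^ CHAR('b) else 0)"
    by (simp add: coeff_sum)
  also have "\<dots> = (if CHAR('b) dvd k then coeff b (k div CHAR('b)) ^ CHAR('b) else 0)"
  proof (cases "CHAR('b) dvd k")
    case True
    then obtain l where l: "k = CHAR('b) * l" by blast
    have "(\<Sum>i\<le>degree b. if CHAR('b) * i = k then coeff b i ^ CHAR('b) else 0) =
      (\<Sum>i\<le>degree b. if i = l then coeff b i ^ CHAR('b) else 0)"
      using p0 by (intro sum.cong) (auto simp: l)
    thus ?thesis using p0 by (auto simp: l coeff_eq_0 zero_power)
  qed (auto intro!: sum.neutral)
  finally show ?thesis .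
qed

text \<open>The coefficient of index \<open>k\<close> meets only the summand
  \<open>j = k mod p\<close>, whose p-th power undoes \<open>proot\<close>.\<close>

lemma sect_decomposition: "(\<Sum>j<CHAR('a). monom 1 j * sect j a ^ CHAR('a)) = (a :: 'a::{field,finite} poly)"
proof (rule poly_eqI)
  fix k
  define p where "p = CHAR('a)"
  have p0: "0 < p" unfolding p_def by (rule CHAR_pos_finite_field)
  have "coeff (\<Sum>j<p. monom 1 j * sect j a ^ p) k =
    (\<Sum>j<p. if j = k mod p then coeff a k else 0)"
    unfolding coeff_sum
  proof (intro sum.cong refl)
    fix j assume j: "j \<in> {..<p}"
    show "coeff (monom 1 j * sect j a ^ p) k = (if j = k mod p then coeff a k else 0)"
    proof (cases "j \<le> k \<and> p dvd k - j")
      case True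
      hence jk: "j = k mod p" using j by (metis le_add_diff_inverse lessThan_iff mod_less mod_eq_dvd_iff_nat)
      have "p * ((k - j) div p) + j = k" using True by simp
      thus ?thesis using True jk by (simp add: coeff_monom_mult p_def coeff_power_CHAR[OF prime_CHAR_finite_field] coeff_sect)
    next
      case False
      hence "j \<noteq> k mod p" using minus_mod_eq_mult_div[of k p] mod_less_eq_dividend[of k p] by auto
      thus ?thesis using False by (auto simp: coeff_monom_mult p_def coeff_power_CHAR[OF prime_CHAR_finite_field])
    qed
  qed
  also have "\<dots> = coeff a k" using p0 by simp
  finally show "coeff (\<Sum>j<CHAR('a). monom 1 j * sect j a ^ CHAR('a)) k = coeff a k" by (simp add: p_def)
qed

lemma coeff_frob [simp]: "coeff (frob P) i = coeff (P :: 'a::{field,finite} poly poly) i ^ CHAR('a)"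
  unfolding frob_def by (rule coeff_map_poly) (simp add: CHAR_pos_finite_field)

lemma coeff_poly_sect [simp]: "coeff (poly_sect j P) i = sect j (coeff P i)"
  unfolding poly_sect_def by (rule coeff_map_poly) (auto intro: poly_eqI simp: coeff_sect)

lemma degree_frob [simp]: "degree (frob P) = degree P"
  unfolding frob_def by (rule Frobenius_poly_hom.degree_map_poly_hom)

lemma frob_mult: "frob (P * Q) = frob P * frob Q"
  unfolding frob_def by (rule Frobenius_bipoly_hom.hom_mult)

lemma frob_inj: "frob P = frob Q \<Longrightarrow> P = Q"
  by (metis Frobenius_poly_hom.injectivity coeff_frob poly_eqI)

lemma degree_poly_sect_le: "degree (poly_sect j P) \<le> degree P"
  unfolding poly_sect_def by (rule degree_map_poly_le)

lemma poly_sect_decomposition: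
  "(\<Sum>j<CHAR('a). [:monom 1 j:] * frob (poly_sect j P)) = (P :: 'a::{field,finite} poly poly)"
  by (rule poly_eqI) (simp add: coeff_sum sect_decomposition)

text \<open>Frobenius is a ring homomorphism and so commutes with recentring; hence every Taylor
  coefficient, not only the value, is raised to the power p.\<close>

lemma taylor_frob:
  fixes P :: "'a::{field,finite} poly poly"
  shows "taylor (frob P) (\<xi> ^ CHAR('a)) = map_poly (\<lambda>x. x ^ CHAR('a)) (taylor P \<xi>)"
proof -
  have 1: "map_poly poly_to_fls (frob P) = map_poly (\<lambda>x. x ^ CHAR('a)) (map_poly poly_to_fls P)"
    by (rule poly_eqI) (simp add: coeff_map_poly poly_to_fls_hom.hom_power
        CHAR_pos_finite_field)
  show ?thesis
    unfolding taylor_def 1 Frobenius_fls_hom.map_poly_pcompose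
    by (simp add: Frobenius_fls_hom.map_poly_pCons_hom)
qed

lemma coeff_taylor_frob [simp]:
  fixes P :: "'a::{field,finite} poly poly"
  shows "coeff (taylor (frob P) (\<xi> ^ CHAR('a))) i = coeff (taylor P \<xi>) i ^ CHAR('a)"
  unfolding taylor_frob
  by (rule coeff_map_poly) (simp add: CHAR_pos_finite_field)

lemma eval_frob: "eval_fls (frob P) (\<xi> ^ CHAR('a)) = eval_fls (P :: 'a::{field,finite} poly poly) \<xi> ^ CHAR('a)"
  using coeff_taylor_frob[of P \<xi> 0] by (simp only: coeff_0_taylor)

lemma height_poly_frob: "height_poly (frob P) = height_poly (P :: 'a::{field,finite} poly poly) ^ CHAR('a)"
proof (rule antisym)
  have co: "fls_abs (poly_to_fls (coeff (frob P) i)) = fls_abs (poly_to_fls (coeff P i)) ^ CHAR('a)" for i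
    by (simp add: poly_to_fls_hom.hom_power fls_abs_power)
  show "height_poly (frob P) \<le> height_poly P ^ CHAR('a)"
  proof (subst height_poly_le_iff)
    show "\<forall>i. fls_abs (poly_to_fls (coeff (frob P) i)) \<le> height_poly P ^ CHAR('a)"
      unfolding co by (intro allI power_mono coeff_le_height_poly) simp
  qed simp
  obtain i where "height_poly P = fls_abs (poly_to_fls (coeff P i))"
    using height_poly_attained by blast
  thus "height_poly P ^ CHAR('a) \<le> height_poly (frob P)"
    using coeff_le_height_poly[of "frob P" i] unfolding co by simp
qed

lemma coeff_taylor_sect:
  fixes P :: "'a::{field,finite} poly poly"
  shows "coeff (taylor P (\<xi> ^ CHAR('a))) i =
    (\<Sum>j<CHAR('a). fls_X_inv ^ j * coeff (taylor (poly_sect j P) \<xi>) i ^ CHAR('a))"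
proof -
  have "taylor P (\<xi> ^ CHAR('a)) = taylor (\<Sum>j<CHAR('a). [:monom 1 j:] * frob (poly_sect j P)) (\<xi> ^ CHAR('a))"
    by (simp only: poly_sect_decomposition)
  also have "\<dots> = (\<Sum>j<CHAR('a). [:fls_X_inv ^ j:] * taylor (frob (poly_sect j P)) (\<xi> ^ CHAR('a)))"
    by (simp only: taylor_sum taylor_mult taylor_const poly_to_fls_monom)
  finally show ?thesis by (simp add: coeff_sum)
qed

lemma fls_abs_eq_imp_subdegree_eq:
  fixes x y :: "'a::{field,finite} fls"
  assumes "fls_abs x = fls_abs y" "x \<noteq> 0" "y \<noteq> 0"
  shows "fls_subdegree x = fls_subdegree y"
proof -
  have "fls_abs v < fls_abs u" if "fls_subdegree u < fls_subdegree v" "u \<noteq> 0" "v \<noteq> 0" for u v :: "'a fls"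
    using that CARD_field_gt_1[where 'a = 'a] by (simp add: fls_abs_def power_int_strict_increasing)
  from this[of x y] this[of y x] show ?thesis using assms by fastforce
qed

text \<open>The nonzero summand of index \<open>j\<close> has subdegree congruent to
  \<open>- j\<close> modulo p, so no two absolute values agree. The attaining index depends on
  \<open>i\<close>: different Taylor coefficients of \<open>P\<close> may be carried by different
  sections.\<close>

lemma taylor_sect_abs:
  fixes P :: "'a::{field,finite} poly poly" and \<xi> :: "'a fls"
  defines "t \<equiv> \<lambda>j i. real CARD('a) ^ j * fls_abs (coeff (taylor (poly_sect j P) \<xi>) i) ^ CHAR('a)"
  shows "\<exists>j<CHAR('a). fls_abs (coeff (taylor P (\<xi> ^ CHAR('a))) i) = t j i"
    and "j < CHAR('a) \<Longrightarrow> t j i \<le> fls_abs (coeff (taylor P (\<xi> ^ CHAR('a))) i)"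
proof -
  define p where "p = CHAR('a)"
  have p0: "0 < p" unfolding p_def by (rule CHAR_pos_finite_field)
  define y where "y j = fls_X_inv ^ j * coeff (taylor (poly_sect j P) \<xi>) i ^ CHAR('a)" for j
  have t: "fls_abs (y j) = t j i" for j
    by (simp add: y_def t_def fls_abs_mult fls_abs_power)
  have q: "1 < real CARD('a)" by (rule real_CARD_field_gt_1)
  have "\<exists>i\<in>{..<p}. fls_abs (\<Sum>j\<in>{..<p}. y j) = fls_abs (y i) \<and> (\<forall>j\<in>{..<p}. fls_abs (y j) \<le> fls_abs (y i))"
  proof (rule fls_abs_sum_distinct)
    fix j l assume jl: "j \<in> {..<p}" "l \<in> {..<p}" "j \<noteq> l" "y j \<noteq> 0" "y l \<noteq> 0"
    have sd: "fls_subdegree (y m) = int p * fls_subdegree (coeff (taylor (poly_sect m P) \<xi>) i) - int m"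
      if "y m \<noteq> 0" for m
      using that by (simp add: y_def p_def fls_subdegree_pow)
    show "fls_abs (y j) \<noteq> fls_abs (y l)"
    proof
      assume "fls_abs (y j) = fls_abs (y l)"
      hence sd_eq: "fls_subdegree (y j) = fls_subdegree (y l)"
        using jl fls_abs_eq_imp_subdegree_eq by blast
      have "int j - int l = int p * fls_subdegree (coeff (taylor (poly_sect j P) \<xi>) i) -
        int p * fls_subdegree (coeff (taylor (poly_sect l P) \<xi>) i)"
        using sd_eq unfolding sd[OF jl(4)] sd[OF jl(5)] by linarith
      hence "int p dvd int j - int l" by (simp flip: right_diff_distrib)
      hence "int j mod int p = int l mod int p" by (simp add: mod_eq_dvd_iff)
      thus False using jl by simp
    qed
  qed (use p0 in auto)
  moreover have "(\<Sum>j\<in>{..<p}. y j) = coeff (taylor P (\<xi> ^ CHAR('a))) i"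
    by (simp add: y_def p_def coeff_taylor_sect)
  ultimately show "\<exists>j<CHAR('a). fls_abs (coeff (taylor P (\<xi> ^ CHAR('a))) i) = t j i"
    "j < CHAR('a) \<Longrightarrow> t j i \<le> fls_abs (coeff (taylor P (\<xi> ^ CHAR('a))) i)"
    by (auto simp: t p_def)
qed

lemma taylor_sect_abs_le:
  fixes P :: "'a::{field,finite} poly poly"
  assumes "j < CHAR('a)"
  shows "fls_abs (coeff (taylor (poly_sect j P) \<xi>) i) ^ CHAR('a) \<le> fls_abs (coeff (taylor P (\<xi> ^ CHAR('a))) i)"
proof -
  have "1 \<le> real CARD('a) ^ j" using CARD_field_gt_1[where 'a = 'a] by (intro one_le_power) simp
  hence "1 * fls_abs (coeff (taylor (poly_sect j P) \<xi>) i) ^ CHAR('a) \<le>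
    real CARD('a) ^ j * fls_abs (coeff (taylor (poly_sect j P) \<xi>) i) ^ CHAR('a)"
    by (intro mult_right_mono) auto
  thus ?thesis using taylor_sect_abs(2)[OF assms, of P \<xi> i] by simp
qed

lemma height_poly_sect_le:
  fixes P :: "'a::{field,finite} poly poly"
  assumes "j < CHAR('a)"
  shows "height_poly (poly_sect j P) ^ CHAR('a) \<le> height_poly P"
proof -
  \<comment> \<open>Coefficients are Taylor coefficients at 0, and 0 is its own p-th power, so the
    estimate for Taylor coefficients of sections also bounds heights.\<close>
  have t0: "taylor F 0 = map_poly poly_to_fls F" for F :: "'a poly poly"
    by (simp add: taylor_def pcompose_idR)
  have "(0 :: 'a fls) ^ CHAR('a) = 0" by (simp add: CHAR_pos_finite_field)
  moreover obtain i where "height_poly (poly_sect j P) = fls_abs (poly_to_fls (coeff (poly_sect j P) i))"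
    using height_poly_attained by blast
  ultimately show ?thesis
    using taylor_sect_abs_le[OF assms, of P 0 i] coeff_le_height_poly[of P i] by (simp add: t0)
qed

subsection \<open>The exponent \<open>w\<^sub>n\<close>\<close>

text \<open>Different polynomials may share a section, so infinitude cannot be inherited by
  injectivity; it is recovered from positive values tending to 0.\<close>

lemma infinite_if_small_values:
  fixes g :: "'b \<Rightarrow> real"
  assumes "\<And>\<epsilon>. 0 < \<epsilon> \<Longrightarrow> \<exists>x\<in>A. 0 < g x \<and> g x < \<epsilon>"
  shows "infinite A"
proof
  assume fin: "finite A"
  define B where "B = {x\<in>A. 0 < g x}"
  have B: "finite B" "B \<noteq> {}" using fin assms[of 1] by (auto simp: B_def)
  have "0 < Min (g ` B)" using B by (subst Min_gr_iff) (auto simp: B_def)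
  then obtain x where x: "x \<in> A" "0 < g x" "g x < Min (g ` B)" using assms by blast
  hence "Min (g ` B) \<le> g x" using B by (intro Min_le) (auto simp: B_def)
  with x show False by simp
qed

lemma ereal_le_if_less_le:
  assumes "\<And>v. v < w \<Longrightarrow> ereal v \<le> S"
  shows "ereal w \<le> S"
proof (rule ccontr)
  assume "\<not> ereal w \<le> S"
  then obtain r where "S < ereal r" "ereal r < ereal w" using ereal_dense2 by (metis not_le)
  with assms[of r] show False by simp
qed

lemma power_powr: "0 < x \<Longrightarrow> (x ^ n) powr y = (x powr y) ^ n" for x y :: real
  by (simp add: powr_realpow[symmetric] powr_powr mult.commute powr_gt_zero)

lemma powr_neg_eventually_less:
  fixes w \<epsilon> :: real
  assumes "0 < w" "0 < \<epsilon>"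
  shows "\<exists>X\<ge>1. \<forall>H\<ge>X. H powr (- w) < \<epsilon>"
proof -
  have "((\<lambda>x :: real. x powr (- w)) \<longlongrightarrow> 0) at_top"
    using assms by (intro tendsto_neg_powr filterlim_ident) auto
  hence "eventually (\<lambda>x. x powr (- w) < \<epsilon>) at_top"
    using assms by (intro order_tendstoD) auto
  then obtain X where "\<forall>H\<ge>X. H powr (- w) < \<epsilon>" unfolding eventually_at_top_linorder by blast
  thus ?thesis by (intro exI[of _ "max 1 X"]) auto
qed

lemma poly_part_exists:
  fixes \<eta> :: "'a::{field,finite} fls"
  shows "\<exists>b. fls_abs (\<eta> - poly_to_fls b) < 1"
proof -
  define b where "b = Poly (map (\<lambda>i. fls_nth \<eta> (- int i)) [0..<Suc (nat (- fls_subdegree \<eta>))])"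
  have b: "coeff b i = fls_nth \<eta> (- int i)" for i
    by (cases "i < Suc (nat (- fls_subdegree \<eta>))")
      (auto simp: b_def nth_default_def nth_append simp del: upt_Suc)
  have "\<forall>i<1. fls_nth (\<eta> - poly_to_fls b) i = 0"
    by (simp add: poly_to_fls_nth b)
  hence "fls_abs (\<eta> - poly_to_fls b) \<le> real CARD('a) powi (- 1)"
    unfolding fls_abs_le_powi_iff .
  also have "\<dots> < 1" using CARD_field_gt_1[where 'a = 'a] by (simp add: power_int_minus field_simps)
  finally show ?thesis by blast
qed

definition w_set :: "nat \<Rightarrow> 'a::{field,finite} fls \<Rightarrow> real \<Rightarrow> 'a poly poly set" where
  "w_set n \<xi> w = {P. degree P \<le> n \<and> 0 < fls_abs (eval_fls P \<xi>) \<and>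
     fls_abs (eval_fls P \<xi>) < height_poly P powr (- w)}"

lemma w_exp_alt: "w_exp n \<xi> = Sup (ereal ` {w. infinite (w_set n \<xi> w)})"
  by (simp add: w_exp_def w_set_def)

lemma eval_fls_linear: "eval_fls [:b, a:] \<xi> = poly_to_fls b + poly_to_fls a * \<xi>"
  by (simp add: eval_fls_def poly_to_fls_hom.map_poly_pCons_hom mult.commute)

lemma infinite_w_set_neg:
  fixes \<xi> :: "'a::{field,finite} fls"
  assumes "1 \<le> n" "w < 0"
  shows "infinite (w_set n \<xi> w)"
proof -
  have "\<exists>b. 0 < fls_abs (\<eta> - poly_to_fls b) \<and> fls_abs (\<eta> - poly_to_fls b) \<le> 1" for \<eta> :: "'a fls"
  proof -
    obtain b where b: "fls_abs (\<eta> - poly_to_fls b) < 1" using poly_part_exists by blast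
    show ?thesis
    proof (cases "\<eta> = poly_to_fls b")
      \<comment> \<open>If \<eta> is itself a polynomial, a shift by 1 keeps the value
        nonzero.\<close>
      case True
      thus ?thesis by (intro exI[of _ "b - 1"]) (simp add: poly_to_fls_hom.hom_minus)
    next
      case False
      thus ?thesis using b by (intro exI[of _ b]) auto
    qed
  qed
  then obtain b where b: "\<And>\<eta> :: 'a fls. 0 < fls_abs (\<eta> - poly_to_fls (b \<eta>))"
    "\<And>\<eta> :: 'a fls. fls_abs (\<eta> - poly_to_fls (b \<eta>)) \<le> 1" by metis
  define a :: "nat \<Rightarrow> 'a poly" where "a k = monom 1 (Suc k)" for k
  define P where "P k = [:- b (poly_to_fls (a k) * \<xi>), a k:]" for k
  have a0: "a k \<noteq> 0" for k by (simp add: a_def)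
  have "P k \<in> w_set n \<xi> w" for k
  proof -
    have ev: "eval_fls (P k) \<xi> = poly_to_fls (a k) * \<xi> - poly_to_fls (b (poly_to_fls (a k) * \<xi>))"
      by (simp add: P_def eval_fls_linear poly_to_fls_hom.hom_uminus)
    have "fls_abs (poly_to_fls (a k)) = real CARD('a) ^ Suc k"
      unfolding fls_abs_poly_to_fls[OF a0] by (simp add: a_def degree_monom_eq)
    moreover have "1 < real CARD('a) ^ Suc k"
      using CARD_field_gt_1[where 'a = 'a] by (intro one_less_power) auto
    moreover have "fls_abs (poly_to_fls (coeff (P k) 1)) \<le> height_poly (P k)" by (rule coeff_le_height_poly)
    ultimately have "1 < height_poly (P k)" by (simp add: P_def)
    hence "1 < height_poly (P k) powr (- w)"
      using powr_less_mono[of 0 "- w" "height_poly (P k)"] assms(2) by simp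
    moreover have "degree (P k) \<le> n" using assms(1) a0 by (simp add: P_def)
    ultimately show ?thesis
      using b[of "poly_to_fls (a k) * \<xi>"] unfolding w_set_def mem_Collect_eq ev by linarith
  qed
  moreover have "inj P"
  proof (rule injI)
    fix k l assume "P k = P l"
    hence "degree (a k) = degree (a l)" by (simp add: P_def)
    thus "k = l" by (simp add: a_def degree_monom_eq)
  qed
  ultimately show ?thesis
    by (meson finite_subset image_subsetI range_inj_infinite)
qed

lemma infinite_w_set_frob:
  fixes \<xi> :: "'a::{field,finite} fls"
  assumes "infinite (w_set n \<xi> w)"
  shows "infinite (w_set n (\<xi> ^ CHAR('a)) w)"
proof -
  have p0: "0 < CHAR('a)" by (rule CHAR_pos_finite_field)
  have "frob ` w_set n \<xi> w \<subseteq> w_set n (\<xi> ^ CHAR('a)) w"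
  proof (rule image_subsetI)
    fix P assume P: "P \<in> w_set n \<xi> w"
    hence "P \<noteq> 0" by (auto simp: w_set_def)
    hence H: "0 < height_poly P" using height_poly_ge_1[of P] by simp
    have "fls_abs (eval_fls P \<xi>) ^ CHAR('a) < (height_poly P powr (- w)) ^ CHAR('a)"
      using P p0 by (intro power_strict_mono) (auto simp: w_set_def)
    thus "frob P \<in> w_set n (\<xi> ^ CHAR('a)) w"
      using P H by (simp add: w_set_def eval_frob height_poly_frob fls_abs_power power_powr)
  qed
  moreover have "infinite (frob ` w_set n \<xi> w)"
    using assms by (metis finite_imageD frob_inj inj_onI)
  ultimately show ?thesis using finite_subset by blast
qed

text \<open>Let \<open>P\<close> be the section carrying the value of \<open>Q\<close>. Since
  \<open>H(P)^p \<le> H(Q)\<close> and the exponent \<open>- w\<close> is negative, the bound for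
  \<open>Q\<close> passes to \<open>P\<close>. By finiteness below a given height,
  \<open>H(Q)\<close> may be taken large, which makes the value of \<open>P\<close> small.\<close>

lemma infinite_w_set_section:
  fixes \<xi> :: "'a::{field,finite} fls"
  assumes inf: "infinite (w_set n (\<xi> ^ CHAR('a)) w)" and w: "0 < w"
  shows "infinite (w_set n \<xi> w)"
proof (rule infinite_if_small_values[where g = "\<lambda>P. fls_abs (eval_fls P \<xi>)"])
  fix \<epsilon> :: real assume \<epsilon>: "0 < \<epsilon>"
  define p where "p = CHAR('a)"
  have p0: "0 < p" unfolding p_def by (rule CHAR_pos_finite_field)
  obtain X where X: "1 \<le> X" "\<And>H. X \<le> H \<Longrightarrow> H powr (- w) < \<epsilon> ^ p"
    using powr_neg_eventually_less[OF w, of "\<epsilon> ^ p"] \<epsilon> by auto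
  have "\<not> w_set n (\<xi> ^ p) w \<subseteq> {Q. degree Q \<le> n \<and> height_poly Q \<le> X}"
    using inf finite_height_poly_le finite_subset unfolding p_def by blast
  then obtain Q where Q: "Q \<in> w_set n (\<xi> ^ p) w" "X < height_poly Q"
    by (force simp: w_set_def not_le)
  obtain j where j: "j < p"
    "fls_abs (eval_fls Q (\<xi> ^ p)) = real CARD('a) ^ j * fls_abs (eval_fls (poly_sect j Q) \<xi>) ^ p"
    using taylor_sect_abs(1)[of Q \<xi> 0] unfolding coeff_0_taylor p_def by blast
  define P where "P = poly_sect j Q"
  have P0: "0 < fls_abs (eval_fls P \<xi>)"
    using Q(1) j(2) p0 by (auto simp: w_set_def P_def zero_power)
  hence HP: "1 \<le> height_poly P" by (intro height_poly_ge_1) auto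
  have "fls_abs (eval_fls P \<xi>) ^ p \<le> fls_abs (eval_fls Q (\<xi> ^ p))"
    using taylor_sect_abs_le[of j Q \<xi> 0] j(1) unfolding coeff_0_taylor p_def P_def by blast
  also have "\<dots> < height_poly Q powr (- w)" using Q by (simp add: w_set_def)
  finally have less: "fls_abs (eval_fls P \<xi>) ^ p < height_poly Q powr (- w)" .
  also have "\<dots> \<le> (height_poly P ^ p) powr (- w)"
    using height_poly_sect_le[of j Q] j(1) HP w unfolding P_def p_def
    by (intro powr_mono2') auto
  also have "\<dots> = (height_poly P powr (- w)) ^ p" using HP by (simp add: power_powr)
  finally have "fls_abs (eval_fls P \<xi>) < height_poly P powr (- w)"
    by (rule power_less_imp_less_base) simp
  moreover have "fls_abs (eval_fls P \<xi>) < \<epsilon>"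
  proof (rule power_less_imp_less_base)
    show "fls_abs (eval_fls P \<xi>) ^ p < \<epsilon> ^ p" using less X(2)[of "height_poly Q"] Q by linarith
  qed (use \<epsilon> in simp)
  moreover have "degree P \<le> n"
    using degree_poly_sect_le[of j Q] Q by (simp add: w_set_def P_def)
  ultimately show "\<exists>P\<in>w_set n \<xi> w. 0 < fls_abs (eval_fls P \<xi>) \<and> fls_abs (eval_fls P \<xi>) < \<epsilon>"
    using P0 by (intro bexI[of _ P]) (auto simp: w_set_def)
qed

lemma w_exp_frob:
  fixes \<xi> :: "'a::{field,finite} fls"
  assumes "1 \<le> n"
  shows "w_exp n (\<xi> ^ CHAR('a)) = w_exp n \<xi>"
proof (rule antisym)
  show "w_exp n \<xi> \<le> w_exp n (\<xi> ^ CHAR('a))"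
    unfolding w_exp_alt using infinite_w_set_frob by (intro Sup_subset_mono image_mono) blast
  have "ereal w \<le> w_exp n \<xi>" if "infinite (w_set n (\<xi> ^ CHAR('a)) w)" for w
  proof (rule ereal_le_if_less_le)
    fix v assume "v < w"
    have upper: "ereal u \<le> w_exp n \<xi>" if "infinite (w_set n \<xi> u)" for u
      unfolding w_exp_alt using that by (intro Sup_upper) auto
    show "ereal v \<le> w_exp n \<xi>"
    proof (cases "0 < w")
      case True
      thus ?thesis using upper[OF infinite_w_set_section[OF that]] \<open>v < w\<close>
        by (meson ereal_less_eq(3) less_imp_le order_trans)
    next
      case False
      thus ?thesis using upper[OF infinite_w_set_neg[OF assms]] \<open>v < w\<close> by simp
    qed
  qed
  thus "w_exp n (\<xi> ^ CHAR('a)) \<le> w_exp n \<xi>"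
    unfolding w_exp_alt[of n "\<xi> ^ CHAR('a)"] by (intro Sup_least) auto
qed

subsection \<open>First properties of \<open>w\<^sub>n\<^sup>*\<close>\<close>

definition w_star_set :: "nat \<Rightarrow> 'a::{field,finite} fls \<Rightarrow> real \<Rightarrow> 'a fls set" where
  "w_star_set n \<xi> w = {\<alpha>. algebraic_fls \<alpha> \<and> degree_fls \<alpha> \<le> n \<and>
     0 < fls_abs (\<xi> - \<alpha>) \<and> fls_abs (\<xi> - \<alpha>) < height_fls \<alpha> powr (- w - 1)}"

lemma w_star_exp_alt: "w_star_exp n \<xi> = Sup (ereal ` {w. infinite (w_star_set n \<xi> w)})"
  by (simp add: w_star_exp_def w_star_set_def)

lemma height_fls_ge_1: "algebraic_fls \<alpha> \<Longrightarrow> 1 \<le> height_fls \<alpha>"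
  unfolding height_fls_def using min_def_poly(2)[of \<alpha>] by (intro height_poly_ge_1) auto

lemma finite_algebraic_bounded:
  "finite {\<alpha> :: 'a::{field,finite} fls. algebraic_fls \<alpha> \<and> degree_fls \<alpha> \<le> n \<and> height_fls \<alpha> \<le> X}"
proof (rule finite_subset)
  show "{\<alpha> :: 'a fls. algebraic_fls \<alpha> \<and> degree_fls \<alpha> \<le> n \<and> height_fls \<alpha> \<le> X} \<subseteq>
    (\<Union>P\<in>{P. degree P \<le> n \<and> height_poly P \<le> X} - {0}. {\<alpha>. eval_fls P \<alpha> = 0})"
  proof
    fix \<alpha> :: "'a fls" assume \<alpha>: "\<alpha> \<in> {\<alpha>. algebraic_fls \<alpha> \<and> degree_fls \<alpha> \<le> n \<and> height_fls \<alpha> \<le> X}"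
    hence "min_def_poly \<alpha> \<noteq> 0" using min_def_poly(2)[of \<alpha>] by auto
    thus "\<alpha> \<in> (\<Union>P\<in>{P. degree P \<le> n \<and> height_poly P \<le> X} - {0}. {\<alpha>. eval_fls P \<alpha> = 0})"
      using \<alpha> min_def_poly(4)[of \<alpha>] by (auto simp: degree_fls_def height_fls_def)
  qed
  have "finite {\<alpha>. eval_fls P \<alpha> = 0}" if "P \<noteq> 0" for P :: "'a poly poly"
    unfolding eval_fls_def using that by (intro poly_roots_finite) simp
  thus "finite (\<Union>P\<in>{P :: 'a poly poly. degree P \<le> n \<and> height_poly P \<le> X} - {0}. {\<alpha>. eval_fls P \<alpha> = 0})"
    using finite_height_poly_le by (intro finite_UN_I) auto
qed

lemma infinite_w_star_set_obtains_height:
  fixes \<xi> :: "'a::{field,finite} fls"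
  assumes "infinite (w_star_set n \<xi> w)"
  shows "\<exists>\<beta>\<in>w_star_set n \<xi> w. X < height_fls \<beta>"
proof (rule ccontr)
  assume "\<not> (\<exists>\<beta>\<in>w_star_set n \<xi> w. X < height_fls \<beta>)"
  hence "w_star_set n \<xi> w \<subseteq> {\<alpha>. algebraic_fls \<alpha> \<and> degree_fls \<alpha> \<le> n \<and> height_fls \<alpha> \<le> X}"
    by (auto simp: w_star_set_def not_less)
  with assms show False using finite_algebraic_bounded finite_subset by blast
qed

text \<open>\<open>frob\<close> of the minimal polynomial of \<alpha> vanishes at
  \<open>\<alpha>^p\<close>, so \<open>H(\<alpha>^p) \<le> H(\<alpha>)^p\<close>; as
  \<open>- w - 1 \<le> 0\<close>, this inequality has the direction needed.\<close>

lemma infinite_w_star_set_frob: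
  fixes \<xi> :: "'a::{field,finite} fls"
  assumes inf: "infinite (w_star_set n \<xi> w)" and w: "- 1 \<le> w"
  shows "infinite (w_star_set n (\<xi> ^ CHAR('a)) w)"
proof -
  define p where "p = CHAR('a)"
  have p0: "0 < p" unfolding p_def by (rule CHAR_pos_finite_field)
  have "(\<lambda>\<alpha>. \<alpha> ^ p) ` w_star_set n \<xi> w \<subseteq> w_star_set n (\<xi> ^ p) w"
  proof (rule image_subsetI)
    fix \<alpha> assume \<alpha>: "\<alpha> \<in> w_star_set n \<xi> w"
    hence alg: "algebraic_fls \<alpha>" by (simp add: w_star_set_def)
    define P where "P = min_def_poly \<alpha>"
    have P: "eval_fls P \<alpha> = 0" "0 < degree P" using min_def_poly[OF alg] by (auto simp: P_def)
    have "eval_fls (frob P) (\<alpha> ^ p) = 0" unfolding p_def eval_frob P(1) using p0 by (simp add: p_def)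
    moreover have "frob P \<noteq> 0" using P(2) by (metis degree_frob degree_0 less_irrefl)
    ultimately have alg': "algebraic_fls (\<alpha> ^ p)" "degree_fls (\<alpha> ^ p) \<le> degree P"
      "height_fls (\<alpha> ^ p) \<le> height_poly P ^ p"
      using root_degree_height_le[of "frob P" "\<alpha> ^ p"] by (simp_all add: height_poly_frob p_def)
    have H: "1 \<le> height_poly P" "1 \<le> height_fls (\<alpha> ^ p)"
      using height_fls_ge_1[OF alg] height_fls_ge_1[OF alg'(1)] by (simp_all add: P_def height_fls_def)
    have diff: "\<xi> ^ p - \<alpha> ^ p = (\<xi> - \<alpha>) ^ p"
      unfolding p_def by (rule Frobenius_fls_hom.hom_minus[symmetric])
    have "fls_abs (\<xi> - \<alpha>) ^ p < (height_poly P powr (- w - 1)) ^ p"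
      using \<alpha> p0 by (intro power_strict_mono) (auto simp: w_star_set_def height_fls_def P_def)
    also have "\<dots> = (height_poly P ^ p) powr (- w - 1)" using H by (simp add: power_powr)
    also have "\<dots> \<le> height_fls (\<alpha> ^ p) powr (- w - 1)"
      using alg' H w by (intro powr_mono2') auto
    finally show "\<alpha> ^ p \<in> w_star_set n (\<xi> ^ p) w"
      using \<alpha> alg'(1,2) p0 unfolding w_star_set_def mem_Collect_eq diff fls_abs_power
      by (simp add: degree_fls_def[of \<alpha>] P_def)
  qed
  moreover have "infinite ((\<lambda>\<alpha>. \<alpha> ^ p) ` w_star_set n \<xi> w)"
    using inf unfolding p_def by (metis finite_imageD Frobenius_fls_hom.injectivity inj_onI)
  ultimately show ?thesis using finite_subset unfolding p_def by blast
qed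

lemma fls_abs_X: "fls_abs (fls_X :: 'a::{field,finite} fls) = 1 / real CARD('a)"
  by (simp add: fls_abs_def power_int_minus field_simps)

text \<open>At exponent -1 the distance only has to be below \<open>H^0 = 1\<close>, so the rational
  elements \<open>b + T^(-k-1)\<close>, with \<open>b\<close> within distance less than 1 of \<xi>,
  suffice. Hence every exponent is at least -1, which disposes of all smaller
  \<open>w\<close>.\<close>

lemma infinite_w_star_set_minus_1:
  fixes \<xi> :: "'a::{field,finite} fls"
  assumes "1 \<le> n"
  shows "infinite (w_star_set n \<xi> (- 1))"
proof -
  obtain b where b: "fls_abs (\<xi> - poly_to_fls b) < 1" using poly_part_exists by blast
  define \<alpha> where "\<alpha> k = poly_to_fls b + fls_X ^ Suc k" for k
  have X: "fls_abs (fls_X ^ Suc k :: 'a fls) < 1" for k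
    using CARD_field_gt_1[where 'a = 'a]
    by (simp add: fls_abs_power fls_abs_X power_less_one_iff del: power_Suc)
  have "range \<alpha> - {\<xi>} \<subseteq> w_star_set n \<xi> (- 1)"
  proof
    fix x assume "x \<in> range \<alpha> - {\<xi>}"
    then obtain k where k: "x = \<alpha> k" "\<alpha> k \<noteq> \<xi>" by blast
    define P where "P = [:- (b * monom 1 (Suc k) + 1), monom 1 (Suc k) :: 'a poly:]"
    have P: "P \<noteq> 0" "degree P \<le> n" using assms by (auto simp: P_def)
    have inv: "fls_X_inv ^ Suc k * fls_X ^ Suc k = (1 :: 'a fls)"
    proof -
      have "fls_X_inv * fls_X = (1 :: 'a fls)"
        by (auto simp: fls_eq_iff fls_X_inv_times_conv_shift)
      thus ?thesis by (metis power_mult_distrib power_one)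
    qed
    have "eval_fls P (\<alpha> k) = fls_X_inv ^ Suc k * fls_X ^ Suc k - 1"
      unfolding P_def eval_fls_linear \<alpha>_def
      by (simp only: poly_to_fls_hom.hom_uminus poly_to_fls_hom.hom_add poly_to_fls_hom.hom_mult
          poly_to_fls_hom.hom_one poly_to_fls_monom) (simp add: algebra_simps del: power_Suc)
    hence "eval_fls P (\<alpha> k) = 0" using inv by simp
    note root = root_degree_height_le[OF P(1) this]
    have "fls_abs (\<xi> - \<alpha> k) \<le> max (fls_abs (\<xi> - poly_to_fls b)) (fls_abs (fls_X ^ Suc k :: 'a fls))"
      using fls_abs_add_le_max[of "\<xi> - poly_to_fls b" "- (fls_X ^ Suc k)"] by (simp add: \<alpha>_def diff_diff_eq)
    hence "fls_abs (\<xi> - \<alpha> k) < 1" using b X[of k] by linarith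
    thus "x \<in> w_star_set n \<xi> (- 1)"
      using k root P(2) height_fls_ge_1[OF root(1)] by (auto simp: w_star_set_def)
  qed
  moreover have "inj \<alpha>"
  proof (rule injI)
    fix k l assume "\<alpha> k = \<alpha> l"
    hence "fls_X ^ Suc k = (fls_X ^ Suc l :: 'a fls)" by (simp add: \<alpha>_def)
    hence "fls_subdegree (fls_X ^ Suc k :: 'a fls) = fls_subdegree (fls_X ^ Suc l :: 'a fls)" by simp
    thus "k = l" by (simp only: fls_subdegree_fls_X_pow)
  qed
  hence "infinite (range \<alpha> - {\<xi>})" using range_inj_infinite by simp
  ultimately show ?thesis using finite_subset by blast
qed

lemma w_star_exp_upper: "infinite (w_star_set n \<xi> w) \<Longrightarrow> ereal w \<le> w_star_exp n \<xi>"
  unfolding w_star_exp_alt by (intro Sup_upper) auto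

lemma w_star_exp_le_frob:
  fixes \<xi> :: "'a::{field,finite} fls"
  assumes "1 \<le> n"
  shows "w_star_exp n \<xi> \<le> w_star_exp n (\<xi> ^ CHAR('a))"
  unfolding w_star_exp_alt[of n \<xi>]
proof (intro Sup_least, safe)
  fix w assume inf: "infinite (w_star_set n \<xi> w)"
  show "ereal w \<le> w_star_exp n (\<xi> ^ CHAR('a))"
  proof (cases "- 1 \<le> w")
    case True
    thus ?thesis using w_star_exp_upper infinite_w_star_set_frob[OF inf] by blast
  next
    case False
    hence "ereal w \<le> ereal (- 1)" by simp
    also have "\<dots> \<le> w_star_exp n (\<xi> ^ CHAR('a))"
      using w_star_exp_upper infinite_w_star_set_minus_1[OF assms] by blast
    finally show ?thesis .
  qed
qed

subsection \<open>A Wirsing-type lower bound for \<open>w\<^sub>n\<^sup>*\<close>\<close>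

text \<open>Pigeonhole over the finite field: two coefficient tables whose values at \<xi> agree in
  sufficiently many Laurent coefficients are subtracted.\<close>

lemma Dirichlet_polynomials:
  fixes \<xi> :: "'a::{field,finite} fls"
  shows "\<exists>C\<ge>1. \<forall>k. \<exists>Q. Q \<noteq> 0 \<and> degree Q \<le> n \<and> height_poly Q \<le> real CARD('a) ^ k \<and>
    fls_abs (eval_fls Q \<xi>) \<le> C / real CARD('a) ^ (k * n)"
proof -
  define q where "q = real CARD('a)"
  have q: "1 < q" unfolding q_def by (rule real_CARD_field_gt_1)
  obtain e where e: "max 1 (fls_abs \<xi>) < q ^ e" using real_arch_pow[OF q] by blast
  have "\<exists>Q. Q \<noteq> 0 \<and> degree Q \<le> n \<and> height_poly Q \<le> q ^ k \<and> fls_abs (eval_fls Q \<xi>) \<le> q ^ (n * e) / q ^ (k * n)" for k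
  proof -
    define A where "A = {..n} \<times> {..k} \<rightarrow>\<^sub>E (UNIV :: 'a set)"
    define F where "F f = (\<Sum>a\<le>n. monom (\<Sum>b\<le>k. monom (f (a, b)) b) a)" for f :: "nat \<times> nat \<Rightarrow> 'a"
    \<comment> \<open>\<open>q^s\<close> bounds the value at \<xi> of every polynomial considered,
      so Laurent coefficients below \<open>- s\<close> vanish anyway. \<open>m\<close> is chosen
      with \<open>m + s = (k + 1) * (n + 1) - 1\<close>, one condition fewer than there are free
      coefficients.\<close>
    define s where "s = int k + int n * int e"
    define m where "m = int (k * n) + int n - int n * int e"
    define I where "I = {- s..<m}"
    define \<Phi> where "\<Phi> f = (\<lambda>i\<in>I. fls_nth (eval_fls (F f) \<xi>) i)" for f
    have coF: "coeff (coeff (F f) a) b = (if a \<le> n \<and> b \<le> k then f (a, b) else 0)" for f a b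
    proof (cases "a \<le> n")
      case True
      hence "coeff (F f) a = (\<Sum>b\<le>k. monom (f (a, b)) b)" by (simp add: F_def coeff_sum)
      thus ?thesis using True by (simp add: coeff_sum)
    qed (simp add: F_def coeff_sum)
    define N where "N = (k + 1) * (n + 1)"
    have "card I = nat (m - (- s))" by (simp only: I_def card_atLeastLessThan_int)
    moreover have "m - (- s) = int N - 1" by (simp add: s_def m_def N_def algebra_simps)
    moreover have "0 < N" by (simp add: N_def)
    ultimately have "card I < (k + 1) * (n + 1)" unfolding N_def[symmetric] by linarith
    hence "CARD('a) ^ card I < CARD('a) ^ ((k + 1) * (n + 1))"
      using CARD_field_gt_1[where 'a = 'a] by (intro power_strict_increasing) auto
    moreover have "card A = CARD('a) ^ ((k + 1) * (n + 1))"
      by (simp add: A_def card_PiE card_cartesian_product mult.commute)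
    moreover have "\<Phi> ` A \<subseteq> I \<rightarrow>\<^sub>E (UNIV :: 'a set)" by (auto simp: \<Phi>_def)
    hence "card (\<Phi> ` A) \<le> card (I \<rightarrow>\<^sub>E (UNIV :: 'a set))"
      by (intro card_mono finite_PiE) (auto simp: I_def)
    moreover have "card (I \<rightarrow>\<^sub>E (UNIV :: 'a set)) = CARD('a) ^ card I"
      by (simp add: card_PiE I_def)
    ultimately have "\<not> inj_on \<Phi> A" by (intro pigeonhole) linarith
    then obtain f g where fg: "f \<in> A" "g \<in> A" "\<Phi> f = \<Phi> g" "f \<noteq> g" unfolding inj_on_def by blast
    define D where "D = F f - F g"
    have "\<exists>x\<in>{..n} \<times> {..k}. f x \<noteq> g x"
      using fg PiE_ext unfolding A_def by metis
    then obtain a b where ab: "a \<le> n" "b \<le> k" "f (a, b) \<noteq> g (a, b)" by auto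
    hence "coeff (coeff D a) b \<noteq> 0" by (simp add: D_def coF)
    hence D0: "D \<noteq> 0" by auto
    have "coeff D a = 0" if "n < a" for a
      using that by (intro poly_eqI) (simp add: D_def coF)
    hence degD: "degree D \<le> n" by (intro degree_le) auto
    have "degree (coeff D a) \<le> k" for a
      by (intro degree_le) (auto simp: D_def coF)
    hence HD: "height_poly D \<le> q ^ k"
    proof (subst height_poly_le_iff)
      assume deg: "\<And>a. degree (coeff D a) \<le> k"
      show "\<forall>i. fls_abs (poly_to_fls (coeff D i)) \<le> q ^ k"
      proof
        fix i
        show "fls_abs (poly_to_fls (coeff D i)) \<le> q ^ k"
          using deg[of i] q
          by (cases "coeff D i = 0") (auto simp: fls_abs_poly_to_fls q_def[symmetric] intro: power_increasing)
      qed
    qed (use q in simp)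
    have "fls_abs (eval_fls D \<xi>) \<le> height_poly D * max 1 (fls_abs \<xi>) ^ degree D"
      using coeff_taylor_le[of D \<xi> 0] by (simp add: coeff_0_taylor)
    also have "\<dots> \<le> q ^ k * (q ^ e) ^ n"
    proof (rule mult_mono[OF HD])
      have "max 1 (fls_abs \<xi>) ^ degree D \<le> max 1 (fls_abs \<xi>) ^ n" using degD by (intro power_increasing) auto
      also have "\<dots> \<le> (q ^ e) ^ n" using e by (intro power_mono) auto
      finally show "max 1 (fls_abs \<xi>) ^ degree D \<le> (q ^ e) ^ n" .
    qed (use q in auto)
    also have "\<dots> = q powi (- (- s))"
    proof -
      have "s = int (k + e * n)" by (simp add: s_def mult.commute)
      thus ?thesis by (simp only: minus_minus power_int_of_nat power_add power_mult)
    qed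
    finally have low: "\<forall>i < - s. fls_nth (eval_fls D \<xi>) i = 0"
      unfolding q_def fls_abs_le_powi_iff .
    have evD: "eval_fls D \<xi> = eval_fls (F f) \<xi> - eval_fls (F g) \<xi>"
      by (simp add: D_def eval_fls_def poly_to_fls_poly_hom.hom_minus)
    have "\<forall>i<m. fls_nth (eval_fls D \<xi>) i = 0"
    proof safe
      fix i assume i: "i < m"
      show "fls_nth (eval_fls D \<xi>) i = 0"
      proof (cases "i < - s")
        case False
        hence "i \<in> I" using i by (simp add: I_def)
        hence "fls_nth (eval_fls (F f) \<xi>) i = fls_nth (eval_fls (F g) \<xi>) i"
          using fun_cong[OF fg(3), of i] by (simp add: \<Phi>_def)
        thus ?thesis by (simp add: evD)
      qed (use low in simp)
    qed
    hence "fls_abs (eval_fls D \<xi>) \<le> q powi (- m)"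
      unfolding q_def fls_abs_le_powi_iff .
    also have "\<dots> \<le> q powi (int (n * e) - int (k * n))"
      using q by (intro power_int_increasing) (auto simp: m_def)
    also have "\<dots> = q ^ (n * e) / q ^ (k * n)"
      using q power_int_diff[of q "int (n * e)" "int (k * n)"] by (simp only: power_int_of_nat) simp
    finally show ?thesis using D0 degD HD by blast
  qed
  moreover have "1 \<le> q ^ (n * e)" using q by (intro one_le_power) simp
  ultimately show ?thesis unfolding q_def by blast
qed

lemma height_poly_eq_power:
  assumes "P \<noteq> 0"
  shows "\<exists>K. height_poly (P :: 'a::{field,finite} poly poly) = real CARD('a) ^ K"
proof -
  obtain i where i: "height_poly P = fls_abs (poly_to_fls (coeff P i))" using height_poly_attained by blast
  hence "coeff P i \<noteq> 0" using height_poly_ge_1[OF assms] by auto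
  thus ?thesis using i by (auto simp: fls_abs_poly_to_fls)
qed

text \<open>Otherwise the multiplicative function \<open>f P = |P(\<xi>)| * H(P)^s\<close> would be
  at least 1 on nonzero constants and on irreducible polynomials of large height, and at least some
  \<open>c > 0\<close> on the finitely many remaining ones. Then \<open>f Q \<ge> c^n\<close> for
  all nonzero \<open>Q\<close> of degree at most \<open>n\<close>, which contradicts Dirichlet
  because \<open>s < n\<close>.\<close>

lemma small_irreducible_polynomials:
  fixes \<xi> :: "'a::{field,finite} fls"
  assumes nonzero: "\<And>P. P \<noteq> 0 \<Longrightarrow> degree P \<le> n \<Longrightarrow> eval_fls P \<xi> \<noteq> 0"
    and s: "0 \<le> s" "s < real n"
  shows "\<exists>P. irreducible P \<and> 0 < degree P \<and> degree P \<le> n \<and> X < height_poly P \<and>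
    fls_abs (eval_fls P \<xi>) < height_poly P powr (- s)"
proof (rule ccontr)
  assume neg: "\<not> ?thesis"
  define f where "f P = fls_abs (eval_fls P \<xi>) * height_poly P powr s" for P :: "'a poly poly"
  define S where "S = {P :: 'a poly poly. P \<noteq> 0 \<and> degree P \<le> n \<and> height_poly P \<le> X}"
  have S: "finite S" unfolding S_def by (rule finite_subset[OF _ finite_height_poly_le[of n X]]) auto
  define c where "c = Min (insert 1 (f ` S))"
  have "0 < f P" if "P \<in> S" for P
    using that nonzero[of P] height_poly_ge_1[of P] by (auto simp: S_def f_def)
  hence c: "0 < c" "c \<le> 1" using S by (auto simp: c_def)
  have cS: "c \<le> f P" if "P \<in> S" for P using S that by (simp add: c_def)
  have const: "c ^ degree P \<le> f P" if "P \<noteq> 0" "degree P = 0" for P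
  proof -
    from that(2) obtain a where "P = [:a:]" by (auto elim!: degree_eq_zeroE)
    with that(1) have a: "P = [:a:]" "a \<noteq> 0" by auto
    have "1 \<le> fls_abs (eval_fls P \<xi>)" using a fls_abs_poly_to_fls_ge_1[of a] by simp
    moreover have "1 \<le> height_poly P powr s" using height_poly_ge_1[OF that(1)] s by (intro ge_one_powr_ge_zero)
    ultimately have "1 * 1 \<le> f P" unfolding f_def by (intro mult_mono) auto
    thus ?thesis using that by simp
  qed
  have lower: "degree P \<le> n \<longrightarrow> c ^ degree P \<le> f P" if "P \<noteq> 0" for P
    using that
  proof (induction P rule: bivariate_poly_induct)
    case (unit P)
    then obtain a where "P = [:a:]" "a \<noteq> 0" by (auto simp: is_unit_poly_iff)
    thus ?case using const[of P] by simp
  next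
    case (irreducible P)
    show ?case
    proof (cases "degree P = 0")
      case True
      thus ?thesis using const[of P] irreducible by auto
    next
      case False
      show ?thesis
      proof
        assume deg: "degree P \<le> n"
        have P0: "P \<noteq> 0" using False by auto
        have c1: "c ^ degree P \<le> c" using c False by (metis less_imp_le power_decreasing power_one_right One_nat_def Suc_leI neq0_conv)
        show "c ^ degree P \<le> f P"
        proof (cases "P \<in> S")
          case True
          thus ?thesis using cS c1 by fastforce
        next
          case notS: False
          hence "X < height_poly P" using P0 deg by (auto simp: S_def)
          hence "height_poly P powr (- s) \<le> fls_abs (eval_fls P \<xi>)"
            using neg irreducible False deg by (meson not_less neq0_conv)
          hence "height_poly P powr (- s) * height_poly P powr s \<le> f P"
            unfolding f_def by (intro mult_right_mono) auto
          moreover have "height_poly P powr (- s) * height_poly P powr s = 1"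
            using height_poly_ge_1[OF P0] by (simp flip: powr_add)
          ultimately show ?thesis using c1 c by linarith
        qed
      qed
    qed
  next
    case (mult A B)
    have deg: "degree (A * B) = degree A + degree B" using mult by (intro degree_mult_eq) auto
    show ?case
    proof
      assume "degree (A * B) \<le> n"
      hence "c ^ degree A \<le> f A" "c ^ degree B \<le> f B" using mult deg by auto
      hence "c ^ degree A * c ^ degree B \<le> f A * f B" using c by (intro mult_mono) (auto simp: f_def)
      also have "f A * f B = f (A * B)"
        by (simp add: f_def fls_abs_mult height_poly_mult powr_mult)
      finally show "c ^ degree (A * B) \<le> f (A * B)" by (simp add: deg power_add)
    qed
  qed
  define q where "q = real CARD('a)"
  have q: "1 < q" unfolding q_def by (rule real_CARD_field_gt_1)
  obtain C where C: "1 \<le> C" "\<And>k. \<exists>Q. Q \<noteq> 0 \<and> degree Q \<le> n \<and> height_poly Q \<le> q ^ k \<and>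
    fls_abs (eval_fls Q \<xi>) \<le> C / q ^ (k * n)"
    using Dirichlet_polynomials[of n \<xi>] unfolding q_def by blast
  have "0 < c ^ n / C" using c C by simp
  then obtain Y where Y: "\<And>H. Y \<le> H \<Longrightarrow> H powr (- (real n - s)) < c ^ n / C"
    using powr_neg_eventually_less[of "real n - s" "c ^ n / C"] s by auto
  obtain k where k: "Y < q ^ k" using real_arch_pow[OF q] by blast
  obtain Q where Q: "Q \<noteq> 0" "degree Q \<le> n" "height_poly Q \<le> q ^ k" "fls_abs (eval_fls Q \<xi>) \<le> C / q ^ (k * n)"
    using C(2)[of k] by blast
  have "c ^ n \<le> c ^ degree Q" using c Q by (intro power_decreasing) auto
  also have "\<dots> \<le> f Q" using lower Q by blast
  also have "\<dots> \<le> (C / q ^ (k * n)) * (q ^ k) powr s"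
    unfolding f_def using Q s C q by (intro mult_mono powr_mono2) auto
  also have "\<dots> = C * (q ^ k) powr (- (real n - s))"
  proof -
    have "q ^ (k * n) = (q ^ k) powr (real n)" using q by (simp add: powr_realpow power_mult)
    thus ?thesis using q by (simp add: powr_minus powr_diff field_simps)
  qed
  also have "\<dots> < C * (c ^ n / C)" using Y[of "q ^ k"] k C by (intro mult_strict_left_mono) auto
  finally show False using C by simp
qed

lemma w_star_set_infiniteI:
  fixes \<xi> :: "'a::{field,finite} fls"
  assumes "\<And>\<epsilon>. 0 < \<epsilon> \<Longrightarrow> \<exists>\<alpha>\<in>w_star_set n \<xi> w. fls_abs (\<xi> - \<alpha>) < \<epsilon>"
  shows "infinite (w_star_set n \<xi> w)"
proof (rule infinite_if_small_values[where g = "\<lambda>\<alpha>. fls_abs (\<xi> - \<alpha>)"])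
  fix \<epsilon> :: real assume "0 < \<epsilon>"
  then obtain \<alpha> where "\<alpha> \<in> w_star_set n \<xi> w" "fls_abs (\<xi> - \<alpha>) < \<epsilon>" using assms by blast
  thus "\<exists>\<alpha>\<in>w_star_set n \<xi> w. 0 < fls_abs (\<xi> - \<alpha>) \<and> fls_abs (\<xi> - \<alpha>) < \<epsilon>"
    by (intro bexI[of _ \<alpha>]) (auto simp: w_star_set_def)
qed

text \<open>An irreducible \<open>P\<close> with \<open>|P(\<xi>)|\<close> small and a polynomial \<open>Q\<close> of smaller height with
  \<open>|Q(\<xi>)|\<close> small are coprime, so their derivatives at \<open>\<xi>\<close> cannot both be small; the one with large
  derivative has, by Hensel's lemma, a root near \<open>\<xi>\<close>.\<close>
lemma infinite_w_star_set_Wirsing: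
  fixes \<xi> :: "'a::{field,finite} fls"
  assumes n: "1 \<le> n" and nonzero: "\<And>P. P \<noteq> 0 \<Longrightarrow> degree P \<le> n \<Longrightarrow> eval_fls P \<xi> \<noteq> 0"
    and M: "0 \<le> M" "M < (real n + 1) / 2"
  shows "infinite (w_star_set n \<xi> (M - 1))"
proof (rule w_star_set_infiniteI)
  fix \<epsilon> :: real assume \<epsilon>: "0 < \<epsilon>"
  \<comment> \<open>\<open>M'\<close> lies above \<open>M\<close> and above
    \<open>(2 * n + 1) / 4\<close>, the threshold of the double root bound, but below
    \<open>(n + 1) / 2\<close>. With \<kappa> the remaining gap, \<open>\<delta> = H^(-M')\<close>
    gives \<open>H * \<delta>^2 = H^(-n + 2 * \<kappa>)\<close>, which leaves room for values of
    size \<open>H^(-n + \<kappa>)\<close>.\<close>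
  define M' where "M' = (max M ((2 * real n + 1) / 4) + (real n + 1) / 2) / 2"
  define \<kappa> where "\<kappa> = (real n + 1) / 2 - M'"
  have M': "M < M'" "(2 * real n + 1) / 4 < M'" "M' < (real n + 1) / 2"
    using M by (auto simp: M'_def max_def field_simps)
  have \<kappa>: "0 < \<kappa>" "\<kappa> < 1 / 4" using M' by (auto simp: \<kappa>_def field_simps)
  define q where "q = real CARD('a)"
  have q: "1 < q" unfolding q_def by (rule real_CARD_field_gt_1)
  obtain C where C: "1 \<le> C" "\<And>k. \<exists>Q. Q \<noteq> 0 \<and> degree Q \<le> n \<and> height_poly Q \<le> q ^ k \<and>
    fls_abs (eval_fls Q \<xi>) \<le> C / q ^ (k * n)"
    using Dirichlet_polynomials[of n \<xi>] unfolding q_def by blast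
  define L where "L = max 1 (fls_abs \<xi>)"
  \<comment> \<open>\<open>C1\<close> absorbs the recentring loss \<open>L^n\<close> and the factor
    \<open>q^n\<close> that arises from using Dirichlet at height \<open>H / q\<close> instead of
    \<open>H\<close>.\<close>
  define C1 where "C1 = max (L ^ n) (C * q ^ n)"
  have L: "1 \<le> L" by (simp add: L_def)
  have "1 \<le> L ^ n" using L by (rule one_le_power)
  hence C1: "1 \<le> C1" "L ^ n \<le> C1" "C * q ^ n \<le> C1" by (auto simp: C1_def)
  obtain X1 where X1: "1 \<le> X1" "\<And>H. X1 \<le> H \<Longrightarrow> H powr (- (4 * M' - real (2 * n + 1))) < 1 / C1 ^ (2 * n + 1)"
    using powr_neg_eventually_less[of "4 * M' - real (2 * n + 1)" "1 / C1 ^ (2 * n + 1)"] M' C1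
    by (auto simp: field_simps)
  obtain X2 where X2: "1 \<le> X2" "\<And>H. X2 \<le> H \<Longrightarrow> H powr (- (M' + \<kappa>)) < \<epsilon>"
    using powr_neg_eventually_less[of "M' + \<kappa>" \<epsilon>] M M' \<kappa> \<epsilon> by auto
  have "\<exists>P. irreducible P \<and> 0 < degree P \<and> degree P \<le> n \<and> max X1 X2 < height_poly P \<and>
    fls_abs (eval_fls P \<xi>) < height_poly P powr (- (real n - \<kappa>))"
    by (rule small_irreducible_polynomials[OF nonzero]) (use \<kappa> n in auto)
  then obtain P where P: "irreducible P" "0 < degree P" "degree P \<le> n" "max X1 X2 < height_poly P"
    "fls_abs (eval_fls P \<xi>) < height_poly P powr (- (real n - \<kappa>))" by blast
  define H where "H = height_poly P"
  have H: "1 < H" "X1 \<le> H" "X2 \<le> H" using P X1 by (auto simp: H_def)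
  have P0: "P \<noteq> 0" using P by auto
  \<comment> \<open>Heights are powers of \<open>q\<close>; Dirichlet at the next smaller power
    gives a \<open>Q\<close> of height below \<open>H(P)\<close>, which \<open>P\<close> therefore
    cannot divide.\<close>
  obtain K where K: "H = q ^ K" using height_poly_eq_power[OF P0] by (auto simp: H_def q_def)
  have "K \<noteq> 0" using K H by (metis less_irrefl power_0)
  then obtain k where k: "K = Suc k" using not0_implies_Suc by blast
  obtain Q where Q: "Q \<noteq> 0" "degree Q \<le> n" "height_poly Q \<le> q ^ k" "fls_abs (eval_fls Q \<xi>) \<le> C / q ^ (k * n)"
    using C(2)[of k] by blast
  have qk: "q ^ k < H" using q by (simp add: K k)
  have "\<not> P dvd Q"
    using height_poly_dvd_le[of P Q] Q qk by (auto simp: H_def)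
  then obtain U V c where Bezout: "c \<noteq> 0" "U * P + V * Q = [:c:]"
    using irreducible_Bezout P by blast
  define \<delta> where "\<delta> = H powr (- M')"
  define h where "h = C1 * H"
  have \<delta>: "0 < \<delta>" "\<delta> \<le> 1" using H M M' powr_mono[of "- M'" 0 H] by (auto simp: \<delta>_def)
  have "1 * 1 \<le> C1 * H" using C1 H by (intro mult_mono) auto
  hence h: "1 \<le> h" by (simp add: h_def)
  have \<delta>2: "H * \<delta>\<^sup>2 = H powr (- real n + 2 * \<kappa>)"
  proof -
    have "\<delta>\<^sup>2 = H powr (- 2 * M')" unfolding \<delta>_def power2_eq_square powr_add[symmetric] by simp
    hence "H * \<delta>\<^sup>2 = H powr 1 * H powr (- 2 * M')" using H by simp
    also have "\<dots> = H powr (1 + - 2 * M')" by (simp only: powr_add)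
    also have "1 + - 2 * M' = - real n + 2 * \<kappa>" by (simp add: \<kappa>_def field_simps)
    finally show ?thesis .
  qed
  have small: "fls_abs (eval_fls R \<xi>) \<le> C1 * H powr (- real n + \<kappa>)" if "R \<in> {P, Q}" for R
  proof -
    have "fls_abs (eval_fls P \<xi>) \<le> 1 * H powr (- real n + \<kappa>)" using P(5) by (simp add: H_def)
    also have "\<dots> \<le> C1 * H powr (- real n + \<kappa>)" using C1 by (intro mult_right_mono) auto
    finally have 1: "fls_abs (eval_fls P \<xi>) \<le> C1 * H powr (- real n + \<kappa>)" .
    have "C / q ^ (k * n) = (C * q ^ n) * H powr (- real n)"
    proof -
      have "H powr (- real n) = 1 / H ^ n" using H by (simp add: powr_minus powr_realpow divide_inverse)
      also have "H ^ n = q ^ (k * n) * q ^ n" by (simp add: K k power_mult power_mult_distrib)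
      finally show ?thesis using q by simp
    qed
    also have "\<dots> \<le> C1 * H powr (- real n + \<kappa>)"
      using C1 C q H \<kappa> by (intro mult_mono powr_mono) auto
    finally have 2: "fls_abs (eval_fls Q \<xi>) \<le> C1 * H powr (- real n + \<kappa>)" using Q by linarith
    show ?thesis using 1 2 that by auto
  qed
  have all: "fls_abs (coeff (taylor R \<xi>) i) \<le> h" if "R \<in> {P, Q}" for R i
  proof -
    have R: "degree R \<le> n" "height_poly R \<le> H" using that P Q qk by (auto simp: H_def)
    have "fls_abs (coeff (taylor R \<xi>) i) \<le> height_poly R * L ^ degree R"
      using coeff_taylor_le by (simp add: L_def)
    also have "\<dots> \<le> H * L ^ n" using R L H by (intro mult_mono power_increasing) auto
    also have "\<dots> \<le> h" using C1 H by (simp add: h_def mult.commute)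
    finally show ?thesis .
  qed
  \<comment> \<open>If both first Taylor coefficients were at most \<open>h * \<delta>\<close>, the
    double root bound would keep \<open>C1^(2n+1) * H^(2n+1-4M')\<close> at least 1, which fails for
    large \<open>H\<close>.\<close>
  have "\<exists>R\<in>{P, Q}. h * \<delta> < fls_abs (coeff (taylor R \<xi>) 1)"
  proof (rule ccontr)
    assume neg: "\<not> ?thesis"
    have "C1 * H powr (- real n + \<kappa>) \<le> C1 * (H * \<delta>\<^sup>2)"
      unfolding \<delta>2 using C1 H \<kappa> by (intro mult_left_mono powr_mono) auto
    hence zero: "fls_abs (coeff (taylor R \<xi>) 0) \<le> h * \<delta>\<^sup>2" if "R \<in> {P, Q}" for R
      using small[OF that] by (simp add: coeff_0_taylor h_def mult.assoc)
    have "1 \<le> h ^ (2 * n + 1) * \<delta> ^ 4"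
      using neg all zero
      by (intro coprime_double_root_bound[OF Bezout P0 Q(1) P(3) Q(2) n \<delta> h, of \<xi>]) (auto simp: not_less)
    also have "h ^ (2 * n + 1) * \<delta> ^ 4 = C1 ^ (2 * n + 1) * H powr (- (4 * M' - real (2 * n + 1)))"
    proof -
      have "\<delta> ^ 4 = H powr (- 4 * M')"
        using H by (simp add: \<delta>_def powr_realpow[symmetric] powr_powr mult.commute)
      moreover have "H ^ (2 * n + 1) = H powr (real (2 * n + 1))" using H by (intro powr_realpow[symmetric]) simp
      ultimately have "H ^ (2 * n + 1) * \<delta> ^ 4 = H powr (real (2 * n + 1) + - 4 * M')" by (simp only: powr_add)
      also have "real (2 * n + 1) + - 4 * M' = - (4 * M' - real (2 * n + 1))" by simp
      finally show ?thesis by (simp only: h_def power_mult_distrib mult.assoc)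
    qed
    also have "\<dots> < C1 ^ (2 * n + 1) * (1 / C1 ^ (2 * n + 1))"
      using C1 X1(2)[OF H(2)] by (intro mult_strict_left_mono) auto
    finally show False using C1 by simp
  qed
  then obtain R where R: "R \<in> {P, Q}" "h * \<delta> < fls_abs (coeff (taylor R \<xi>) 1)" by blast
  have Rdeg: "degree R \<le> n" "height_poly R \<le> H" "R \<noteq> 0" using R P Q qk P0 by (auto simp: H_def)
  have r1: "0 < fls_abs (coeff (taylor R \<xi>) 1)" using R h \<delta> mult_pos_pos[of h \<delta>] by linarith
  define \<rho> where "\<rho> = fls_abs (eval_fls R \<xi>) / fls_abs (coeff (taylor R \<xi>) 1)"
  have ev: "eval_fls R \<xi> \<noteq> 0" using nonzero Rdeg by blast
  have \<rho>: "0 < \<rho>" using ev r1 by (simp add: \<rho>_def)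
  have \<rho>_le: "\<rho> \<le> H powr (- (M' + \<kappa>))"
  proof -
    have "\<rho> \<le> (C1 * H powr (- real n + \<kappa>)) / (h * \<delta>)"
      unfolding \<rho>_def using small[OF R(1)] R(2) h \<delta> C1 by (intro frac_le) auto
    also have "\<dots> = H powr (- real n + \<kappa>) / H powr (1 - M')"
      using C1 H by (simp add: h_def \<delta>_def powr_diff powr_minus field_simps)
    also have "\<dots> = H powr (- (M' + \<kappa>))"
    proof -
      have "- real n + \<kappa> - (1 - M') = - (M' + \<kappa>)" by (simp add: \<kappa>_def field_simps)
      thus ?thesis by (metis powr_diff)
    qed
    finally show ?thesis .
  qed
  have "H powr (- (M' + \<kappa>)) \<le> H powr (- M')" using H \<kappa> by (intro powr_mono) auto
  hence \<rho>\<delta>: "\<rho> \<le> \<delta>" using \<rho>_le by (simp add: \<delta>_def)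
  have "\<exists>\<alpha>. algebraic_fls \<alpha> \<and> degree_fls \<alpha> \<le> degree R \<and> height_fls \<alpha> \<le> height_poly R \<and>
    0 < fls_abs (\<xi> - \<alpha>) \<and> fls_abs (\<xi> - \<alpha>) \<le> \<rho>"
  proof (rule algebraic_root_near[OF \<rho> _ _ ev])
    fix i :: nat assume i: "2 \<le> i"
    have "\<rho> ^ (i - 1) \<le> \<rho> ^ 1" using \<rho> \<rho>\<delta> \<delta> i by (intro power_decreasing) auto
    hence "fls_abs (coeff (taylor R \<xi>) i) * \<rho> ^ (i - 1) \<le> h * \<delta>"
      using all[OF R(1), of i] \<rho> \<rho>\<delta> h by (intro mult_mono) auto
    thus "fls_abs (coeff (taylor R \<xi>) i) * \<rho> ^ (i - 1) < fls_abs (coeff (taylor R \<xi>) 1)"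
      using R by linarith
  next
    show "fls_abs (eval_fls R \<xi>) \<le> fls_abs (coeff (taylor R \<xi>) 1) * \<rho>"
      using r1 by (simp add: \<rho>_def)
  qed
  then obtain \<alpha> where \<alpha>: "algebraic_fls \<alpha>" "degree_fls \<alpha> \<le> degree R" "height_fls \<alpha> \<le> height_poly R"
    "0 < fls_abs (\<xi> - \<alpha>)" "fls_abs (\<xi> - \<alpha>) \<le> \<rho>" by blast
  have "H powr (- (M' + \<kappa>)) < H powr (- M)" using H M' \<kappa> by (intro powr_less_mono) auto
  also have "\<dots> \<le> height_fls \<alpha> powr (- M)"
    using \<alpha> Rdeg M height_fls_ge_1[OF \<alpha>(1)] by (intro powr_mono2') auto
  finally have "fls_abs (\<xi> - \<alpha>) < height_fls \<alpha> powr (- (M - 1) - 1)" using \<alpha> \<rho>_le by simp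
  moreover have "fls_abs (\<xi> - \<alpha>) < \<epsilon>" using \<alpha> \<rho>_le X2(2)[OF H(3)] by linarith
  ultimately show "\<exists>\<alpha>\<in>w_star_set n \<xi> (M - 1). fls_abs (\<xi> - \<alpha>) < \<epsilon>"
    using \<alpha> Rdeg by (intro bexI[of _ \<alpha>]) (auto simp: w_star_set_def)
qed

subsection \<open>Elements of the Frobenius image\<close>

lemma fls_nth_intpow: "fls_nth (fls_const c * fls_X_intpow i) k = (if k = i then c else 0 :: 'a::field)"
  by (auto simp: fls_X_intpow_times_conv_shift)

text \<open>Split \<open>x = u + r\<close> with \<open>u\<close> a finite Laurent sum and
  \<open>r\<close> of order beyond \<open>|k|\<close>. Additivity of the p-th power gives the
  coefficient of \<open>u^p\<close>, and \<open>r^p\<close> does not reach index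
  \<open>k\<close>.\<close>

lemma fls_nth_power_CHAR:
  fixes x :: "'a::{field,finite} fls"
  shows "fls_nth (x ^ CHAR('a)) k =
    (if int CHAR('a) dvd k then fls_nth x (k div int CHAR('a)) ^ CHAR('a) else 0)"
proof -
  define p where "p = CHAR('a)"
  have p: "prime CHAR('a fls)" using prime_CHAR_finite_field[where 'a = 'a] by simp
  have p0: "0 < p" using p by (simp add: prime_gt_0_nat p_def)
  define s where "s = fls_subdegree x"
  define t where "t = max \<bar>k\<bar> s"
  define u where "u = (\<Sum>i\<in>{s..t}. fls_const (fls_nth x i) * fls_X_intpow i)"
  define r where "r = x - u"
  have u: "fls_nth u i = (if i \<in> {s..t} then fls_nth x i else 0)" for i
    unfolding u_def fls_nth_sum fls_nth_intpow by simp
  have r: "fls_nth r i = 0" if "i \<le> t" for i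
    using that by (auto simp: r_def u s_def)
  have "fls_nth (r ^ p) k = 0"
  proof (cases "r = 0")
    case True
    thus ?thesis using p0 by (simp add: zero_power)
  next
    case False
    have "t + 1 \<le> fls_subdegree r" using r by (intro fls_subdegree_geI[OF False]) simp
    moreover have "0 \<le> t" by (simp add: t_def)
    moreover have "\<bar>k\<bar> \<le> t" by (simp add: t_def)
    ultimately have "k < fls_subdegree r" "0 < fls_subdegree r" by linarith+
    moreover have "1 * fls_subdegree r \<le> int p * fls_subdegree r"
      using p0 \<open>0 < fls_subdegree r\<close> by (intro mult_right_mono) auto
    ultimately have "k < int p * fls_subdegree r" by (simp only: mult_1)
    hence "k < fls_subdegree (r ^ p)" by (simp add: fls_subdegree_pow)
    thus ?thesis by simp
  qed
  have "x ^ p = (u + r) ^ p" by (simp add: r_def)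
  also have "\<dots> = u ^ p + r ^ p" using freshmans_dream[OF p] by (simp add: p_def)
  also have "u ^ p = (\<Sum>i\<in>{s..t}. (fls_const (fls_nth x i) * fls_X_intpow i) ^ p)"
    unfolding u_def by (rule freshmans_dream_sum[OF p]) (simp add: p_def)
  also have "\<dots> = (\<Sum>i\<in>{s..t}. fls_const (fls_nth x i ^ p) * fls_X_intpow (int p * i))"
    by (simp add: power_mult_distrib fls_const_power fls_X_intpow_power)
  finally have "fls_nth (x ^ p) k = (\<Sum>i\<in>{s..t}. if k = int p * i then fls_nth x i ^ p else 0)"
    by (simp only: fls_plus_nth fls_nth_sum fls_nth_intpow \<open>fls_nth (r ^ p) k = 0\<close> add_0_right)
  also have "\<dots> = (if int p dvd k then fls_nth x (k div int p) ^ p else 0)"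
  proof (cases "int p dvd k")
    case True
    then obtain l where l: "k = int p * l" by blast
    have "\<bar>l\<bar> \<le> \<bar>k\<bar>" using p0 by (simp add: l abs_mult mult_le_cancel_right1)
    hence lt: "l \<le> t" by (simp add: t_def)
    have "(\<Sum>i\<in>{s..t}. if k = int p * i then fls_nth x i ^ p else 0) =
      (\<Sum>i\<in>{s..t}. if i = l then fls_nth x i ^ p else 0)"
      using p0 by (intro sum.cong) (auto simp: l)
    also have "\<dots> = fls_nth x l ^ p"
      using lt p0 by (auto simp: s_def zero_power)
    finally show ?thesis using p0 by (simp add: l)
  qed (auto intro!: sum.neutral)
  finally show ?thesis by (simp add: p_def)
qed

text \<open>\<open>fls_deriv\<close> differentiates with respect to T^(-1); it differs from d/dT by
  a nonzero factor, so the kernel is the same. Coefficients with index prime to p must vanish, and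
  the others have p-th roots in the finite field.\<close>

lemma fls_deriv_eq_0_imp_power_CHAR:
  fixes \<beta> :: "'a::{field,finite} fls"
  assumes "fls_deriv \<beta> = 0"
  shows "\<exists>\<alpha>. \<alpha> ^ CHAR('a) = \<beta>"
proof -
  define p where "p = CHAR('a)"
  have p0: "0 < p" unfolding p_def by (rule CHAR_pos_finite_field)
  have \<beta>: "fls_nth \<beta> k = 0" if "\<not> int p dvd k" for k
  proof -
    have "of_int k * fls_nth \<beta> k = 0"
      using arg_cong[OF assms, of "\<lambda>f. fls_nth f (k - 1)"] by (simp add: fls_deriv_nth)
    moreover have "of_int k \<noteq> (0 :: 'a)"
      using that unfolding p_def by (simp add: of_int_eq_0_iff_char_dvd)
    ultimately show ?thesis by simp
  qed
  define \<alpha> where "\<alpha> = Abs_fls (\<lambda>k. proot (fls_nth \<beta> (int p * k)))"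
  have \<alpha>: "fls_nth \<alpha> k = proot (fls_nth \<beta> (int p * k))" for k
    unfolding \<alpha>_def
  proof (rule nth_Abs_fls_lower_bound)
    show "\<forall>k < - \<bar>fls_subdegree \<beta>\<bar>. proot (fls_nth \<beta> (int p * k)) = 0"
    proof safe
      fix k assume k: "k < - \<bar>fls_subdegree \<beta>\<bar>"
      have "int p * k \<le> 1 * k" using k p0 by (intro mult_right_mono_neg) auto
      hence "int p * k < fls_subdegree \<beta>" using k by linarith
      thus "proot (fls_nth \<beta> (int p * k)) = 0" by simp
    qed
  qed
  have "\<alpha> ^ p = \<beta>"
    unfolding fls_eq_iff p_def fls_nth_power_CHAR
    using \<beta> \<alpha> by (auto simp: p_def)
  thus ?thesis unfolding p_def by blast
qed

lemma fls_deriv_poly: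
  assumes "\<And>i. fls_deriv (coeff F i) = 0"
  shows "fls_deriv (poly F \<beta>) = poly (pderiv F) \<beta> * fls_deriv (\<beta> :: 'a::field fls)"
  using assms
proof (induction F)
  case (pCons a F)
  have "fls_deriv a = 0" using pCons.prems[of 0] by simp
  moreover have "fls_deriv (coeff F i) = 0" for i using pCons.prems[of "Suc i"] by simp
  ultimately show ?case using pCons.IH by (simp add: pderiv_pCons algebra_simps)
qed auto

text \<open>If \<open>frob G\<close> is irreducible then it is separable, for otherwise it would be a \<open>p\<close>-th power; as
  the derivation \<open>d/dT\<close> kills its coefficients, it kills each of its roots.\<close>
lemma root_of_irreducible_frob:
  fixes G :: "'a::{field,finite} poly poly"
  assumes irr: "irreducible (frob G)" and deg: "0 < degree G" and root: "eval_fls (frob G) \<beta> = 0"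
  shows "\<exists>\<alpha>. \<alpha> ^ CHAR('a) = \<beta>"
proof -
  define p where "p = CHAR('a)"
  have p: "prime CHAR('a poly)" using prime_CHAR_finite_field[where 'a = 'a] by simp
  have p1: "1 < p" using prime_gt_1_nat[OF p] by (simp add: p_def)
  define Q where "Q = frob G"
  have "pderiv Q \<noteq> 0"
  proof
    assume "pderiv Q = 0"
    \<comment> \<open>A vanishing derivative leaves only powers of \<open>X\<close> with exponent
      divisible by p. As the coefficients of \<open>Q\<close> are p-th powers too, \<open>Q\<close>
      is the p-th power of \<open>B\<close>, against irreducibility.\<close>
    have G0: "coeff G i = 0" if "\<not> p dvd i" for i
    proof -
      have "0 < i" using that by (cases i) auto
      hence "of_nat i * coeff Q i = 0"
        using arg_cong[OF \<open>pderiv Q = 0\<close>, of "\<lambda>f. coeff f (i - 1)"] by (simp add: coeff_pderiv)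
      moreover have "of_nat i \<noteq> (0 :: 'a poly)"
        using that by (simp add: of_nat_eq_0_iff_char_dvd p_def)
      ultimately show ?thesis by (simp add: Q_def)
    qed
    define B where "B = Poly (map (\<lambda>i. coeff G (p * i)) [0..<Suc (degree G)])"
    have B: "coeff B i = coeff G (p * i)" for i
    proof (cases "i < Suc (degree G)")
      case False
      moreover have "i \<le> p * i" using p1 by simp
      ultimately have "degree G < p * i" by linarith
      thus ?thesis using False by (simp add: B_def nth_default_beyond coeff_eq_0 del: upt_Suc)
    qed (simp add: B_def nth_default_nth del: upt_Suc)
    have "Q = B ^ p"
    proof (rule poly_eqI)
      fix k
      show "coeff Q k = coeff (B ^ p) k"
        using coeff_power_CHAR[OF p, of B k] G0[of k] p1 by (auto simp: Q_def B p_def zero_power)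
    qed
    moreover have "p = Suc (p - 1)" using p1 by simp
    ultimately have "Q = B * B ^ (p - 1)" by (metis power_Suc)
    hence "B dvd 1 \<or> B ^ (p - 1) dvd 1" using irr irreducibleD unfolding Q_def by blast
    moreover have "B dvd B ^ (p - 1)" using p1 by (intro dvd_power) simp
    ultimately have "B dvd 1" using dvd_trans by blast
    hence "Q dvd 1" using \<open>Q = B ^ p\<close> by (simp add: is_unit_power_iff)
    thus False using irr by (simp add: Q_def irreducible_def)
  qed
  have degQ: "0 < degree Q" using deg by (simp add: Q_def)
  \<comment> \<open>Otherwise \<open>Q\<close> would divide its nonzero derivative, which has
    smaller degree.\<close>
  have sep: "eval_fls (pderiv Q) \<beta> \<noteq> 0"
  proof
    assume "eval_fls (pderiv Q) \<beta> = 0"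
    hence "Q dvd pderiv Q" using irreducible_root_unique[of Q \<beta> "pderiv Q"] irr root degQ by (simp add: Q_def)
    hence "degree Q \<le> degree (pderiv Q)" using \<open>pderiv Q \<noteq> 0\<close> by (rule dvd_imp_degree_le)
    moreover have "degree (pderiv Q) < degree Q"
      using degree_pderiv_le[of Q] degQ by linarith
    ultimately show False by simp
  qed
  have "of_nat CHAR('a) = (0 :: 'a fls)" using of_nat_CHAR[where 'a = "'a fls"] by simp
  hence coeff0: "fls_deriv (coeff (map_poly poly_to_fls Q) i) = 0" for i
    by (simp add: Q_def poly_to_fls_hom.hom_power fls_deriv_power)
  from fls_deriv_poly[OF coeff0, of \<beta>]
  have "fls_deriv (eval_fls Q \<beta>) = eval_fls (pderiv Q) \<beta> * fls_deriv \<beta>"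
    unfolding eval_fls_def poly_to_fls_hom.map_poly_pderiv .
  hence "fls_deriv \<beta> = 0" using root sep by (simp add: Q_def)
  thus ?thesis by (rule fls_deriv_eq_0_imp_power_CHAR)
qed

text \<open>A common factor \<open>G\<close> gives \<open>Q = frob G * E\<close>. As
  \<open>frob G\<close> has positive degree, \<open>E\<close> is a unit, that is, an element of the
  finite field; it is itself a p-th power and can be moved under \<open>frob\<close>.\<close>

lemma common_factor_of_sections:
  fixes Q G :: "'a::{field,finite} poly poly"
  assumes Q: "irreducible Q" and G: "0 < degree G"
    and dvd: "\<And>j. j < CHAR('a) \<Longrightarrow> G dvd poly_sect j Q"
  shows "\<exists>P. frob P = Q"
proof -
  define A where "A j = (SOME E. poly_sect j Q = G * E)" for j
  have A: "poly_sect j Q = G * A j" if "j < CHAR('a)" for j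
  proof -
    from dvd[OF that] obtain E where "poly_sect j Q = G * E" by (rule dvdE)
    thus ?thesis unfolding A_def by (rule someI)
  qed
  define E where "E = (\<Sum>j<CHAR('a). [:monom 1 j:] * frob (A j))"
  have "Q = (\<Sum>j<CHAR('a). [:monom 1 j:] * frob (poly_sect j Q))"
    by (simp only: poly_sect_decomposition)
  also have "\<dots> = (\<Sum>j<CHAR('a). frob G * ([:monom 1 j:] * frob (A j)))"
    using A by (intro sum.cong) (auto simp only: frob_mult mult.left_commute lessThan_iff)
  finally have QE: "Q = frob G * E" by (simp only: E_def sum_distrib_left)
  have "\<not> frob G dvd 1"
  proof
    assume "frob G dvd 1"
    then obtain c where "frob G = [:c:]" unfolding is_unit_poly_iff by blast
    hence "degree (frob G) = 0" by simp
    thus False using G by simp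
  qed
  hence "E dvd 1" using irreducibleD[OF Q QE] by simp
  then obtain e0 where e0: "E = [:e0:]" "e0 dvd 1" unfolding is_unit_poly_iff by blast
  then obtain e where e: "e0 = [:e:]" unfolding is_unit_poly_iff by blast
  have pow: "[:proot e:] ^ CHAR('a) = [:e:]"
  proof -
    have "[:x:] ^ m = [:x ^ m:]" for x :: 'a and m by (induction m) (auto simp: one_pCons)
    thus ?thesis by simp
  qed
  have "frob [:[:proot e:]:] = E"
  proof (rule poly_eqI)
    fix n
    show "coeff (frob [:[:proot e:]:]) n = coeff E n"
      by (cases n) (simp_all add: e0(1) e pow zero_power CHAR_pos_finite_field)
  qed
  hence "frob (G * [:[:proot e:]:]) = Q" by (simp only: frob_mult QE)
  thus ?thesis by blast
qed

subsection \<open>Transfer of an approximation of \<open>\<xi>^p\<close> to one of \<open>\<xi>\<close>\<close>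

text \<open>The section that carries the linear term may vanish at \<open>\<xi>\<close>; multiplying it by \<open>T\<close> and adding a
  section that does not vanish there excludes \<open>\<alpha> = \<xi>\<close>.\<close>
lemma transfer_dominant_linear_term:
  fixes Q :: "'a::{field,finite} poly poly"
  assumes hQ: "h ^ CHAR('a) = height_poly Q" "0 < h"
    and d: "0 < d"
    and q0: "0 < fls_abs (coeff (taylor Q (\<xi> ^ CHAR('a))) 0)"
      "fls_abs (coeff (taylor Q (\<xi> ^ CHAR('a))) 0) \<le> fls_abs (coeff (taylor Q (\<xi> ^ CHAR('a))) 1) * d ^ CHAR('a)"
    and dom: "\<And>i. 2 \<le> i \<Longrightarrow> fls_abs (coeff (taylor Q (\<xi> ^ CHAR('a))) i) * (d ^ CHAR('a)) ^ (i - 1)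
      < fls_abs (coeff (taylor Q (\<xi> ^ CHAR('a))) 1)"
  shows "\<exists>\<alpha>. algebraic_fls \<alpha> \<and> degree_fls \<alpha> \<le> degree Q \<and> height_fls \<alpha> \<le> real CARD('a) * h \<and>
    0 < fls_abs (\<xi> - \<alpha>) \<and> fls_abs (\<xi> - \<alpha>) \<le> d"
proof -
  define p where "p = CHAR('a)"
  have p0: "0 < p" unfolding p_def by (rule CHAR_pos_finite_field)
  define q where "q = real CARD('a)"
  have q: "1 < q" unfolding q_def by (rule real_CARD_field_gt_1)
  define a where "a i = fls_abs (coeff (taylor Q (\<xi> ^ p)) i)" for i
  define b where "b j i = fls_abs (coeff (taylor (poly_sect j Q) \<xi>) i)" for j i
  have ab: "q ^ j * b j i ^ p \<le> a i" if "j < p" for j i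
    using taylor_sect_abs(2)[of j Q \<xi> i] that by (simp add: a_def b_def p_def q_def)
  have le_a: "b j i ^ p \<le> a i" if "j < p" for j i
    using taylor_sect_abs_le[of j Q \<xi> i] that by (simp add: a_def b_def p_def)
  obtain j1 where j1: "j1 < p" "a 1 = q ^ j1 * b j1 1 ^ p"
    using taylor_sect_abs(1)[of Q \<xi> 1] by (auto simp: a_def b_def p_def q_def)
  obtain j0 where j0: "j0 < p" "a 0 = q ^ j0 * b j0 0 ^ p"
    using taylor_sect_abs(1)[of Q \<xi> 0] by (auto simp: a_def b_def p_def q_def)
  have a1: "0 < a 1"
  proof -
    have "0 \<le> fls_abs (coeff (taylor Q (\<xi> ^ p)) 2) * (d ^ p) ^ (2 - 1)"
      using d by (intro mult_nonneg_nonneg) auto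
    also have "\<dots> < a 1" using dom[of 2] by (simp add: a_def p_def)
    finally show ?thesis .
  qed
  have hs: "height_poly (poly_sect j Q) \<le> h" if "j < p" for j
  proof (rule power_le_imp_le_base)
    have "height_poly (poly_sect j Q) ^ p \<le> h ^ p"
      using height_poly_sect_le[of j Q] that hQ by (simp add: p_def)
    thus "height_poly (poly_sect j Q) ^ Suc (p - 1) \<le> h ^ Suc (p - 1)" using p0 by simp
  qed (use hQ in simp)
  \<comment> \<open>Hensel's lemma depends only on ratios of Taylor coefficients. It suffices that
    those of \<open>R\<close>, raised to the power p, are at most \<open>s\<close> times those of
    \<open>Q\<close>, with equality in the linear one.\<close>
  have "\<exists>R s. 0 < s \<and> eval_fls R \<xi> \<noteq> 0 \<and> degree R \<le> degree Q \<and> height_poly R \<le> q * h \<and>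
    (\<forall>i. fls_abs (coeff (taylor R \<xi>) i) ^ p \<le> s * a i) \<and> fls_abs (coeff (taylor R \<xi>) 1) ^ p = s * a 1"
  proof (cases "eval_fls (poly_sect j1 Q) \<xi> = 0")
    case False
    have "fls_abs (coeff (taylor (poly_sect j1 Q) \<xi>) i) ^ p \<le> 1 / q ^ j1 * a i" for i
      using ab[OF j1(1), of i] q by (simp add: b_def field_simps)
    moreover have "fls_abs (coeff (taylor (poly_sect j1 Q) \<xi>) 1) ^ p = 1 / q ^ j1 * a 1"
      using j1(2) q by (simp add: b_def)
    moreover have "height_poly (poly_sect j1 Q) \<le> q * h"
    proof -
      have "1 * h \<le> q * h" using q hQ by (intro mult_right_mono) auto
      thus ?thesis using hs[OF j1(1)] by simp
    qed
    ultimately show ?thesis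
      using False degree_poly_sect_le[of j1 Q] q
      by (intro exI[of _ "poly_sect j1 Q"] exI[of _ "1 / q ^ j1"] conjI allI) auto
  next
    case True
    define T :: "'a poly poly" where "T = [:monom 1 1:]"
    define R where "R = T * poly_sect j1 Q + poly_sect j0 Q"
    \<comment> \<open>Since \<open>|T|^p = q^p = s * q^j1\<close>, the linear coefficient of T times
      section \<open>j1\<close>, raised to the power p, is \<open>s * a 1\<close>. As
      \<open>j1 < p\<close> makes \<open>s > 1\<close>, the linear coefficient of section
      \<open>j0\<close>, whose p-th power is at most \<open>a 1\<close>, cannot cancel it.\<close>
    define s where "s = q ^ (p - j1)"
    have s: "1 < s" unfolding s_def using q j1 by (intro one_less_power) auto
    have qs: "q ^ p = s * q ^ j1" using j1 by (simp add: s_def flip: power_add)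
    have pT: "fls_abs (poly_to_fls (monom 1 1 :: 'a poly)) = q"
      by (subst fls_abs_poly_to_fls) (auto simp: q_def degree_monom_eq)
    have co: "coeff (taylor R \<xi>) i = poly_to_fls (monom 1 1) * coeff (taylor (poly_sect j1 Q) \<xi>) i +
      coeff (taylor (poly_sect j0 Q) \<xi>) i" for i
      by (simp only: R_def T_def taylor_add taylor_mult taylor_const coeff_add) simp
    have 1: "fls_abs (poly_to_fls (monom 1 1) * coeff (taylor (poly_sect j1 Q) \<xi>) i) ^ p = s * (q ^ j1 * b j1 i ^ p)" for i
      by (simp only: fls_abs_mult pT power_mult_distrib b_def qs mult.assoc)
    have 2: "fls_abs (coeff (taylor (poly_sect j0 Q) \<xi>) i) ^ p \<le> s * a i" for i
    proof -
      have "1 * a i \<le> s * a i" using s by (intro mult_right_mono) (auto simp: a_def)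
      thus ?thesis using le_a[OF j0(1), of i] by (simp add: b_def)
    qed
    have 3: "s * (q ^ j1 * b j1 i ^ p) \<le> s * a i" for i
      using ab[OF j1(1)] s by (intro mult_left_mono) auto
    have "fls_abs (coeff (taylor R \<xi>) i) ^ p \<le> s * a i" for i
    proof -
      have "fls_abs (coeff (taylor R \<xi>) i) \<le> fls_abs (poly_to_fls (monom 1 1) * coeff (taylor (poly_sect j1 Q) \<xi>) i) \<or>
        fls_abs (coeff (taylor R \<xi>) i) \<le> fls_abs (coeff (taylor (poly_sect j0 Q) \<xi>) i)"
        unfolding co using fls_abs_add_le_max[of "poly_to_fls (monom 1 1) * coeff (taylor (poly_sect j1 Q) \<xi>) i"
            "coeff (taylor (poly_sect j0 Q) \<xi>) i"] by linarith
      thus ?thesis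
      proof
        assume "fls_abs (coeff (taylor R \<xi>) i) \<le> fls_abs (poly_to_fls (monom 1 1) * coeff (taylor (poly_sect j1 Q) \<xi>) i)"
        from power_mono[OF this fls_abs_nonneg, of p] show ?thesis using 1[of i] 3[of i] by linarith
      next
        assume "fls_abs (coeff (taylor R \<xi>) i) \<le> fls_abs (coeff (taylor (poly_sect j0 Q) \<xi>) i)"
        from power_mono[OF this fls_abs_nonneg, of p] show ?thesis using 2[of i] by linarith
      qed
    qed
    moreover have "fls_abs (coeff (taylor R \<xi>) 1) ^ p = s * a 1"
    proof -
      have "fls_abs (coeff (taylor (poly_sect j0 Q) \<xi>) 1) ^ p \<le> a 1"
        using le_a[OF j0(1), of 1] by (simp add: b_def)
      also have "\<dots> < s * a 1" using s a1 by simp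
      also have "\<dots> = fls_abs (poly_to_fls (monom 1 1) * coeff (taylor (poly_sect j1 Q) \<xi>) 1) ^ p"
        using 1[of 1] j1(2) by simp
      finally have "fls_abs (coeff (taylor (poly_sect j0 Q) \<xi>) 1) <
        fls_abs (poly_to_fls (monom 1 1) * coeff (taylor (poly_sect j1 Q) \<xi>) 1)"
        by (rule power_less_imp_less_base) simp
      hence "fls_abs (coeff (taylor R \<xi>) 1) = fls_abs (poly_to_fls (monom 1 1) * coeff (taylor (poly_sect j1 Q) \<xi>) 1)"
        unfolding co by (rule fls_abs_add_eq)
      thus ?thesis using 1[of 1] j1(2) by simp
    qed
    moreover have "eval_fls R \<xi> \<noteq> 0"
    proof -
      have "eval_fls R \<xi> = eval_fls (poly_sect j0 Q) \<xi>" by (simp add: R_def True del: mult_pCons_left)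
      moreover have "b j0 0 \<noteq> 0" using q0(1) j0(2) p0 by (auto simp: a_def p_def zero_power)
      ultimately show ?thesis by (simp add: b_def coeff_0_taylor)
    qed
    moreover have "degree R \<le> degree Q"
    proof -
      have "degree (T * poly_sect j1 Q) \<le> degree T + degree (poly_sect j1 Q)" by (rule degree_mult_le)
      also have "\<dots> \<le> degree Q" using degree_poly_sect_le[of j1 Q] by (simp add: T_def)
      finally show ?thesis unfolding R_def by (intro degree_add_le degree_poly_sect_le)
    qed
    moreover have "height_poly R \<le> q * h"
    proof (subst height_poly_le_iff)
      show "\<forall>i. fls_abs (poly_to_fls (coeff R i)) \<le> q * h"
      proof
        fix i
        have "poly_to_fls (coeff R i) = poly_to_fls (monom 1 1) * poly_to_fls (coeff (poly_sect j1 Q) i) +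
          poly_to_fls (coeff (poly_sect j0 Q) i)"
          by (simp add: R_def T_def poly_to_fls_hom.hom_add poly_to_fls_hom.hom_mult del: coeff_poly_sect)
        moreover have "fls_abs (poly_to_fls (monom 1 1) * poly_to_fls (coeff (poly_sect j1 Q) i)) \<le> q * h"
          unfolding fls_abs_mult pT using q hs[OF j1(1)] coeff_le_height_poly[of "poly_sect j1 Q" i]
          by (intro mult_left_mono) auto
        moreover have "fls_abs (poly_to_fls (coeff (poly_sect j0 Q) i)) \<le> q * h"
        proof -
          have "1 * h \<le> q * h" using q hQ by (intro mult_right_mono) auto
          thus ?thesis using hs[OF j0(1)] coeff_le_height_poly[of "poly_sect j0 Q" i] by linarith
        qed
        ultimately show "fls_abs (poly_to_fls (coeff R i)) \<le> q * h" by (simp only: fls_abs_add_le)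
      qed
    qed (use q hQ in auto)
    ultimately show ?thesis using s by (intro exI[of _ R] exI[of _ s]) auto
  qed
  then obtain R s where s: "0 < s" and R: "eval_fls R \<xi> \<noteq> 0" "degree R \<le> degree Q" "height_poly R \<le> q * h"
    "\<And>i. fls_abs (coeff (taylor R \<xi>) i) ^ p \<le> s * a i" "fls_abs (coeff (taylor R \<xi>) 1) ^ p = s * a 1"
    by blast
  have "\<exists>\<alpha>. algebraic_fls \<alpha> \<and> degree_fls \<alpha> \<le> degree R \<and> height_fls \<alpha> \<le> height_poly R \<and>
    0 < fls_abs (\<xi> - \<alpha>) \<and> fls_abs (\<xi> - \<alpha>) \<le> d"
  proof (rule algebraic_root_near[OF d _ _ R(1)])
    fix i :: nat assume i: "2 \<le> i"
    have "(fls_abs (coeff (taylor R \<xi>) i) * d ^ (i - 1)) ^ p = fls_abs (coeff (taylor R \<xi>) i) ^ p * (d ^ p) ^ (i - 1)"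
      by (simp add: power_mult_distrib mult.commute flip: power_mult)
    also have "\<dots> \<le> s * a i * (d ^ p) ^ (i - 1)" using R(4)[of i] d by (intro mult_right_mono) auto
    also have "\<dots> < s * a 1" using dom[OF i] s by (simp add: a_def p_def mult.assoc)
    also have "\<dots> = fls_abs (coeff (taylor R \<xi>) 1) ^ p" using R(5) by simp
    finally show "fls_abs (coeff (taylor R \<xi>) i) * d ^ (i - 1) < fls_abs (coeff (taylor R \<xi>) 1)"
      by (rule power_less_imp_less_base) simp
  next
    have "fls_abs (eval_fls R \<xi>) ^ p \<le> s * a 0" using R(4)[of 0] by (simp add: coeff_0_taylor)
    also have "\<dots> \<le> s * (a 1 * d ^ p)" using q0(2) s by (intro mult_left_mono) (auto simp: a_def p_def)
    also have "\<dots> = (fls_abs (coeff (taylor R \<xi>) 1) * d) ^ p" using R(5) by (simp add: power_mult_distrib)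
    finally have "fls_abs (eval_fls R \<xi>) ^ Suc (p - 1) \<le> (fls_abs (coeff (taylor R \<xi>) 1) * d) ^ Suc (p - 1)"
      using p0 by simp
    thus "fls_abs (eval_fls R \<xi>) \<le> fls_abs (coeff (taylor R \<xi>) 1) * d"
      by (rule power_le_imp_le_base) (use d in auto)
  qed
  thus ?thesis using R unfolding q_def by (meson order_trans)
qed

lemma section_bounds:
  fixes Q :: "'a::{field,finite} poly poly"
  assumes "j < CHAR('a)" "0 \<le> B" "fls_abs (coeff (taylor Q (\<xi> ^ CHAR('a))) i) \<le> B ^ CHAR('a)"
  shows "fls_abs (coeff (taylor (poly_sect j Q) \<xi>) i) \<le> B"
proof -
  have p0: "0 < CHAR('a)" by (rule CHAR_pos_finite_field)
  have "fls_abs (coeff (taylor (poly_sect j Q) \<xi>) i) ^ CHAR('a) \<le> B ^ CHAR('a)"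
    using taylor_sect_abs_le[OF assms(1), of Q \<xi> i] assms(3) by linarith
  hence "fls_abs (coeff (taylor (poly_sect j Q) \<xi>) i) ^ Suc (CHAR('a) - 1) \<le> B ^ Suc (CHAR('a) - 1)"
    using p0 by simp
  thus ?thesis using assms(2) by (rule power_le_imp_le_base)
qed

text \<open>Centred at \<xi>^p, \<beta> becomes a root \<open>x\<close> of absolute value
  \<open>d^p\<close>. If the linear coefficient dominates at this radius, the root equation forces
  \<open>a 0 = a 1 * d^p\<close>, as Hensel's lemma requires. If not,
  \<open>a 1 \<le> C * h^p * d^p\<close>, the root equation yields
  \<open>a 0 \<le> C * h^p * d^(2p)\<close>, and p-th roots of these bounds hold for every
  section.\<close>

lemma transfer_dichotomy:
  fixes \<xi> \<beta> :: "'a::{field,finite} fls"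
  assumes Q: "irreducible Q" "0 < degree Q" "degree Q \<le> n" "eval_fls Q \<beta> = 0"
    and ne: "\<beta> \<noteq> \<xi> ^ CHAR('a)"
    and h: "h ^ CHAR('a) = height_poly Q" "0 < h"
    and d: "0 < d" "d \<le> 1" "d ^ CHAR('a) = fls_abs (\<xi> ^ CHAR('a) - \<beta>)"
    and C: "C = max 1 (fls_abs (\<xi> ^ CHAR('a))) ^ n"
  shows "(\<exists>\<alpha>. algebraic_fls \<alpha> \<and> degree_fls \<alpha> \<le> n \<and> height_fls \<alpha> \<le> real CARD('a) * h \<and>
      0 < fls_abs (\<xi> - \<alpha>) \<and> fls_abs (\<xi> - \<alpha>) \<le> d) \<or>
    (\<not> (\<exists>G. irreducible G \<and> 0 < degree G \<and> (\<forall>j<CHAR('a). G dvd poly_sect j Q)) \<and>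
     (\<forall>j<CHAR('a). fls_abs (coeff (taylor (poly_sect j Q) \<xi>) 0) \<le> C * h * d\<^sup>2 \<and>
       fls_abs (coeff (taylor (poly_sect j Q) \<xi>) 1) \<le> C * h * d))"
    (is "?good \<or> ?bad")
proof -
  define p where "p = CHAR('a)"
  have p0: "0 < p" unfolding p_def by (rule CHAR_pos_finite_field)
  have q: "1 < real CARD('a)" by (rule real_CARD_field_gt_1)
  define a where "a i = fls_abs (coeff (taylor Q (\<xi> ^ p)) i)" for i
  define x where "x = \<beta> - \<xi> ^ p"
  have x: "fls_abs x = d ^ p" "x \<noteq> 0"
    using d(3) ne fls_abs_minus_commute[of \<beta> "\<xi> ^ p"] by (auto simp: x_def p_def)
  have D1: "d ^ p \<le> 1" using d(1,2) by (intro power_le_one) auto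
  have C1: "1 \<le> C" unfolding C by (intro one_le_power) simp
  have all: "a i \<le> C * h ^ p" for i
  proof -
    have "a i \<le> height_poly Q * max 1 (fls_abs (\<xi> ^ p)) ^ degree Q"
      unfolding a_def by (rule coeff_taylor_le)
    also have "\<dots> \<le> height_poly Q * C"
      unfolding C p_def using Q by (intro mult_left_mono power_increasing) auto
    finally show ?thesis using h by (simp add: p_def mult.commute)
  qed
  have "poly (taylor Q (\<xi> ^ p)) x = 0" using Q by (simp add: poly_taylor x_def)
  define N where "N = Suc (degree Q)"
  have "0 = (\<Sum>i<N. coeff (taylor Q (\<xi> ^ p)) i * x ^ i)"
    using \<open>poly (taylor Q (\<xi> ^ p)) x = 0\<close> by (simp add: poly_altdef N_def lessThan_Suc_atMost)
  also have "\<dots> = coeff (taylor Q (\<xi> ^ p)) 0 + (\<Sum>i<degree Q. coeff (taylor Q (\<xi> ^ p)) (Suc i) * x ^ Suc i)"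
    unfolding N_def by (subst sum.lessThan_Suc_shift) simp
  finally have q0: "coeff (taylor Q (\<xi> ^ p)) 0 = - (\<Sum>i<degree Q. coeff (taylor Q (\<xi> ^ p)) (Suc i) * x ^ Suc i)"
    by (simp add: eq_neg_iff_add_eq_0)
  have a0: "a 0 = fls_abs (\<Sum>i<degree Q. coeff (taylor Q (\<xi> ^ p)) (Suc i) * x ^ Suc i)"
    unfolding a_def q0 by simp
  have abs_term: "fls_abs (coeff (taylor Q (\<xi> ^ p)) i * x ^ i) = a i * (d ^ p) ^ i" for i
    by (simp add: fls_abs_mult fls_abs_power x a_def)
  show ?thesis
  proof (cases "\<exists>G. irreducible G \<and> 0 < degree G \<and> (\<forall>j<CHAR('a). G dvd poly_sect j Q)")
    case True
    then obtain G where G: "0 < degree G" "\<And>j. j < CHAR('a) \<Longrightarrow> G dvd poly_sect j Q" by blast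
    obtain P where P: "frob P = Q" using common_factor_of_sections[OF Q(1) G] by blast
    have degP: "degree P = degree Q" using degree_frob[of P] by (simp add: P)
    have "\<exists>\<alpha>. \<alpha> ^ CHAR('a) = \<beta>"
      by (rule root_of_irreducible_frob[of P]) (use Q degP in \<open>simp_all add: P\<close>)
    then obtain \<alpha> where \<alpha>: "\<alpha> ^ p = \<beta>" unfolding p_def by blast
    have "eval_fls P \<alpha> ^ p = eval_fls (frob P) (\<alpha> ^ p)" by (simp only: eval_frob p_def)
    also have "\<dots> = 0" by (simp only: P \<alpha> Q(4))
    finally have "eval_fls P \<alpha> ^ p = 0" .
    hence ev: "eval_fls P \<alpha> = 0" by simp
    have P0: "P \<noteq> 0" using Q(2) degP by auto
    note root = root_degree_height_le[OF P0 ev]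
    have "height_poly P ^ p = h ^ p" using h height_poly_frob[of P] by (simp add: p_def P)
    hence "height_poly P ^ Suc (p - 1) \<le> h ^ Suc (p - 1)" using p0 by simp
    hence hP: "height_poly P \<le> h" by (rule power_le_imp_le_base) (use h(2) in simp)
    have "1 * h \<le> real CARD('a) * h" by (rule mult_right_mono) (use q h(2) in simp_all)
    hence "height_fls \<alpha> \<le> real CARD('a) * h" using root(3) hP by linarith
    moreover have "degree_fls \<alpha> \<le> n" using root(2) Q(3) degP by simp
    moreover have "\<xi> - \<alpha> \<noteq> 0" using ne \<alpha> by (auto simp: p_def)
    moreover have "fls_abs (\<xi> - \<alpha>) ^ Suc (p - 1) \<le> d ^ Suc (p - 1)"
    proof -
      have "\<xi> ^ p - \<beta> = (\<xi> - \<alpha>) ^ p"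
        unfolding p_def \<alpha>[symmetric] by (rule Frobenius_fls_hom.hom_minus[symmetric])
      hence "fls_abs (\<xi> - \<alpha>) ^ p = d ^ p" using d(3) by (simp add: p_def fls_abs_power)
      thus ?thesis using p0 by simp
    qed
    hence "fls_abs (\<xi> - \<alpha>) \<le> d" by (rule power_le_imp_le_base) (use d(1) in simp)
    ultimately have ?good using root(1) by (intro exI[of _ \<alpha>]) auto
    thus ?thesis ..
  next
    case nogcd: False
    show ?thesis
    proof (cases "\<forall>i\<ge>2. a i * (d ^ p) ^ (i - 1) < a 1")
      case True
      have a1: "0 < a 1"
      proof -
        have "0 \<le> a 2 * (d ^ p) ^ (2 - 1)" using d(1,2) by (intro mult_nonneg_nonneg) (auto simp: a_def)
        also have "\<dots> < a 1" using True by blast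
        finally show ?thesis .
      qed
      have le: "a (Suc i) * (d ^ p) ^ i \<le> a 1" for i
        using True[rule_format, of "Suc i"] by (cases i) auto
      obtain m where m: "degree Q = Suc m" using Q(2) by (cases "degree Q") auto
      have split: "(\<Sum>i<degree Q. coeff (taylor Q (\<xi> ^ p)) (Suc i) * x ^ Suc i) =
        coeff (taylor Q (\<xi> ^ p)) 1 * x ^ 1 + (\<Sum>i<m. coeff (taylor Q (\<xi> ^ p)) (Suc (Suc i)) * x ^ Suc (Suc i))"
        unfolding m by (subst sum.lessThan_Suc_shift) simp
      have lead: "fls_abs (coeff (taylor Q (\<xi> ^ p)) 1 * x ^ 1) = a 1 * d ^ p"
        using abs_term[of 1] by simp
      have less: "fls_abs (\<Sum>i<m. coeff (taylor Q (\<xi> ^ p)) (Suc (Suc i)) * x ^ Suc (Suc i)) <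
        fls_abs (coeff (taylor Q (\<xi> ^ p)) 1 * x ^ 1)"
        unfolding lead
      proof (rule fls_abs_sum_less)
        fix i
        have "a (Suc (Suc i)) * (d ^ p) ^ (Suc (Suc i) - 1) < a 1"
          using True[rule_format, of "Suc (Suc i)"] by simp
        hence "a (Suc (Suc i)) * (d ^ p) ^ Suc i * d ^ p < a 1 * d ^ p"
          using d(1,2) by (intro mult_strict_right_mono) auto
        thus "fls_abs (coeff (taylor Q (\<xi> ^ p)) (Suc (Suc i)) * x ^ Suc (Suc i)) < a 1 * d ^ p"
          unfolding abs_term by (simp add: mult_ac)
      qed (use a1 d(1,2) in simp)
      have a0_eq: "a 0 = a 1 * d ^ p"
        unfolding a0 split fls_abs_add_eq[OF less] by (rule lead)
      have "\<exists>\<alpha>. algebraic_fls \<alpha> \<and> degree_fls \<alpha> \<le> degree Q \<and> height_fls \<alpha> \<le> real CARD('a) * h \<and>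
        0 < fls_abs (\<xi> - \<alpha>) \<and> fls_abs (\<xi> - \<alpha>) \<le> d"
        using a0_eq a1 True d(1,2)
        by (intro transfer_dominant_linear_term[OF h d(1)]) (simp_all add: a_def p_def)
      hence ?good using Q(3) by (meson order_trans)
      thus ?thesis ..
    next
      case False
      then obtain i where i: "2 \<le> i" "a 1 \<le> a i * (d ^ p) ^ (i - 1)" by (auto simp: not_less)
      have le1: "a k * (d ^ p) ^ l \<le> C * h ^ p * (d ^ p) ^ m" if "m \<le> l" for k l m
      proof (rule mult_mono[OF all])
        show "(d ^ p) ^ l \<le> (d ^ p) ^ m" using d(1,2) D1 that by (intro power_decreasing) auto
      qed (use C1 h(2) d(1,2) in auto)
      have b1: "a 1 \<le> C * h ^ p * d ^ p" 
      proof -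
        have "1 \<le> i - 1" using i(1) by simp
        from le1[OF this, of i] i(2) show ?thesis by simp
      qed
      have "a 0 \<le> C * h ^ p * (d ^ p)\<^sup>2"
        unfolding a0
      proof (rule fls_abs_sum_le)
        fix k
        show "fls_abs (coeff (taylor Q (\<xi> ^ p)) (Suc k) * x ^ Suc k) \<le> C * h ^ p * (d ^ p)\<^sup>2"
        proof (cases k)
          case 0
          have "a 1 * d ^ p \<le> C * h ^ p * d ^ p * d ^ p" using b1 d(1,2) by (intro mult_right_mono) auto
          thus ?thesis unfolding abs_term 0 by (simp add: power2_eq_square mult_ac)
        next
          case (Suc l)
          thus ?thesis unfolding abs_term using le1[of 2 "Suc k" "Suc k"] Suc by simp
        qed
      qed (use C1 h(2) in simp)
      \<comment> \<open>Replacing \<open>C\<close> by \<open>C^p\<close> makes both bounds exact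
        p-th powers, from which roots can be taken.\<close>
      moreover have "C \<le> C ^ p" using C1 p0 by (simp add: self_le_power)
      hence "C * (h ^ p * (d ^ p)\<^sup>2) \<le> C ^ p * (h ^ p * (d ^ p)\<^sup>2)" "C * (h ^ p * d ^ p) \<le> C ^ p * (h ^ p * d ^ p)"
        using h(2) d(1,2) by (auto intro!: mult_right_mono)
      moreover have "(C * h * d\<^sup>2) ^ p = C ^ p * (h ^ p * (d ^ p)\<^sup>2)" "(C * h * d) ^ p = C ^ p * (h ^ p * d ^ p)"
        by (simp_all add: power_mult_distrib mult.commute flip: power_mult)
      ultimately have "a 0 \<le> (C * h * d\<^sup>2) ^ p" "a 1 \<le> (C * h * d) ^ p"
        using b1 by (simp_all add: mult.assoc)
      moreover have "0 \<le> C * h * d\<^sup>2" "0 \<le> C * h * d" using C1 h(2) d(1,2) by auto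
      ultimately have ?bad
        using nogcd section_bounds[of _ "C * h * d\<^sup>2" Q \<xi> 0] section_bounds[of _ "C * h * d" Q \<xi> 1]
        by (simp add: a_def p_def)
      thus ?thesis ..
    qed
  qed
qed

subsection \<open>Polynomials with a metrical double root\<close>

text \<open>Irreducible factors that do not divide one another can be split off one at a time, each
  lowering the degree by at least 1.\<close>

lemma card_nonassociated_factors_le_degree:
  fixes R :: "'a::field poly poly"
  assumes "finite E" "R \<noteq> 0"
    and "\<And>e. e \<in> E \<Longrightarrow> irreducible (G e) \<and> 0 < degree (G e) \<and> G e dvd R"
    and "\<And>e e'. e \<in> E \<Longrightarrow> e' \<in> E \<Longrightarrow> e \<noteq> e' \<Longrightarrow> \<not> G e dvd G e'"
  shows "card E \<le> degree R"
  using assms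
proof (induction E arbitrary: R rule: finite_induct)
  case (insert e E)
  obtain R' where R': "R = G e * R'" using insert.prems(2)[of e] by (auto elim!: dvdE)
  have nz: "G e \<noteq> 0" "R' \<noteq> 0" using R' insert.prems(1) by auto
  have "G e' dvd R'" if "e' \<in> E" for e'
  proof -
    have "\<not> G e' dvd G e" using insert.prems(3)[of e' e] insert.hyps that by auto
    moreover have "irreducible (G e')" "0 < degree (G e')" "G e' dvd G e * R'"
      using insert.prems(2)[of e'] that R' by auto
    ultimately show ?thesis using irreducible_dvd_multD by blast
  qed
  hence "card E \<le> degree R'"
    using insert.prems nz by (intro insert.IH) auto
  moreover have "degree R = degree (G e) + degree R'" unfolding R' using nz by (rule degree_mult_eq)
  moreover have "0 < degree (G e)" using insert.prems(2) by blast
  ultimately show ?case using insert.hyps by simp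
qed simp

text \<open>The polynomials are added one at a time. An irreducible factor of \<open>R\<close> that
  divides \<open>S + T^t * P m\<close> for two values of \<open>t\<close> divides \<open>P m\<close>
  and \<open>S\<close>; bad exponents thus require different factors, of which \<open>R\<close> has
  at most \<open>n\<close>, while \<open>n + 1\<close> exponents are available. Powers of T serve as
  multipliers because the field of constants may have too few elements.\<close>

lemma generic_combination:
  fixes R :: "'a::field poly poly" and P :: "nat \<Rightarrow> 'a poly poly"
  assumes R: "R \<noteq> 0" "degree R \<le> n"
  shows "\<exists>e. (\<forall>j. e j \<le> n) \<and> (\<forall>G. irreducible G \<longrightarrow> 0 < degree G \<longrightarrow> G dvd R \<longrightarrow>
    G dvd (\<Sum>j<m. [:monom 1 (e j):] * P j) \<longrightarrow> (\<forall>j<m. G dvd P j))"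
proof (induction m)
  case (Suc m)
  then obtain e where e: "\<And>j. e j \<le> n" "\<And>G. irreducible G \<Longrightarrow> 0 < degree G \<Longrightarrow> G dvd R \<Longrightarrow>
    G dvd (\<Sum>j<m. [:monom 1 (e j):] * P j) \<Longrightarrow> \<forall>j<m. G dvd P j" by blast
  define S where "S = (\<Sum>j<m. [:monom 1 (e j):] * P j)"
  define bad where "bad t G \<longleftrightarrow> irreducible G \<and> 0 < degree G \<and> G dvd R \<and>
    G dvd S + [:monom 1 t:] * P m \<and> \<not> (G dvd S \<and> G dvd P m)" for t G
  have "\<exists>t\<le>n. \<forall>G. \<not> bad t G"
  proof (rule ccontr)
    assume "\<not> ?thesis"
    then obtain G where G: "\<And>t. t \<le> n \<Longrightarrow> bad t (G t)" by metis
    have "card {..n} \<le> degree R"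
    proof (rule card_nonassociated_factors_le_degree[OF _ R(1), of _ G])
      fix t u assume tu: "t \<in> {..n}" "u \<in> {..n}" "t \<noteq> u"
      show "\<not> G t dvd G u"
      proof
        assume dvd: "G t dvd G u"
        have Gt: "irreducible (G t)" "0 < degree (G t)" "\<not> (G t dvd S \<and> G t dvd P m)"
          "G t dvd S + [:monom 1 t:] * P m" using G[of t] tu by (auto simp: bad_def)
        have "G u dvd S + [:monom 1 u:] * P m" using G[of u] tu by (simp add: bad_def)
        hence "G t dvd S + [:monom 1 u:] * P m" using dvd dvd_trans by blast
        hence "G t dvd (S + [:monom 1 t:] * P m) - (S + [:monom 1 u:] * P m)" using Gt(4) by (intro dvd_diff)
        also have "(S + [:monom 1 t:] * P m) - (S + [:monom 1 u:] * P m) = [:monom 1 t - monom 1 u:] * P m"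
          by (simp add: smult_diff_left)
        finally have dm: "G t dvd [:monom 1 t - monom 1 u:] * P m" .
        have "coeff (monom 1 t - monom 1 u :: 'a poly) t \<noteq> 0" using tu by simp
        hence "monom 1 t - monom 1 u \<noteq> (0 :: 'a poly)" by (metis coeff_0)
        hence Pm: "G t dvd P m" using irreducible_dvd_const_multD[OF Gt(1,2) _ dm] by blast
        hence "G t dvd [:monom 1 t:] * P m" by (rule dvd_mult)
        hence "G t dvd S" using Gt(4) by (metis dvd_add_left_iff)
        with Pm Gt(3) show False by blast
      qed
    qed (use G in \<open>auto simp: bad_def\<close>)
    with R(2) show False by simp
  qed
  then obtain t where t: "t \<le> n" "\<And>G. \<not> bad t G" by blast
  define e' where "e' = e(m := t)"
  have S': "(\<Sum>j<Suc m. [:monom 1 (e' j):] * P j) = S + [:monom 1 t:] * P m"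
  proof -
    have "(\<Sum>j<m. [:monom 1 (e' j):] * P j) = S"
      unfolding S_def by (intro sum.cong) (auto simp: e'_def)
    thus ?thesis by (simp add: e'_def)
  qed
  show ?case
  proof (intro exI[of _ e'] conjI allI impI)
    show "e' j \<le> n" for j using e t by (simp add: e'_def)
    fix G j assume G: "irreducible G" "0 < degree G" "G dvd R"
      "G dvd (\<Sum>j<Suc m. [:monom 1 (e' j):] * P j)" and j: "j < Suc m"
    have "G dvd S \<and> G dvd P m" using t(2)[of G] G unfolding S' bad_def by blast
    thus "G dvd P j" using e(2)[OF G(1-3)] j unfolding S_def by (metis less_Suc_eq)
  qed
qed auto

text \<open>Two members may share a factor although the whole family has none in common. A generic
  combination \<open>S\<close> is coprime to a fixed nonzero member \<open>R\<close> and inherits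
  the bounds up to the factor \<open>q^n\<close>, so the bound for two coprime polynomials
  applies.\<close>

lemma double_root_family_bound:
  fixes P :: "nat \<Rightarrow> 'a::{field,finite} poly poly"
  assumes n: "1 \<le> n" and deg: "\<And>j. j < m \<Longrightarrow> degree (P j) \<le> n"
    and nz: "\<exists>j<m. P j \<noteq> 0"
    and no_common: "\<not> (\<exists>G. irreducible G \<and> 0 < degree G \<and> (\<forall>j<m. G dvd P j))"
    and \<delta>: "0 < \<delta>" "\<delta> \<le> 1" and h: "1 \<le> h"
    and b: "\<And>j i. j < m \<Longrightarrow> fls_abs (coeff (taylor (P j) \<xi>) i) \<le> h"
      "\<And>j. j < m \<Longrightarrow> fls_abs (coeff (taylor (P j) \<xi>) 0) \<le> h * \<delta>\<^sup>2"
      "\<And>j. j < m \<Longrightarrow> fls_abs (coeff (taylor (P j) \<xi>) 1) \<le> h * \<delta>"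
  shows "1 \<le> (real CARD('a) ^ n * h) ^ (2 * n + 1) * \<delta> ^ 4"
proof -
  define q where "q = real CARD('a)"
  have q: "1 < q" unfolding q_def by (rule real_CARD_field_gt_1)
  define h' where "h' = q ^ n * h"
  have qn: "1 \<le> q ^ n" using q by (intro one_le_power) simp
  have hh': "h \<le> h'" using mult_right_mono[OF qn, of h] h by (simp add: h'_def)
  hence h': "1 \<le> h'" using h by linarith
  obtain j where j: "j < m" "P j \<noteq> 0" using nz by blast
  define R where "R = P j"
  have R: "R \<noteq> 0" "degree R \<le> n" using j deg by (auto simp: R_def)
  have mono: "x \<le> h' * y" if "x \<le> h * y" "0 \<le> y" for x y
    using that mult_right_mono[OF hh' that(2)] by linarith
  have bR: "fls_abs (coeff (taylor R \<xi>) i) \<le> h'" "fls_abs (coeff (taylor R \<xi>) 0) \<le> h' * \<delta>\<^sup>2"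
    "fls_abs (coeff (taylor R \<xi>) 1) \<le> h' * \<delta>" for i
    using b(1)[OF j(1), of i] mono[OF b(2)[OF j(1)]] mono[OF b(3)[OF j(1)]] hh' \<delta> by (auto simp: R_def)
  have "1 \<le> h' ^ (2 * n + 1) * \<delta> ^ 4"
  proof (cases "degree R = 0")
    \<comment> \<open>A constant \<open>R\<close> is paired with itself, as the argument for
      \<open>S \<noteq> 0\<close> relies on a factor of \<open>R\<close> of positive degree.\<close>
    case True
    then obtain a where a: "R = [:a:]" by (auto elim!: degree_eq_zeroE)
    have "a \<noteq> 0" "1 * R + 0 * R = [:a:]" using R a by auto
    thus ?thesis
      by (intro coprime_double_root_bound[of a 1 R 0 R n \<delta> h' \<xi>] R n \<delta> h' bR)
  next
    case False
    obtain e where e: "\<And>j. e j \<le> n" "\<And>G. irreducible G \<Longrightarrow> 0 < degree G \<Longrightarrow> G dvd R \<Longrightarrow>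
      G dvd (\<Sum>j<m. [:monom 1 (e j):] * P j) \<Longrightarrow> \<forall>j<m. G dvd P j"
      using generic_combination[OF R, where m = m and P = P] by blast
    define S where "S = (\<Sum>j<m. [:monom 1 (e j):] * P j)"
    have nc: "\<not> (\<exists>G. irreducible G \<and> 0 < degree G \<and> G dvd R \<and> G dvd S)"
      using e(2) no_common unfolding S_def by blast
    have S0: "S \<noteq> 0"
    proof
      assume "S = 0"
      moreover obtain G where "irreducible G" "0 < degree G" "G dvd R"
        using irreducible_factor_of_pos_degree[of R] False by blast
      ultimately show False using nc by (metis dvd_0_right)
    qed
    have degS: "degree S \<le> n"
      unfolding S_def
    proof (rule degree_sum_le)
      fix j assume "j \<in> {..<m}"
      thus "degree ([:monom 1 (e j):] * P j) \<le> n"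
        using degree_mult_le[of "[:monom 1 (e j):]" "P j"] deg[of j] by simp
    qed simp
    have tS: "coeff (taylor S \<xi>) i = (\<Sum>j<m. poly_to_fls (monom 1 (e j)) * coeff (taylor (P j) \<xi>) i)" for i
      by (simp add: S_def taylor_sum taylor_mult taylor_const coeff_sum del: mult_pCons_left) simp
    have bS: "fls_abs (coeff (taylor S \<xi>) i) \<le> h' * y"
      if "\<And>j. j < m \<Longrightarrow> fls_abs (coeff (taylor (P j) \<xi>) i) \<le> h * y" "0 \<le> y" for i y
      unfolding tS
    proof (rule fls_abs_sum_le)
      fix j assume "j \<in> {..<m}"
      hence j: "j < m" by simp
      have "fls_abs (poly_to_fls (monom 1 (e j) :: 'a poly)) = q ^ e j"
        by (subst fls_abs_poly_to_fls) (auto simp: q_def degree_monom_eq)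
      also have "\<dots> \<le> q ^ n" using e(1) q by (intro power_increasing) auto
      finally have "fls_abs (poly_to_fls (monom 1 (e j) :: 'a poly)) * fls_abs (coeff (taylor (P j) \<xi>) i) \<le> q ^ n * (h * y)"
        using that(1)[OF j] q by (intro mult_mono) auto
      thus "fls_abs (poly_to_fls (monom 1 (e j)) * coeff (taylor (P j) \<xi>) i) \<le> h' * y"
        by (simp add: fls_abs_mult h'_def mult.assoc)
    qed (use that(2) h' in simp)
    obtain U V c where Bezout: "c \<noteq> 0" "U * R + V * S = [:c:]"
    proof -
      from Bezout_or_common_factor[OF R(1), of S] have "\<exists>U V c. c \<noteq> 0 \<and> U * R + V * S = [:c:]"
      proof
        assume "\<exists>G. irreducible G \<and> 0 < degree G \<and> G dvd R \<and> G dvd S"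
        with nc show ?thesis by (rule notE)
      qed assumption
      thus thesis by (elim exE conjE) (rule that)
    qed
    show ?thesis
    proof (rule coprime_double_root_bound[OF Bezout R(1) S0 R(2) degS n \<delta> h' bR])
      show "fls_abs (coeff (taylor S \<xi>) i) \<le> h'" for i using bS[of i 1] b(1) by simp
      show "fls_abs (coeff (taylor S \<xi>) 0) \<le> h' * \<delta>\<^sup>2" using bS[of 0 "\<delta>\<^sup>2"] b(2) by simp
      show "fls_abs (coeff (taylor S \<xi>) 1) \<le> h' * \<delta>" using bS[of 1 \<delta>] b(3) \<delta> by simp
    qed
  qed
  thus ?thesis by (simp add: h'_def q_def)
qed

subsection \<open>Frobenius invariance of \<open>w\<^sub>n\<^sup>*\<close>\<close>

text \<open>For rational \<xi> there is no positive degree below \<open>deg F\<close> in which to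
  run the Wirsing-type argument. The elements \<open>\<xi> + T^(-m)\<close> lie at distance
  \<open>q^(-m)\<close> and have height at most a constant times \<open>q^m\<close>, enough for
  every negative exponent.\<close>

lemma infinite_w_star_set_rational:
  fixes \<xi> :: "'a::{field,finite} fls"
  assumes F: "irreducible F" "degree F = 1" "eval_fls F \<xi> = 0"
    and n: "1 \<le> n" and w: "- 1 \<le> w" "w < 0"
  shows "infinite (w_star_set n \<xi> w)"
proof (rule w_star_set_infiniteI)
  fix \<epsilon> :: real assume \<epsilon>: "0 < \<epsilon>"
  define q where "q = real CARD('a)"
  have q: "1 < q" unfolding q_def by (rule real_CARD_field_gt_1)
  define f0 where "f0 = coeff F 0"
  define f1 where "f1 = coeff F 1"
  have F_eq: "F = [:f0, f1:]"
    by (rule poly_eqI) (auto simp: f0_def f1_def coeff_pCons coeff_eq_0 F(2) split: nat.splits)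
  have f1: "f1 \<noteq> 0" using F(2) by (auto simp: F_eq split: if_splits)
  define C where "C = height_poly F"
  have C: "1 \<le> C" unfolding C_def using f1 by (intro height_poly_ge_1) (auto simp: F_eq)
  obtain Y1 where Y1: "1 \<le> Y1" "\<And>Y. Y1 \<le> Y \<Longrightarrow> Y powr (- (- w)) < 1 / C powr (w + 1)"
    using powr_neg_eventually_less[of "- w" "1 / C powr (w + 1)"] w C by auto
  obtain Y2 where Y2: "1 \<le> Y2" "\<And>Y. Y2 \<le> Y \<Longrightarrow> Y powr (- 1) < \<epsilon>"
    using powr_neg_eventually_less[of 1 \<epsilon>] \<epsilon> by auto
  obtain m where m: "max Y1 Y2 < q ^ m" using real_arch_pow[OF q] by blast
  define Y where "Y = q ^ m"
  have Y: "1 \<le> Y" "Y1 \<le> Y" "Y2 \<le> Y" using m Y1 by (auto simp: Y_def)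
  define T :: "'a poly" where "T = monom 1 m"
  have T: "poly_to_fls T * fls_X ^ m = 1"
    by (auto simp: T_def fls_eq_iff poly_to_fls_nth fls_X_power_times_conv_shift)
  have absT: "fls_abs (poly_to_fls T) = Y"
    unfolding T_def by (subst fls_abs_poly_to_fls) (auto simp: Y_def q_def degree_monom_eq)
  define \<alpha> where "\<alpha> = \<xi> + fls_X ^ m"
  \<comment> \<open>\<open>F(\<alpha>) = f1 * fls_X ^ m\<close>, so \<open>T * F - f1\<close>
    vanishes at \<alpha>; here \<open>T\<close> is the m-th power of the variable.\<close>
  define P where "P = [:f0 * T - f1, f1 * T:]"
  have T0: "T \<noteq> 0" by (simp add: T_def)
  have P: "P \<noteq> 0" "degree P \<le> n" using f1 T0 n by (auto simp: P_def)
  have root: "poly_to_fls f0 + poly_to_fls f1 * \<xi> = 0" using F(3) unfolding F_eq eval_fls_linear .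
  have "eval_fls P \<alpha> = poly_to_fls T * (poly_to_fls f0 + poly_to_fls f1 * \<xi>) +
    poly_to_fls f1 * (poly_to_fls T * fls_X ^ m) - poly_to_fls f1"
    unfolding P_def eval_fls_linear \<alpha>_def poly_to_fls_hom.hom_minus poly_to_fls_hom.hom_mult
    by (simp add: algebra_simps)
  hence ev: "eval_fls P \<alpha> = 0" using root T by simp
  note r = root_degree_height_le[OF P(1) ev]
  have cF: "fls_abs (poly_to_fls f0) \<le> C" "fls_abs (poly_to_fls f1) \<le> C"
    unfolding f0_def f1_def C_def by (rule coeff_le_height_poly)+
  have CY: "fls_abs (poly_to_fls f0 * poly_to_fls T) \<le> C * Y" "fls_abs (poly_to_fls f1 * poly_to_fls T) \<le> C * Y"
    unfolding fls_abs_mult absT using cF Y by (auto intro: mult_right_mono)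
  have "C * 1 \<le> C * Y" using C Y by (intro mult_left_mono) auto
  hence "fls_abs (poly_to_fls f1) \<le> C * Y" using cF by linarith
  hence HP: "height_poly P \<le> C * Y"
    using CY C Y by (subst height_poly_le_iff)
      (auto simp: P_def coeff_pCons poly_to_fls_hom.hom_minus poly_to_fls_hom.hom_mult
        intro: fls_abs_diff_le split: nat.splits)
  have dist: "fls_abs (\<xi> - \<alpha>) = 1 / Y"
  proof -
    have "fls_abs (\<xi> - \<alpha>) = fls_abs (fls_X ^ m :: 'a fls)" by (simp add: \<alpha>_def)
    moreover have "Y * fls_abs (fls_X ^ m :: 'a fls) = 1"
      using arg_cong[OF T, of fls_abs] by (simp add: fls_abs_mult absT)
    ultimately show ?thesis using Y by (simp add: field_simps)
  qed
  have "1 / Y < (C * Y) powr (- w - 1)"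
  proof -
    define t where "t = C powr (w + 1) * (Y powr w * Y)"
    have "C powr (w + 1) * Y powr w < 1" using Y1(2)[OF Y(2)] C by (simp add: field_simps)
    hence "C powr (w + 1) * Y powr w * Y < 1 * Y" using Y(1) by (intro mult_strict_right_mono) auto
    hence "t < Y" by (simp add: t_def mult.assoc)
    moreover have "0 < t" unfolding t_def using C Y(1) by (intro mult_pos_pos) auto
    ultimately have "1 / Y < 1 / t" by (simp add: frac_less2)
    moreover have "(C * Y) powr (- w - 1) = 1 / (C powr (w + 1) * (Y powr w * Y))"
    proof -
      have "(C * Y) powr (- w - 1) = 1 / (C * Y) powr (w + 1)"
        using powr_minus_divide[of "C * Y" "w + 1"] by simp
      also have "(C * Y) powr (w + 1) = C powr (w + 1) * (Y powr w * Y)"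
        using C Y by (simp add: powr_mult powr_add)
      finally show ?thesis .
    qed
    ultimately show ?thesis by (simp add: t_def)
  qed
  also have "(C * Y) powr (- w - 1) \<le> height_fls \<alpha> powr (- w - 1)"
    using w r(3) HP height_fls_ge_1[OF r(1)] by (intro powr_mono2') auto
  finally have "\<alpha> \<in> w_star_set n \<xi> w"
    using r(1,2) P(2) Y(1) unfolding w_star_set_def mem_Collect_eq dist by simp
  moreover have "1 / Y < \<epsilon>" using Y2(2)[OF Y(3)] Y(1) by (simp add: powr_minus_divide)
  ultimately show "\<exists>\<alpha>\<in>w_star_set n \<xi> w. fls_abs (\<xi> - \<alpha>) < \<epsilon>"
    using dist by (intro bexI[of _ \<alpha>]) auto
qed

text \<open>No nonzero polynomial of degree below \<open>deg F\<close> vanishes at \<xi>, so for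
  \<open>deg F > 1\<close> the Wirsing-type bound applies in degree \<open>deg F - 1\<close>, where
  its threshold is \<open>deg F / 2\<close>.\<close>

lemma infinite_w_star_set_algebraic:
  fixes \<xi> :: "'a::{field,finite} fls"
  assumes F: "irreducible F" "0 < degree F" "eval_fls F \<xi> = 0"
    and n: "degree F \<le> n" and M: "0 \<le> M" "M < real (degree F) / 2"
  shows "infinite (w_star_set n \<xi> (M - 1))"
proof (cases "degree F = 1")
  case True
  thus ?thesis using F n M by (intro infinite_w_star_set_rational[of F]) auto
next
  case False
  have "infinite (w_star_set (degree F - 1) \<xi> (M - 1))"
  proof (rule infinite_w_star_set_Wirsing)
    fix P :: "'a poly poly" assume P: "P \<noteq> 0" "degree P \<le> degree F - 1"
    show "eval_fls P \<xi> \<noteq> 0"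
    proof
      assume "eval_fls P \<xi> = 0"
      hence "degree F \<le> degree P"
        using irreducible_root_unique[OF F] P(1) dvd_imp_degree_le by blast
      with P(2) F(2) show False by simp
    qed
  qed (use False F M in \<open>auto simp: of_nat_diff\<close>)
  moreover have "w_star_set (degree F - 1) \<xi> (M - 1) \<subseteq> w_star_set n \<xi> (M - 1)"
    using n by (auto simp: w_star_set_def)
  ultimately show ?thesis using finite_subset by blast
qed

text \<open>If the set were finite, \<open>v + 1\<close> would be at least the Wirsing-type
  threshold, so \<open>M = w + 1\<close> would strictly exceed it. The second alternative of the
  dichotomy then fails for all large heights, and the first one provides approximations of \<xi>
  after all.\<close>

lemma infinite_w_star_set_transfer:
  fixes \<xi> :: "'a::{field,finite} fls"
  assumes n: "1 \<le> n" and inf: "infinite (w_star_set n (\<xi> ^ CHAR('a)) w)" and v: "- 1 \<le> v" "v < w"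
  shows "infinite (w_star_set n \<xi> v)"
proof (rule ccontr)
  assume fin: "\<not> infinite (w_star_set n \<xi> v)"
  define p where "p = CHAR('a)"
  have p0: "0 < p" unfolding p_def by (rule CHAR_pos_finite_field)
  define q where "q = real CARD('a)"
  have q: "1 < q" unfolding q_def by (rule real_CARD_field_gt_1)
  define M where "M = w + 1"
  have M: "0 < M" using v by (simp add: M_def)
  define C where "C = max 1 (fls_abs (\<xi> ^ CHAR('a))) ^ n"
  have C1: "1 \<le> C" unfolding C_def by (intro one_le_power) simp
  define good where "good h d \<longleftrightarrow> (\<exists>\<alpha>. algebraic_fls \<alpha> \<and> degree_fls \<alpha> \<le> n \<and> height_fls \<alpha> \<le> q * h \<and>
      0 < fls_abs (\<xi> - \<alpha>) \<and> fls_abs (\<xi> - \<alpha>) \<le> d)" for h d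
  define bad where "bad h d \<longleftrightarrow> (\<exists>Q. degree Q \<le> n \<and> eval_fls Q (\<xi> ^ p) \<noteq> 0 \<and> h ^ p = height_poly Q \<and>
     \<not> (\<exists>G. irreducible G \<and> 0 < degree G \<and> (\<forall>j<p. G dvd poly_sect j Q)) \<and>
     (\<forall>j<p. fls_abs (coeff (taylor (poly_sect j Q) \<xi>) 0) \<le> C * h * d\<^sup>2 \<and>
       fls_abs (coeff (taylor (poly_sect j Q) \<xi>) 1) \<le> C * h * d))" for h d
  have choice: "\<exists>h d. X \<le> h \<and> 1 \<le> h \<and> 0 < d \<and> d \<le> 1 \<and> d < h powr (- M) \<and> (good h d \<or> bad h d)" for X
  proof -
    \<comment> \<open>Exceeding the height of \<xi>^p excludes that \<beta> and \<xi>^p have the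
      same minimal polynomial, so \<open>Q\<close> does not vanish at \<xi>^p.\<close>
    define X' where "X' = max (height_fls (\<xi> ^ p)) (max 1 X ^ p)"
    obtain \<beta> where \<beta>: "\<beta> \<in> w_star_set n (\<xi> ^ p) w" "X' < height_fls \<beta>"
      using infinite_w_star_set_obtains_height[OF inf] unfolding p_def by blast
    have alg: "algebraic_fls \<beta>" using \<beta> by (simp add: w_star_set_def)
    define Q where "Q = min_def_poly \<beta>"
    have Q: "irreducible Q" "0 < degree Q" "eval_fls Q \<beta> = 0" "lead_coeff (lead_coeff Q) = 1"
      using min_def_poly[OF alg] by (auto simp: Q_def)
    have degQ: "degree Q \<le> n" using \<beta> by (simp add: w_star_set_def degree_fls_def Q_def)
    have HQ: "height_poly Q = height_fls \<beta>" by (simp add: Q_def height_fls_def)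
    have ev: "eval_fls Q (\<xi> ^ p) \<noteq> 0"
    proof
      assume "eval_fls Q (\<xi> ^ p) = 0"
      hence "min_def_poly (\<xi> ^ p) = Q" using Q by (intro min_def_poly_eqI)
      hence "height_fls (\<xi> ^ p) = height_fls \<beta>" using HQ by (simp add: height_fls_def)
      thus False using \<beta>(2) by (simp add: X'_def)
    qed
    define h where "h = height_poly Q powr (1 / p)"
    define d where "d = fls_abs (\<xi> ^ p - \<beta>) powr (1 / p)"
    have H1: "1 \<le> height_poly Q" using height_fls_ge_1[OF alg] HQ by simp
    have root_pow: "(y powr (1 / p)) ^ p = y" if "0 < y" for y :: real
      using that p0 by (simp add: powr_realpow[symmetric] powr_powr)
    have hp: "h ^ p = height_poly Q" unfolding h_def using H1 by (intro root_pow) simp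
    have h0: "0 < h" unfolding h_def using H1 by simp
    have dist: "0 < fls_abs (\<xi> ^ p - \<beta>)" "fls_abs (\<xi> ^ p - \<beta>) < height_poly Q powr (- M)"
      using \<beta>(1) HQ by (auto simp: w_star_set_def M_def)
    have dp: "d ^ p = fls_abs (\<xi> ^ p - \<beta>)" unfolding d_def using dist by (intro root_pow)
    have d0: "0 < d" unfolding d_def using dist by simp
    have "max 1 X ^ Suc (p - 1) \<le> h ^ Suc (p - 1)" using \<beta>(2) HQ hp p0 by (simp add: X'_def)
    hence hX: "max 1 X \<le> h" by (rule power_le_imp_le_base) (use h0 in simp)
    have "d ^ p < (h powr (- M)) ^ p"
      unfolding dp power_powr[OF h0, symmetric] hp by (rule dist(2))
    hence dM: "d < h powr (- M)" by (rule power_less_imp_less_base) simp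
    also have "h powr (- M) \<le> h powr 0" using hX M by (intro powr_mono) auto
    finally have d1: "d \<le> 1" using h0 by simp
    have ne: "\<beta> \<noteq> \<xi> ^ CHAR('a)" using dist(1) by (auto simp: p_def)
    have "good h d \<or> bad h d"
    proof -
      have "good h d \<or>
       (\<not> (\<exists>G. irreducible G \<and> 0 < degree G \<and> (\<forall>j<CHAR('a). G dvd poly_sect j Q)) \<and>
        (\<forall>j<CHAR('a). fls_abs (coeff (taylor (poly_sect j Q) \<xi>) 0) \<le> C * h * d\<^sup>2 \<and>
          fls_abs (coeff (taylor (poly_sect j Q) \<xi>) 1) \<le> C * h * d))"
        unfolding good_def q_def
        by (rule transfer_dichotomy[OF Q(1,2) degQ Q(3) ne hp[unfolded p_def] h0 d0 d1 dp[unfolded p_def] C_def])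
      thus ?thesis
      proof
        assume "\<not> (\<exists>G. irreducible G \<and> 0 < degree G \<and> (\<forall>j<CHAR('a). G dvd poly_sect j Q)) \<and>
          (\<forall>j<CHAR('a). fls_abs (coeff (taylor (poly_sect j Q) \<xi>) 0) \<le> C * h * d\<^sup>2 \<and>
            fls_abs (coeff (taylor (poly_sect j Q) \<xi>) 1) \<le> C * h * d)"
        hence "bad h d" unfolding bad_def p_def[symmetric] using degQ ev hp by (intro exI[of _ Q]) simp
        thus ?thesis ..
      qed simp
    qed
    thus ?thesis using hX d0 d1 dM by (intro exI[of _ h] exI[of _ d]) auto
  qed
  have ex_section: "\<exists>j<p. eval_fls (poly_sect j Q) \<xi> \<noteq> 0" if "eval_fls Q (\<xi> ^ p) \<noteq> 0" for Q
  proof -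
    obtain j where "j < p" "fls_abs (eval_fls Q (\<xi> ^ p)) = q ^ j * fls_abs (eval_fls (poly_sect j Q) \<xi>) ^ p"
      using taylor_sect_abs(1)[of Q \<xi> 0] unfolding coeff_0_taylor p_def q_def by blast
    with that p0 show ?thesis by (intro exI[of _ j]) (auto simp: zero_power)
  qed
  have height_section: "height_poly (poly_sect j Q) \<le> h" if "j < p" "h ^ p = height_poly Q" "0 < h" for j h and Q :: "'a poly poly"
  proof (rule power_le_imp_le_base)
    show "height_poly (poly_sect j Q) ^ Suc (p - 1) \<le> h ^ Suc (p - 1)"
      using height_poly_sect_le[of j Q] that p0 by (simp add: p_def)
  qed (use that in simp)
  have "\<exists>X. \<forall>h d. X \<le> h \<longrightarrow> 1 \<le> h \<longrightarrow> 0 < d \<longrightarrow> d \<le> 1 \<longrightarrow> d < h powr (- M) \<longrightarrow> \<not> bad h d"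
  proof (cases "\<exists>P. P \<noteq> 0 \<and> degree P \<le> n \<and> eval_fls P \<xi> = 0")
    case True
    then obtain P0 where P0: "P0 \<noteq> 0" "degree P0 \<le> n" "eval_fls P0 \<xi> = 0" by blast
    hence "algebraic_fls \<xi>" unfolding algebraic_fls_def by blast
    define F where "F = min_def_poly \<xi>"
    have F: "irreducible F" "0 < degree F" "eval_fls F \<xi> = 0"
      using min_def_poly[OF \<open>algebraic_fls \<xi>\<close>] by (auto simp: F_def)
    have "degree F \<le> degree P0"
      unfolding F_def using min_def_poly_dvd[OF P0(3,1)] P0(1) by (rule dvd_imp_degree_le)
    hence Fn: "degree F \<le> n" using P0 by simp
    \<comment> \<open>With \<open>D = deg F\<close>, Liouville applied to a section of height at
      most \<open>h\<close> and value at most \<open>C * h * d^2\<close> keeps a constant times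
      \<open>h^(D - 2M)\<close> at least 1; this is impossible for large \<open>h\<close> once
      \<open>2 * M > D\<close>.\<close>
    have "\<not> v + 1 < real (degree F) / 2"
      using infinite_w_star_set_algebraic[OF F Fn, of "v + 1"] fin v by auto
    hence dM: "0 < 2 * M - real (degree F)" using v by (simp add: M_def)
    obtain C2 where C2: "0 < C2" "\<And>P. degree P \<le> n \<Longrightarrow> eval_fls P \<xi> \<noteq> 0 \<Longrightarrow>
      1 \<le> C2 * height_poly P ^ (degree F - 1) * fls_abs (eval_fls P \<xi>)"
      using Liouville_bound[OF F, of n] by blast
    obtain X where X: "\<And>H. X \<le> H \<Longrightarrow> H powr (- (2 * M - real (degree F))) < 1 / (C2 * C)"
      using powr_neg_eventually_less[OF dM, of "1 / (C2 * C)"] C1 C2(1) by auto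
    have "\<not> bad h d" if hd: "X \<le> h" "1 \<le> h" "0 < d" "d \<le> 1" "d < h powr (- M)" for h d
    proof
      assume "bad h d"
      then obtain Q where Q: "degree Q \<le> n" "eval_fls Q (\<xi> ^ p) \<noteq> 0" "h ^ p = height_poly Q"
        "\<And>j. j < p \<Longrightarrow> fls_abs (coeff (taylor (poly_sect j Q) \<xi>) 0) \<le> C * h * d\<^sup>2" unfolding bad_def by blast
      obtain j where j: "j < p" "eval_fls (poly_sect j Q) \<xi> \<noteq> 0" using ex_section[OF Q(2)] by blast
      have H: "height_poly (poly_sect j Q) \<le> h" using height_section[OF j(1) Q(3)] hd by simp
      have "1 \<le> C2 * height_poly (poly_sect j Q) ^ (degree F - 1) * fls_abs (eval_fls (poly_sect j Q) \<xi>)"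
        using degree_poly_sect_le[of j Q] Q(1) j(2) by (intro C2(2)) auto
      also have "\<dots> \<le> C2 * h ^ (degree F - 1) * (C * h * d\<^sup>2)"
        using C2(1) H hd Q(4)[OF j(1)] by (intro mult_mono power_mono) (auto simp: coeff_0_taylor)
      also have "\<dots> = C2 * C * (h ^ degree F * d\<^sup>2)"
      proof -
        have "h ^ degree F = h ^ (degree F - 1) * h" using F(2) by (metis power_minus_mult)
        thus ?thesis by simp
      qed
      also have "\<dots> \<le> C2 * C * (h ^ degree F * (h powr (- M))\<^sup>2)"
        using hd C1 C2(1) by (intro mult_left_mono power_mono) auto
      also have "h ^ degree F * (h powr (- M))\<^sup>2 = h powr (- (2 * M - real (degree F)))"
      proof -
        have "h ^ degree F = h powr real (degree F)" using hd by (simp add: powr_realpow)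
        moreover have "(h powr (- M))\<^sup>2 = h powr (- M + - M)" unfolding power2_eq_square by (simp only: powr_add)
        ultimately have "h ^ degree F * (h powr (- M))\<^sup>2 = h powr (real (degree F) + (- M + - M))"
          by (simp only: powr_add)
        also have "real (degree F) + (- M + - M) = - (2 * M - real (degree F))" by simp
        finally show ?thesis .
      qed
      also have "C2 * C * \<dots> < C2 * C * (1 / (C2 * C))"
        using X[OF hd(1)] C1 C2(1) by (intro mult_strict_left_mono) auto
      finally show False using C1 C2(1) by simp
    qed
    thus ?thesis by blast
  next
    case False
    \<comment> \<open>From \<open>M > v + 1 \<ge> (n + 1) / 2\<close> follows
      \<open>4 * M > 2 * n + 2\<close>, more than the \<open>2 * n + 1\<close> needed against the
      double root bound.\<close>
    have "\<not> v + 1 < (real n + 1) / 2"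
    proof
      assume "v + 1 < (real n + 1) / 2"
      hence "infinite (w_star_set n \<xi> (v + 1 - 1))"
        using v False by (intro infinite_w_star_set_Wirsing[OF n]) auto
      with fin show False by simp
    qed
    hence dM: "0 < 4 * M - real (2 * n + 1)" using v by (simp add: M_def)
    define C2 where "C2 = (q ^ n * C) ^ (2 * n + 1)"
    have C2: "0 < C2" using q C1 by (simp add: C2_def)
    obtain X where X: "\<And>H. X \<le> H \<Longrightarrow> H powr (- (4 * M - real (2 * n + 1))) < 1 / C2"
      using powr_neg_eventually_less[OF dM, of "1 / C2"] C2 by auto
    have "\<not> bad h d" if hd: "X \<le> h" "1 \<le> h" "0 < d" "d \<le> 1" "d < h powr (- M)" for h d
    proof
      assume "bad h d"
      then obtain Q where Q: "degree Q \<le> n" "eval_fls Q (\<xi> ^ p) \<noteq> 0" "h ^ p = height_poly Q"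
        "\<not> (\<exists>G. irreducible G \<and> 0 < degree G \<and> (\<forall>j<p. G dvd poly_sect j Q))"
        "\<And>j. j < p \<Longrightarrow> fls_abs (coeff (taylor (poly_sect j Q) \<xi>) 0) \<le> C * h * d\<^sup>2"
        "\<And>j. j < p \<Longrightarrow> fls_abs (coeff (taylor (poly_sect j Q) \<xi>) 1) \<le> C * h * d" unfolding bad_def by blast
      have "1 \<le> (real CARD('a) ^ n * (C * h)) ^ (2 * n + 1) * d ^ 4"
      proof (rule double_root_family_bound[OF n, of p "\<lambda>j. poly_sect j Q" d "C * h" \<xi>])
        show "degree (poly_sect j Q) \<le> n" for j using degree_poly_sect_le[of j Q] Q(1) by simp
        show "\<exists>j<p. poly_sect j Q \<noteq> 0" using ex_section[OF Q(2)] by fastforce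
        show "1 \<le> C * h" using mult_mono[OF C1 hd(2)] C1 by simp
        fix j i assume j: "j < p"
        have "max 1 (fls_abs \<xi>) ^ degree (poly_sect j Q) \<le> C"
        proof -
          have "fls_abs \<xi> \<le> max 1 (fls_abs (\<xi> ^ CHAR('a)))"
          proof (cases "fls_abs \<xi> \<le> 1")
            case False
            hence "fls_abs \<xi> \<le> fls_abs \<xi> ^ CHAR('a)" using p0 unfolding p_def by (intro self_le_power) auto
            thus ?thesis by (simp add: fls_abs_power)
          qed simp
          hence "max 1 (fls_abs \<xi>) \<le> max 1 (fls_abs (\<xi> ^ CHAR('a)))" by simp
          hence "max 1 (fls_abs \<xi>) ^ degree (poly_sect j Q) \<le> max 1 (fls_abs (\<xi> ^ CHAR('a))) ^ degree (poly_sect j Q)"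
            by (intro power_mono) auto
          also have "\<dots> \<le> C" unfolding C_def using degree_poly_sect_le[of j Q] Q(1) by (intro power_increasing) auto
          finally show ?thesis .
        qed
        hence "height_poly (poly_sect j Q) * max 1 (fls_abs \<xi>) ^ degree (poly_sect j Q) \<le> h * C"
          using height_section[OF j Q(3)] hd by (intro mult_mono) auto
        thus "fls_abs (coeff (taylor (poly_sect j Q) \<xi>) i) \<le> C * h"
          using coeff_taylor_le[of "poly_sect j Q" \<xi> i] by (simp add: mult.commute)
      qed (use Q hd in auto)
      also have "\<dots> = C2 * (h ^ (2 * n + 1) * d ^ 4)"
        by (simp only: C2_def q_def power_mult_distrib mult.assoc)
      also have "\<dots> \<le> C2 * (h ^ (2 * n + 1) * (h powr (- M)) ^ 4)"
        using hd C2 by (intro mult_left_mono power_mono) auto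
      also have "h ^ (2 * n + 1) * (h powr (- M)) ^ 4 = h powr (- (4 * M - real (2 * n + 1)))"
      proof -
        have "h ^ (2 * n + 1) = h powr real (2 * n + 1)" using hd by (intro powr_realpow[symmetric]) simp
        moreover have "(h powr (- M)) ^ 4 = h powr (- M + - M + - M + - M)"
          by (simp only: power4_eq_xxxx powr_add mult.assoc)
        ultimately have "h ^ (2 * n + 1) * (h powr (- M)) ^ 4 = h powr (real (2 * n + 1) + (- M + - M + - M + - M))"
          by (simp only: powr_add)
        also have "real (2 * n + 1) + (- M + - M + - M + - M) = - (4 * M - real (2 * n + 1))" by simp
        finally show ?thesis .
      qed
      also have "C2 * \<dots> < C2 * (1 / C2)"
        using X[OF hd(1)] C2 by (intro mult_strict_left_mono) auto
      finally show False using C2 by simp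
    qed
    thus ?thesis by blast
  qed
  then obtain X where no_bad: "\<And>h d. X \<le> h \<Longrightarrow> 1 \<le> h \<Longrightarrow> 0 < d \<Longrightarrow> d \<le> 1 \<Longrightarrow> d < h powr (- M) \<Longrightarrow> \<not> bad h d"
    by blast
  have "infinite (w_star_set n \<xi> v)"
  proof (rule w_star_set_infiniteI)
    fix \<epsilon> :: real assume \<epsilon>: "0 < \<epsilon>"
    obtain X1 where X1: "\<And>H. X1 \<le> H \<Longrightarrow> H powr (- M) < \<epsilon>"
      using powr_neg_eventually_less[OF M \<epsilon>] by auto
    \<comment> \<open>The gap \<open>w - v\<close> pays for the factor \<open>q\<close> in the bound
      \<open>q * h\<close> on the height of \<alpha>.\<close>
    obtain X2 where X2: "\<And>H. X2 \<le> H \<Longrightarrow> H powr (- (w - v)) < q powr (- v - 1)"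
      using powr_neg_eventually_less[of "w - v" "q powr (- v - 1)"] v q by auto
    obtain h d where hd: "max X (max X1 X2) \<le> h" "1 \<le> h" "0 < d" "d \<le> 1" "d < h powr (- M)" "good h d \<or> bad h d"
      using choice[of "max X (max X1 X2)"] by blast
    hence "good h d" using no_bad[of h d] by auto
    then obtain \<alpha> where \<alpha>: "algebraic_fls \<alpha>" "degree_fls \<alpha> \<le> n" "height_fls \<alpha> \<le> q * h"
      "0 < fls_abs (\<xi> - \<alpha>)" "fls_abs (\<xi> - \<alpha>) \<le> d" unfolding good_def by blast
    have "- M = - (w - v) + (- v - 1)" by (simp add: M_def)
    hence "h powr (- M) = h powr (- (w - v)) * h powr (- v - 1)" by (simp only: powr_add)
    also have "\<dots> \<le> q powr (- v - 1) * h powr (- v - 1)"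
      using X2[of h] hd by (intro mult_right_mono) auto
    also have "\<dots> = (q * h) powr (- v - 1)" using q hd by (simp add: powr_mult)
    also have "\<dots> \<le> height_fls \<alpha> powr (- v - 1)"
      using \<alpha> v height_fls_ge_1[OF \<alpha>(1)] by (intro powr_mono2') auto
    finally have "fls_abs (\<xi> - \<alpha>) < height_fls \<alpha> powr (- v - 1)" using \<alpha> hd by linarith
    moreover have "fls_abs (\<xi> - \<alpha>) < \<epsilon>" using X1[of h] \<alpha> hd by simp
    ultimately show "\<exists>\<alpha>\<in>w_star_set n \<xi> v. fls_abs (\<xi> - \<alpha>) < \<epsilon>"
      using \<alpha> by (intro bexI[of _ \<alpha>]) (auto simp: w_star_set_def)
  qed
  with fin show False by contradiction
qed

lemma w_star_exp_frob:
  fixes \<xi> :: "'a::{field,finite} fls"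
  assumes n: "1 \<le> n"
  shows "w_star_exp n (\<xi> ^ CHAR('a)) = w_star_exp n \<xi>"
proof (rule antisym)
  show "w_star_exp n \<xi> \<le> w_star_exp n (\<xi> ^ CHAR('a))" by (rule w_star_exp_le_frob[OF n])
  have "ereal w \<le> w_star_exp n \<xi>" if inf: "infinite (w_star_set n (\<xi> ^ CHAR('a)) w)" for w
  proof (rule ereal_le_if_less_le)
    fix v assume "v < w"
    have "ereal (- 1) \<le> w_star_exp n \<xi>"
      using w_star_exp_upper infinite_w_star_set_minus_1[OF n] by blast
    show "ereal v \<le> w_star_exp n \<xi>"
    proof (cases "- 1 \<le> v")
      case True
      thus ?thesis using w_star_exp_upper infinite_w_star_set_transfer[OF n inf] \<open>v < w\<close> by blast
    next
      case False
      hence "ereal v \<le> ereal (- 1)" by simp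
      with \<open>ereal (- 1) \<le> w_star_exp n \<xi>\<close> show ?thesis by (rule order_trans[rotated])
    qed
  qed
  thus "w_star_exp n (\<xi> ^ CHAR('a)) \<le> w_star_exp n \<xi>"
    unfolding w_star_exp_alt[of n "\<xi> ^ CHAR('a)"] by (intro Sup_least) auto
qed

theorem theorem1p7:
  fixes p q n :: nat and \<xi> :: "'a::{field,finite} fls"
  assumes "prime p"
    and "\<exists>m\<ge>1. q = p ^ m"
    and "CARD('a) = q"
    and "n \<ge> 1"
  shows "w_exp n \<xi> = w_exp n (\<xi> ^ p) \<and> w_star_exp n \<xi> = w_star_exp n (\<xi> ^ p)"
proof -
  obtain m where "CARD('a) = p ^ m" using assms(2,3) by blast
  hence p: "CHAR('a) = p" using CHAR_eq_of_CARD assms(1) by blast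
  show ?thesis
    using w_exp_frob[OF assms(4), of \<xi>] w_star_exp_frob[OF assms(4), of \<xi>] unfolding p by simp
qed

end
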